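(* Let $(G_N)_{N\ge1}$ be a sequence of generalized random graphs $\mathrm{GRG}_N(\boldsymbol w)$ whose deterministic weights satisfy the weight regularity condition with limiting random variable $W$. Then the following conclusions hold. (i) For all $0\le\beta<\infty$ and all $B\in\mathbb R$, the annealed pressure exists in the thermodynamic limit $N\to\infty$, i.e. $\widetilde\psi(\beta,B):=\lim_{N\to\infty}\widetilde\psi_N(\beta,B)$ exists, and its value is $$\widetilde\psi(\beta,B)=\log 2+\alpha(\beta)+\mathbb E\Big[\log\cosh\Big(\sqrt{\tfrac{\sinh(\beta)}{\mathbb E[W]}}\,W z^*(\beta,B)+B\Big)\Big]-\frac{z^*(\beta,B)^2}{2},$$ where $\alpha(\beta)$ is defined in the context and $z^*(\beta,B)$ is the supremum point in $\sup_{z}\big\{\mathbb E\big[\log\cosh\big(\sqrt{\sinh(\beta)/\mathbb E[W]}\,Wz+B\big)\big]-z^2/2\big\}$, the equation defining it being the fixed-point equation displayed in (ii). (ii) For all $(\beta,B)\in\mathcal U^{\mathrm{an}}$, the magnetization per vertex exists in the limit $N\to\infty$, i.e. $\widetilde M(\beta,B):=\lim_{N\to\infty}\widetilde M_N(\beta,B)$ exists. For $B\ne0$ the limit value equals $\widetilde M(\beta,B)=\frac{\partial}{\partial B}\widetilde\psi(\beta,B)$ and is given by $$\widetilde M(\beta,B)=\mathbb E\Big[\tanh\Big(\sqrt{\tfrac{\sinh(\beta)}{\mathbb E[W]}}\,W z^*+B\Big)\Big],$$ where $z^*=z^*(\beta,B)$ is the solution of the fixed-point equation $$z=\mathbb E\Big[\tanh\Big(\sqrt{\tfrac{\sinh(\beta)}{\mathbb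 E[W]}}\,W z+B\Big)\sqrt{\tfrac{\sinh(\beta)}{\mathbb E[W]}}\,W\Big].$$ (iii) The spontaneous magnetization is given by $$\widetilde{\mathcal M}(\beta):=\lim_{B\to0^+}\widetilde M(\beta,B)\;\begin{cases}=0 & \text{if }\beta\in\mathcal U^{\mathrm{an}},\\ \neq0 & \text{if }\beta\notin\mathcal U^{\mathrm{an}},\end{cases}$$ and the annealed critical inverse temperature is $\beta_c^{\mathrm{an}}=\operatorname{asinh}(1/\nu)$, where $\nu=\mathbb E[W^2]/\mathbb E[W]$. In particular, if $\nu>1$, then $\beta_c^{\mathrm{an}}<\beta_c^{\mathrm{qu}}$, where $\beta_c^{\mathrm{qu}}=\operatorname{atanh}(1/\nu)$ is the quenched critical inverse temperature. (iv) For all $(\beta,B)\in\mathcal U^{\mathrm{an}}$, the thermodynamic limit of the susceptibility exists and is given by $$\widetilde\chi(\beta,B):=\lim_{N\to\infty}\widetilde\chi_N(\beta,B)=\frac{\partial^2}{\partial B^2}\widetilde\psi(\beta,B).$$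
   Context: Generalized random graph: for each $N$, let $\boldsymbol w=(w_i)_{i\in[N]}$ be deterministic weights $w_i>0$, $[N]=\{1,\dots,N\}$, and $\ell_N=\sum_{i=1}^N w_i$. In $\mathrm{GRG}_N(\boldsymbol w)$ with vertex set $[N]$, the edges $\{i,j\}$, $i<j$, are present independently with probability $p_{ij}=\frac{w_iw_j}{\ell_N+w_iw_j}$. Let $W_N=w_{I_N}$ with $I_N$ uniform in $[N]$. Weight regularity condition: there is a random variable $W$ such that, as $N\to\infty$, (a) $W_N\to W$ in distribution; (b) $\mathbb E[W_N]=\frac1N\sum_i w_i\to\mathbb E[W]<\infty$; (c) $\mathbb E[W_N^2]=\frac1N\sum_i w_i^2\to\mathbb E[W^2]<\infty$; and $\mathbb E[W]>0$. Annealed Ising model: let $Q_N$ denote the law of the random graph $G_N=([N],E_N)$ and also the corresponding expectation. For $\beta\ge0$, $B\in\mathbb R$ the annealed measure on $\sigma\in\{-1,1\}^N$ is $$\widetilde P_N(\sigma)=\frac{Q_N\big(\exp[\beta\sum_{(i,j)\in E_N}\sigma_i\sigma_j+B\sum_{i\in[N]}\sigma_i]\big)}{Q_N(Z_N(\beta,B))},\qquad Z_N(\beta,B)=\sum_{\sigma\in\{-1,1\}^N}\exp\Big[\beta\sum_{(i,j)\in E_N}\sigma_i\sigma_j+B\sum_{i\in[N]}\sigma_i\Big]$$ (each edge counted once). $\widetilde P_N(\cdot)$ also denotes expectation. Total spin $S_N=\sum_{i\in[N]}\sigma_i$; annealed pressure $\widetilde\psi_N(\beta,B)=\frac1N\log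 Q_N(Z_N(\beta,B))$; annealed magnetization $\widetilde M_N(\beta,B)=\widetilde P_N(S_N/N)$; annealed susceptibility $\widetilde\chi_N(\beta,B)=\frac{\partial}{\partial B}\widetilde M_N(\beta,B)=\mathrm{Var}_{\widetilde P_N}(S_N/\sqrt N)$. The annealed critical inverse temperature is $\beta_c^{\mathrm{an}}:=\inf\{\beta>0:\widetilde{\mathcal M}(\beta)>0\}$, where $\widetilde{\mathcal M}(\beta)=\lim_{B\to0^+}\widetilde M(\beta,B)$, and the annealed uniqueness regime is $\mathcal U^{\mathrm{an}}=\{(\beta,B):\beta\ge0,\ B\ne0\ \text{ or }\ 0<\beta<\beta_c^{\mathrm{an}},\ B=0\}$. In part (iii), "$\beta\in\mathcal U^{\mathrm{an}}$" is shorthand for $(\beta,0)\in\mathcal U^{\mathrm{an}}$. Constant $\alpha(\beta)$: for $i,j\in[N]$ (with $p_{ii}=w_i^2/(\ell_N+w_i^2)$) define $$\beta_{ij}=\tfrac12\log\frac{e^{\beta}p_{ij}+(1-p_{ij})}{e^{-\beta}p_{ij}+(1-p_{ij})},\qquad C_{ij}\cosh(\beta_{ij})=p_{ij}\cosh(\beta)+(1-p_{ij}),$$ $G_2(\beta)=\prod_{i<j}C_{ij}\prod_{i\in[N]}e^{-\beta_{ii}/2}$, and $\alpha(\beta)=\lim_{N\to\infty}\frac1N\log G_2(\beta)$.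
   Formalization: In (iii), nonvanishing of the spontaneous magnetization outside the uniqueness regime is claimed only for β≠0 and β≠β_c^an (at both values it is 0); in (ii), z* is the fixed-point solution with B·z*≥0, since solutions of the opposite sign can exist. *)

theory Defs
  imports "HOL-Probability.Probability"
begin

text \<open>
  The weights form a triangular array: \<open>w N i\<close> is the weight of vertex \<open>i \<in> {1..N}\<close> in the graph on
  \<open>N\<close> vertices; values with \<open>i \<notin> {1..N}\<close> are never used.
\<close>

definition total_weight :: "(nat \<Rightarrow> nat \<Rightarrow> real) \<Rightarrow> nat \<Rightarrow> real" where
  "total_weight w N = (\<Sum>i\<in>{1..N}. w N i)"

definition edge_prob :: "(nat \<Rightarrow> nat \<Rightarrow> real) \<Rightarrow> nat \<Rightarrow> nat \<Rightarrow> nat \<Rightarrow> real" where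
  "edge_prob w N i j = w N i * w N j / (total_weight w N + w N i * w N j)"

definition vertex_pairs :: "nat \<Rightarrow> (nat \<times> nat) set" where
  "vertex_pairs N = {(i, j). i \<in> {1..N} \<and> j \<in> {1..N} \<and> i < j}"

text \<open>Law of the random edge set; the edge \<open>{i, j}\<close> is represented by the pair \<open>(i, j)\<close> with \<open>i < j\<close>.\<close>

definition GRG :: "(nat \<Rightarrow> nat \<Rightarrow> real) \<Rightarrow> nat \<Rightarrow> (nat \<times> nat) set pmf" where
  "GRG w N =
     map_pmf (\<lambda>x. {e \<in> vertex_pairs N. x e})
       (Pi_pmf (vertex_pairs N) False (\<lambda>(i, j). bernoulli_pmf (edge_prob w N i j)))"

definition weight_regularity ::
  "(nat \<Rightarrow> nat \<Rightarrow> real) \<Rightarrow> 'a measure \<Rightarrow> ('a \<Rightarrow> real) \<Rightarrow> bool" where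
  "weight_regularity w M W \<longleftrightarrow>
     prob_space M \<and> W \<in> borel_measurable M \<and>
     weak_conv_m (\<lambda>N. distr (measure_pmf (pmf_of_set {1..N})) borel (w N)) (distr M borel W) \<and>
     integrable M W \<and>
     (\<lambda>N. measure_pmf.expectation (pmf_of_set {1..N}) (w N)) \<longlonglongrightarrow> (\<integral>\<omega>. W \<omega> \<partial>M) \<and>
     integrable M (\<lambda>\<omega>. (W \<omega>)\<^sup>2) \<and>
     (\<lambda>N. measure_pmf.expectation (pmf_of_set {1..N}) (\<lambda>i. (w N i)\<^sup>2)) \<longlonglongrightarrow> (\<integral>\<omega>. (W \<omega>)\<^sup>2 \<partial>M) \<and>
     (\<integral>\<omega>. W \<omega> \<partial>M) > 0"

definition spins :: "nat \<Rightarrow> (nat \<Rightarrow> real) set" where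
  "spins N = {1..N} \<rightarrow>\<^sub>E {-1, 1}"

definition total_spin :: "nat \<Rightarrow> (nat \<Rightarrow> real) \<Rightarrow> real" where
  "total_spin N \<sigma> = (\<Sum>i\<in>{1..N}. \<sigma> i)"

definition boltzmann :: "nat \<Rightarrow> real \<Rightarrow> real \<Rightarrow> (nat \<times> nat) set \<Rightarrow> (nat \<Rightarrow> real) \<Rightarrow> real" where
  "boltzmann N \<beta> B E \<sigma> = exp (\<beta> * (\<Sum>(i, j)\<in>E. \<sigma> i * \<sigma> j) + B * (\<Sum>i\<in>{1..N}. \<sigma> i))"

definition partition_function :: "nat \<Rightarrow> real \<Rightarrow> real \<Rightarrow> (nat \<times> nat) set \<Rightarrow> real" where
  "partition_function N \<beta> B E = (\<Sum>\<sigma>\<in>spins N. boltzmann N \<beta> B E \<sigma>)"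

definition annealed_prob ::
  "(nat \<Rightarrow> nat \<Rightarrow> real) \<Rightarrow> nat \<Rightarrow> real \<Rightarrow> real \<Rightarrow> (nat \<Rightarrow> real) \<Rightarrow> real" where
  "annealed_prob w N \<beta> B \<sigma> =
     measure_pmf.expectation (GRG w N) (\<lambda>E. boltzmann N \<beta> B E \<sigma>) /
     measure_pmf.expectation (GRG w N) (partition_function N \<beta> B)"

definition annealed_expectation ::
  "(nat \<Rightarrow> nat \<Rightarrow> real) \<Rightarrow> nat \<Rightarrow> real \<Rightarrow> real \<Rightarrow> ((nat \<Rightarrow> real) \<Rightarrow> real) \<Rightarrow> real" where
  "annealed_expectation w N \<beta> B f = (\<Sum>\<sigma>\<in>spins N. f \<sigma> * annealed_prob w N \<beta> B \<sigma>)"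

definition annealed_variance ::
  "(nat \<Rightarrow> nat \<Rightarrow> real) \<Rightarrow> nat \<Rightarrow> real \<Rightarrow> real \<Rightarrow> ((nat \<Rightarrow> real) \<Rightarrow> real) \<Rightarrow> real" where
  "annealed_variance w N \<beta> B f =
     annealed_expectation w N \<beta> B (\<lambda>\<sigma>. (f \<sigma> - annealed_expectation w N \<beta> B f)\<^sup>2)"

definition pressure_N :: "(nat \<Rightarrow> nat \<Rightarrow> real) \<Rightarrow> nat \<Rightarrow> real \<Rightarrow> real \<Rightarrow> real" where
  "pressure_N w N \<beta> B =
     1 / real N * ln (measure_pmf.expectation (GRG w N) (partition_function N \<beta> B))"

definition magnetization_N :: "(nat \<Rightarrow> nat \<Rightarrow> real) \<Rightarrow> nat \<Rightarrow> real \<Rightarrow> real \<Rightarrow> real" where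
  "magnetization_N w N \<beta> B = annealed_expectation w N \<beta> B (\<lambda>\<sigma>. total_spin N \<sigma> / real N)"

definition susceptibility_N :: "(nat \<Rightarrow> nat \<Rightarrow> real) \<Rightarrow> nat \<Rightarrow> real \<Rightarrow> real \<Rightarrow> real" where
  "susceptibility_N w N \<beta> B = deriv (magnetization_N w N \<beta>) B"

lemma finite_vertex_pairs: "finite (vertex_pairs N)"
  by (rule finite_subset[of _ "{1..N} \<times> {1..N}"]) (auto simp: vertex_pairs_def)

lemma finite_spins: "finite (spins N)"
  unfolding spins_def by (rule finite_PiE) auto

lemma finite_set_pmf_GRG: "finite (set_pmf (GRG w N))"
  by (rule finite_subset[of _ "Pow (vertex_pairs N)"])
     (auto simp: GRG_def finite_vertex_pairs)

lemma expectation_boltzmann: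
  "measure_pmf.expectation (GRG w N) (\<lambda>E. boltzmann N \<beta> B E \<sigma>) =
     measure_pmf.expectation (GRG w N) (\<lambda>E. boltzmann N \<beta> 0 E \<sigma>) * exp (B * total_spin N \<sigma>)"
  by (simp add: boltzmann_def total_spin_def exp_add)

lemma expectation_boltzmann_pos:
  "measure_pmf.expectation (GRG w N) (\<lambda>E. boltzmann N \<beta> B E \<sigma>) > 0"
proof -
  have "measure_pmf.expectation (GRG w N) (\<lambda>E. boltzmann N \<beta> B E \<sigma>) =
      (\<Sum>E\<in>set_pmf (GRG w N). boltzmann N \<beta> B E \<sigma> * pmf (GRG w N) E)"
    by (rule integral_measure_pmf_real[OF finite_set_pmf_GRG]) auto
  also have "\<dots> > 0"
    by (rule sum_pos)
       (auto simp: finite_set_pmf_GRG set_pmf_not_empty boltzmann_def pmf_positive)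
  finally show ?thesis .
qed

lemma expectation_partition_function:
  "measure_pmf.expectation (GRG w N) (partition_function N \<beta> B) =
     (\<Sum>\<sigma>\<in>spins N. measure_pmf.expectation (GRG w N) (\<lambda>E. boltzmann N \<beta> B E \<sigma>))"
  unfolding partition_function_def
  by (rule Bochner_Integration.integral_sum)
     (simp add: integrable_measure_pmf_finite finite_set_pmf_GRG)

lemma expectation_partition_function_pos:
  "measure_pmf.expectation (GRG w N) (partition_function N \<beta> B) > 0"
  unfolding expectation_partition_function
  by (rule sum_pos[OF finite_spins])
     (auto simp: expectation_boltzmann_pos spins_def PiE_eq_empty_iff)

lemma sum_annealed_prob: "(\<Sum>\<sigma>\<in>spins N. annealed_prob w N \<beta> B \<sigma>) = 1"
  using expectation_partition_function_pos[of w N \<beta> B]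
  by (simp add: annealed_prob_def sum_divide_distrib[symmetric] expectation_partition_function)

lemma susceptibility_N_eq_variance:
  "(magnetization_N w N \<beta> has_real_derivative
      annealed_variance w N \<beta> B (\<lambda>\<sigma>. total_spin N \<sigma> / sqrt (real N))) (at B)"
  "susceptibility_N w N \<beta> B =
      annealed_variance w N \<beta> B (\<lambda>\<sigma>. total_spin N \<sigma> / sqrt (real N))"
proof -
  define a where "a \<sigma> = measure_pmf.expectation (GRG w N) (\<lambda>E. boltzmann N \<beta> 0 E \<sigma>)" for \<sigma>
  define S where "S = total_spin N"
  define Z where "Z b = (\<Sum>\<sigma>\<in>spins N. a \<sigma> * exp (b * S \<sigma>))" for b
  define Y where "Y b = (\<Sum>\<sigma>\<in>spins N. S \<sigma> * (a \<sigma> * exp (b * S \<sigma>)))" for b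
  define X where "X b = (\<Sum>\<sigma>\<in>spins N. S \<sigma> ^ 2 * (a \<sigma> * exp (b * S \<sigma>)))" for b
  have EZ: "measure_pmf.expectation (GRG w N) (partition_function N \<beta> b) = Z b" for b
    unfolding expectation_partition_function Z_def a_def S_def
    by (subst expectation_boltzmann) simp
  have Zpos: "Z b > 0" for b
    using expectation_partition_function_pos[of w N \<beta> b] EZ by simp
  have prob: "annealed_prob w N \<beta> b \<sigma> = a \<sigma> * exp (b * S \<sigma>) / Z b" for b \<sigma>
    unfolding annealed_prob_def EZ a_def S_def by (subst expectation_boltzmann) simp
  have dZ: "(Z has_real_derivative Y b) (at b)" for b
    unfolding Z_def[abs_def] Y_def
    by (auto intro!: derivative_eq_intros sum.cong simp: algebra_simps)
  have dY: "(Y has_real_derivative X b) (at b)" for b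
    unfolding Y_def[abs_def] X_def
    by (auto intro!: derivative_eq_intros sum.cong simp: algebra_simps power2_eq_square)
  have mean: "annealed_expectation w N \<beta> b (\<lambda>\<sigma>. S \<sigma> / c) = Y b / Z b / c" for b c
    by (simp add: annealed_expectation_def prob Y_def sum_divide_distrib mult_ac)
  have mag: "magnetization_N w N \<beta> = (\<lambda>b. Y b / Z b / real N)"
    unfolding magnetization_N_def[abs_def] using mean[of _ "real N"] by (simp add: S_def)
  have "annealed_variance w N \<beta> B (\<lambda>\<sigma>. S \<sigma> / sqrt (real N)) =
      (\<Sum>\<sigma>\<in>spins N. (S \<sigma> - Y B / Z B)\<^sup>2 / real N * (a \<sigma> * exp (B * S \<sigma>) / Z B))"
    unfolding annealed_variance_def mean unfolding annealed_expectation_def prob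
    by (simp only: diff_divide_distrib[symmetric] power_divide real_sqrt_pow2 of_nat_0_le_iff)
  also have "\<dots> = (\<Sum>\<sigma>\<in>spins N. (S \<sigma> ^ 2 * (a \<sigma> * exp (B * S \<sigma>))
        - 2 * (Y B / Z B) * (S \<sigma> * (a \<sigma> * exp (B * S \<sigma>)))
        + (Y B / Z B)\<^sup>2 * (a \<sigma> * exp (B * S \<sigma>))) / Z B / real N)"
    by (intro sum.cong refl) (simp add: power2_diff algebra_simps add_divide_distrib diff_divide_distrib)
  also have "\<dots> = (X B - 2 * (Y B / Z B) * Y B + (Y B / Z B)\<^sup>2 * Z B) / Z B / real N"
    unfolding X_def
    by (simp add: sum_divide_distrib[symmetric] sum.distrib sum_subtractf sum_distrib_left[symmetric]
        flip: Y_def Z_def)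
  also have "\<dots> = (X B * Z B - Y B * Y B) / (Z B * Z B) / real N"
    using Zpos[of B] by (simp add: field_simps power2_eq_square)
  finally have var: "annealed_variance w N \<beta> B (\<lambda>\<sigma>. S \<sigma> / sqrt (real N)) =
      (X B * Z B - Y B * Y B) / (Z B * Z B) / real N" .
  have "((\<lambda>b. Y b / Z b / real N) has_real_derivative
      (X B * Z B - Y B * Y B) / (Z B * Z B) / real N) (at B)"
    using Zpos[of B] by (intro DERIV_cdivide DERIV_divide dY dZ) simp
  then show der: "(magnetization_N w N \<beta> has_real_derivative
      annealed_variance w N \<beta> B (\<lambda>\<sigma>. total_spin N \<sigma> / sqrt (real N))) (at B)"
    unfolding mag var[unfolded S_def] .
  show "susceptibility_N w N \<beta> B =
      annealed_variance w N \<beta> B (\<lambda>\<sigma>. total_spin N \<sigma> / sqrt (real N))"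
    unfolding susceptibility_N_def using der by (rule DERIV_imp_deriv)
qed

text \<open>
  The thermodynamic limits below are taken with \<open>lim\<close>, \<open>Lim\<close>, which are total operators; a theorem
  about them has to assert convergence separately.
\<close>

definition pressure :: "(nat \<Rightarrow> nat \<Rightarrow> real) \<Rightarrow> real \<Rightarrow> real \<Rightarrow> real" where
  "pressure w \<beta> B = lim (\<lambda>N. pressure_N w N \<beta> B)"

definition magnetization :: "(nat \<Rightarrow> nat \<Rightarrow> real) \<Rightarrow> real \<Rightarrow> real \<Rightarrow> real" where
  "magnetization w \<beta> B = lim (\<lambda>N. magnetization_N w N \<beta> B)"

definition susceptibility :: "(nat \<Rightarrow> nat \<Rightarrow> real) \<Rightarrow> real \<Rightarrow> real \<Rightarrow> real" where
  "susceptibility w \<beta> B = lim (\<lambda>N. susceptibility_N w N \<beta> B)"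

definition spontaneous_magnetization :: "(nat \<Rightarrow> nat \<Rightarrow> real) \<Rightarrow> real \<Rightarrow> real" where
  "spontaneous_magnetization w \<beta> = Lim (at_right 0) (\<lambda>B. magnetization w \<beta> B)"

definition beta_c_an :: "(nat \<Rightarrow> nat \<Rightarrow> real) \<Rightarrow> real" where
  "beta_c_an w = Inf {\<beta>. \<beta> > 0 \<and> spontaneous_magnetization w \<beta> > 0}"

definition uniqueness_regime :: "(nat \<Rightarrow> nat \<Rightarrow> real) \<Rightarrow> (real \<times> real) set" where
  "uniqueness_regime w =
     {(\<beta>, B). \<beta> \<ge> 0 \<and> B \<noteq> 0 \<or> 0 < \<beta> \<and> \<beta> < beta_c_an w \<and> B = 0}"

definition beta_edge :: "(nat \<Rightarrow> nat \<Rightarrow> real) \<Rightarrow> nat \<Rightarrow> real \<Rightarrow> nat \<Rightarrow> nat \<Rightarrow> real" where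
  "beta_edge w N \<beta> i j =
     1 / 2 * ln ((exp \<beta> * edge_prob w N i j + (1 - edge_prob w N i j)) /
                 (exp (- \<beta>) * edge_prob w N i j + (1 - edge_prob w N i j)))"

text \<open>The solution \<open>C\<close> of \<open>C * cosh (\<beta>\<^sub>i\<^sub>j) = p\<^sub>i\<^sub>j * cosh \<beta> + (1 - p\<^sub>i\<^sub>j)\<close>.\<close>

definition C_edge :: "(nat \<Rightarrow> nat \<Rightarrow> real) \<Rightarrow> nat \<Rightarrow> real \<Rightarrow> nat \<Rightarrow> nat \<Rightarrow> real" where
  "C_edge w N \<beta> i j =
     (edge_prob w N i j * cosh \<beta> + (1 - edge_prob w N i j)) / cosh (beta_edge w N \<beta> i j)"

definition G2 :: "(nat \<Rightarrow> nat \<Rightarrow> real) \<Rightarrow> nat \<Rightarrow> real \<Rightarrow> real" where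
  "G2 w N \<beta> =
     (\<Prod>(i, j)\<in>vertex_pairs N. C_edge w N \<beta> i j) *
     (\<Prod>i\<in>{1..N}. exp (- beta_edge w N \<beta> i i / 2))"

definition alpha :: "(nat \<Rightarrow> nat \<Rightarrow> real) \<Rightarrow> real \<Rightarrow> real" where
  "alpha w \<beta> = lim (\<lambda>N. 1 / real N * ln (G2 w N \<beta>))"

definition pressure_functional ::
  "'a measure \<Rightarrow> ('a \<Rightarrow> real) \<Rightarrow> real \<Rightarrow> real \<Rightarrow> real \<Rightarrow> real" where
  "pressure_functional M W \<beta> B z =
     (\<integral>\<omega>. ln (cosh (sqrt (sinh \<beta> / (\<integral>\<omega>. W \<omega> \<partial>M)) * W \<omega> * z + B)) \<partial>M) - z\<^sup>2 / 2"

text \<open>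
  The supremum point \<open>z\<^sup>*(\<beta>, B)\<close> is rendered as a predicate, since for \<open>B = 0\<close> and large \<open>\<beta>\<close> the supremum is
  attained at two opposite points.
\<close>

definition is_z_star :: "'a measure \<Rightarrow> ('a \<Rightarrow> real) \<Rightarrow> real \<Rightarrow> real \<Rightarrow> real \<Rightarrow> bool" where
  "is_z_star M W \<beta> B z \<longleftrightarrow> is_arg_max (pressure_functional M W \<beta> B) (\<lambda>_. True) z"

definition fixed_point_eq :: "'a measure \<Rightarrow> ('a \<Rightarrow> real) \<Rightarrow> real \<Rightarrow> real \<Rightarrow> real \<Rightarrow> bool" where
  "fixed_point_eq M W \<beta> B z \<longleftrightarrow>
     z =
       (\<integral>\<omega>. tanh (sqrt (sinh \<beta> / (\<integral>\<omega>. W \<omega> \<partial>M)) * W \<omega> * z + B) *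
           (sqrt (sinh \<beta> / (\<integral>\<omega>. W \<omega> \<partial>M)) * W \<omega>) \<partial>M)"

definition nu :: "'a measure \<Rightarrow> ('a \<Rightarrow> real) \<Rightarrow> real" where
  "nu M W = (\<integral>\<omega>. (W \<omega>)\<^sup>2 \<partial>M) / (\<integral>\<omega>. W \<omega> \<partial>M)"

definition beta_c_qu :: "'a measure \<Rightarrow> ('a \<Rightarrow> real) \<Rightarrow> real" where
  "beta_c_qu M W = artanh (1 / nu M W)"

end

theory Submission
  imports Defs "HOL-Computational_Algebra.Fundamental_Theorem_Algebra"
begin

text \<open>
  Averaging over the edges turns the annealed measure into an Ising model on the complete graph. With
  \<open>x\<^sub>i\<^sub>j = w\<^sub>i w\<^sub>j / \<ell>\<^sub>N\<close>, the edge \<open>ij\<close> contributes \<open>p\<^sub>i\<^sub>j e\<^bsup>\<beta>s\<^esup> + 1 - p\<^sub>i\<^sub>j\<close> for \<open>s = \<sigma>\<^sub>i\<sigma>\<^sub>j = \<plusminus>1\<close>, which is a constant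
  times \<open>1 + t\<^sub>i\<^sub>j s\<close> with \<open>t\<^sub>i\<^sub>j = x\<^sub>i\<^sub>j sinh \<beta> / (1 + x\<^sub>i\<^sub>j cosh \<beta>)\<close> in \<open>[0, 1)\<close> (\<open>annealed_boltzmann\<close>). Two features of
  this model carry the proof. It is ferromagnetic, so the Lee-Yang theorem and the first Griffiths inequality
  apply. And it has rank one up to a bounded error: \<open>ln (1 + t\<^sub>i\<^sub>j s)\<close> and \<open>x\<^sub>i\<^sub>j s sinh \<beta>\<close> differ by \<open>O(x\<^sub>i\<^sub>j\<^sup>2)\<close>,
  and \<open>\<Sum> x\<^sub>i\<^sub>j\<^sup>2 \<le> (\<Sum> w\<^sub>i\<^sup>2 / \<ell>\<^sub>N)\<^sup>2\<close> stays bounded, so the energy is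
  \<open>sinh \<beta> (\<Sum> w\<^sub>i \<sigma>\<^sub>i)\<^sup>2 / (2 \<ell>\<^sub>N) + O(1)\<close> uniformly in the spins.

  For the pressure, a bounded error in the energy is invisible at scale \<open>N\<close>. For the rank-one energy \<open>N u\<^sup>2 / 2\<close>, the identity
  \<open>u\<^sup>2 / 2 = max\<^sub>s (s u - s\<^sup>2 / 2)\<close> decouples the spins: a single \<open>s\<close> bounds the sum from below, a finite grid of
  values \<open>s\<close> bounds it from above, and up to the mesh of the grid both
  exponential rates converge to \<open>ln 2 + sup\<^sub>z F(z, B)\<close> by convergence of empirical averages of
  Lipschitz functions of the weights (\<open>ln_Z_limit\<close>).

  For \<open>B \<noteq> 0\<close> the derivatives are controlled by Lee-Yang. The zeros of the partition function in \<open>e\<^bsup>2B\<^esup>\<close> lie on the unit circle, which makes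
  the magnetization of the \<open>N\<close>-vertex model an average of functions \<open>sinh 2B / (cosh 2B - c)\<close> with \<open>\<bar>c\<bar> \<le> 1\<close>. Their first two
  derivatives are bounded on compact intervals avoiding \<open>0\<close>, uniformly in \<open>N\<close>. Pointwise convergence of the pressures then
  forces convergence of the first and second derivatives to those of the limit (\<open>derivative_of_limit\<close>,
  \<open>magnetization_limit\<close>), and the envelope theorem identifies the limiting magnetization (\<open>magnetization_eq\<close>).

  At \<open>B = 0\<close> a bounded error in the energy does matter for the variance, and the susceptibility is squeezed instead.
  From below, \<open>M\<^sub>N(B) / sinh 2B\<close> decreases in \<open>B > 0\<close> by the Lee-Yang representation. From above, deleting edges one by one
  gives \<open>\<langle>\<sigma>\<^sub>i\<sigma>\<^sub>j\<rangle> \<le> \<delta>\<^sub>i\<^sub>j + \<kappa> w\<^sub>i w\<^sub>j\<close>. Both bounds tend to \<open>1 + sinh \<beta> E[W] / (1 - \<nu> sinh \<beta>)\<close>, which is also the slope at \<open>0\<close>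
  of the limiting magnetization (\<open>susceptibility_zero\<close>, \<open>magnetization_DERIV_zero\<close>).

  The critical value comes from the fixed-point equation. With \<open>V = sqrt (sinh \<beta> / E[W]) W \<ge> 0\<close>, the map \<open>z \<mapsto> E[tanh (V z + B) V]\<close> is concave on
  \<open>[0, \<infinity>)\<close>, so for \<open>B > 0\<close> it has exactly one fixed point there. Its slope at \<open>z = B = 0\<close> is
  \<open>E[V\<^sup>2] = \<nu> sinh \<beta>\<close>, and the spontaneous magnetization is zero when this is below \<open>1\<close> and positive when it exceeds \<open>1\<close>.
\<close>

section \<open>The Lee-Yang circle theorem\<close>

text \<open>
  The product of the two roots is \<open>a / c\<close>, and both have modulus at least \<open>1\<close>.
\<close>

lemma roots_outside_disc_imp_coeff_le:
  fixes a b c :: complex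
  assumes nz: "\<And>x. norm x < 1 \<Longrightarrow> a + b * x + c * x\<^sup>2 \<noteq> 0"
  shows "a \<noteq> 0" "norm c \<le> norm a"
proof -
  show "a \<noteq> 0" using nz[of 0] by simp
  show "norm c \<le> norm a"
  proof (cases "c = 0")
    case False
    define s where "s = csqrt (b\<^sup>2 - 4 * a * c)"
    have s: "s\<^sup>2 = b\<^sup>2 - 4 * a * c" by (simp add: s_def)
    define u where "u = (- b + s) / (2 * c)"
    define v where "v = (- b - s) / (2 * c)"
    have sum: "c * (u + v) = - b" and "(2 * c * u) * (2 * c * v) = b\<^sup>2 - s\<^sup>2"
      using False by (auto simp: u_def v_def field_simps power2_eq_square)
    then have prod: "c * (u * v) = a"
      unfolding s using False by (simp add: power2_eq_square mult.left_commute)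
    have "a + b * x + c * x\<^sup>2 = c * ((x - u) * (x - v))" for x
    proof -
      have "c * ((x - u) * (x - v)) = c * x\<^sup>2 - c * (u + v) * x + c * (u * v)"
        by (simp add: algebra_simps power2_eq_square)
      then show ?thesis unfolding sum prod by simp
    qed
    then have "norm u \<ge> 1" "norm v \<ge> 1"
      using nz[of u] nz[of v] by (auto simp: not_less[symmetric])
    then have "1 * 1 \<le> norm u * norm v" by (intro mult_mono) auto
    then have "norm c * 1 \<le> norm c * (norm u * norm v)"
      by (intro mult_left_mono) auto
    also have "\<dots> = norm a" by (simp flip: prod add: norm_mult)
    finally show ?thesis by simp
  qed simp
qed

text \<open>
  One ferromagnetic bond preserves the Lee-Yang property. Up to the factor \<open>1 + t\<close>, the new polynomial is the coefficientwise
  product of the old one with \<open>1 + r x + r y + x y\<close>, where \<open>r = (1 - t) / (1 + t)\<close> lies in \<open>[0, 1]\<close>. The factor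
  \<open>1 + r x + r y + x y\<close> itself has no zeros in the bidisc, since \<open>\<bar>r + v\<bar> \<le> \<bar>1 + r v\<bar>\<close> there. Asano's contraction
  multiplies coefficients one variable at a time: the variable \<open>x\<close> is contracted by the bound \<open>slice\<close>, the variable \<open>y\<close> by comparing
  the extreme coefficients of a quadratic without zeros in the disc.
\<close>

lemma Asano_edge:
  fixes A B C D x y :: complex and t :: real
  assumes nz: "\<And>x y. norm x < 1 \<Longrightarrow> norm y < 1 \<Longrightarrow> A + B * x + C * y + D * (x * y) \<noteq> 0"
    and t: "0 \<le> t" "t < 1" and x: "norm x < 1" and y: "norm y < 1"
  shows "(1 + t) * A + (1 - t) * B * x + (1 - t) * C * y + (1 + t) * D * (x * y) \<noteq> 0"
proof -
  define r where "r = (1 - t) / (1 + t)"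
  have r: "0 \<le> r" "r \<le> 1" and tr: "1 - t = (1 + t) * r" using t by (auto simp: r_def)
  have slice: "A + C * v \<noteq> 0" "norm (B + D * v) \<le> norm (A + C * v)" if v: "norm v < 1" for v
  proof -
    show "A + C * v \<noteq> 0" using nz[of 0 v] v by simp
    show "norm (B + D * v) \<le> norm (A + C * v)"
    proof (rule ccontr)
      assume *: "\<not> ?thesis"
      then have n0: "B + D * v \<noteq> 0" by auto
      \<comment> \<open>Otherwise the first variable can be chosen inside the disc so that the polynomial vanishes.\<close>
      define u where "u = - (A + C * v) / (B + D * v)"
      have "norm u < 1" using * n0 by (simp add: u_def norm_divide norm_minus_cancel[of "A + C * v", symmetric] del: norm_minus_cancel)
      moreover have "A + B * u + C * v + D * (u * v) = (A + C * v) + (B + D * v) * u"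
        by (simp add: algebra_simps)
      moreover have "\<dots> = 0" using n0 by (simp add: u_def)
      ultimately show False using nz[of u v] v by simp
    qed
  qed
  have moebius: "1 + r * v \<noteq> 0" "norm (r + v) \<le> norm (1 + r * v)" if v: "norm v < 1" for v :: complex
  proof -
    have "norm (r * v) \<le> 1 * norm v" unfolding norm_mult using r by (intro mult_right_mono) auto
    then have "norm (r * v) < 1" using v by simp
    then show "1 + r * v \<noteq> 0" by (metis add_eq_0_iff norm_minus_cancel norm_one order_less_irrefl)
    have n: "(norm v)\<^sup>2 \<le> 1" using v by (simp add: power_le_one)
    have "(norm (1 + r * v))\<^sup>2 - (norm (r + v))\<^sup>2 = (1 - r\<^sup>2) * (1 - (norm v)\<^sup>2)"
      unfolding cmod_power2 by (simp add: algebra_simps power2_eq_square)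
    also have "\<dots> \<ge> 0" using r n by (intro mult_nonneg_nonneg) (auto simp: power_le_one)
    finally show "norm (r + v) \<le> norm (1 + r * v)" by (intro power2_le_imp_le[OF _ norm_ge_zero]) linarith
  qed
  \<comment> \<open>The polynomial with \<open>x\<close> contracted, on the diagonal of the two variables that remain to be contracted.\<close>
  have "A + r * B * x + ((r * A + C) + (B + r * D) * x) * v + (r * C + D * x) * v\<^sup>2 \<noteq> 0" if v: "norm v < 1" for v
  proof -
    have "norm (x * ((B + D * v) * (r + v))) = norm x * (norm (B + D * v) * norm (r + v))"
      unfolding norm_mult ..
    also have "\<dots> \<le> norm x * (norm (A + C * v) * norm (1 + r * v))"
      using slice[OF v] moebius[OF v] by (intro mult_left_mono mult_mono) auto
    also have "\<dots> < 1 * (norm (A + C * v) * norm (1 + r * v))"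
      using slice[OF v] moebius[OF v] x by (intro mult_strict_right_mono) auto
    finally have "norm (x * ((B + D * v) * (r + v))) < norm ((A + C * v) * (1 + r * v))"
      unfolding norm_mult mult_1_left .
    then have "(A + C * v) * (1 + r * v) + x * ((B + D * v) * (r + v)) \<noteq> 0"
      by (metis add_eq_0_iff norm_minus_cancel order_less_irrefl)
    then show ?thesis by (simp add: algebra_simps power2_eq_square)
  qed
  from roots_outside_disc_imp_coeff_le[of "A + r * B * x" _ "r * C + D * x", OF this]
  have a: "A + r * B * x \<noteq> 0" and c: "norm (r * C + D * x) \<le> norm (A + r * B * x)" by auto
  have "norm ((r * C + D * x) * y) < norm (A + r * B * x)"
  proof -
    have "norm ((r * C + D * x) * y) \<le> norm (A + r * B * x) * norm y"
      unfolding norm_mult using c by (intro mult_right_mono) auto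
    also have "\<dots> < norm (A + r * B * x) * 1" using a y by (intro mult_strict_left_mono) auto
    finally show ?thesis by simp
  qed
  then have "A + r * B * x + (r * C + D * x) * y \<noteq> 0"
    by (metis add_eq_0_iff norm_minus_cancel order_less_irrefl)
  moreover have "(1 + t) * A + (1 - t) * B * x + (1 - t) * C * y + (1 + t) * D * (x * y)
      = complex_of_real (1 + t) * (A + r * B * x + (r * C + D * x) * y)"
  proof -
    have tr': "complex_of_real (1 - t) = complex_of_real (1 + t) * complex_of_real r" unfolding tr by simp
    show ?thesis unfolding tr' by (simp only: algebra_simps)
  qed
  moreover have "complex_of_real (1 + t) \<noteq> 0" using t by (metis add_pos_nonneg less_numeral_extra(1) of_real_eq_0_iff order_less_irrefl)
  ultimately show ?thesis by simp
qed

text \<open>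
  The high-temperature form of the Ising weight: \<open>e\<^bsup>J s\<^esup> = cosh J (1 + t s)\<close> for \<open>s = \<plusminus>1\<close> and \<open>t = tanh J\<close>.
  The edge set is a parameter because both the Lee-Yang theorem and the correlation bounds are proved by adding or deleting edges.
\<close>

definition edge_weight :: "(nat \<Rightarrow> nat \<Rightarrow> real) \<Rightarrow> (nat \<times> nat) set \<Rightarrow> (nat \<Rightarrow> real) \<Rightarrow> real" where
  "edge_weight t F \<sigma> = (\<Prod>(i, j)\<in>F. 1 + t i j * \<sigma> i * \<sigma> j)"

lemma edge_weight_empty [simp]: "edge_weight t {} \<sigma> = 1"
  by (simp add: edge_weight_def)

lemma edge_weight_insert:
  "finite F \<Longrightarrow> (i, j) \<notin> F \<Longrightarrow>
     edge_weight t (insert (i, j) F) \<sigma> = (1 + t i j * \<sigma> i * \<sigma> j) * edge_weight t F \<sigma>"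
  by (simp add: edge_weight_def)

lemma spins_values: "\<sigma> \<in> spins N \<Longrightarrow> i \<in> {1..N} \<Longrightarrow> \<sigma> i = 1 \<or> \<sigma> i = -1"
  by (auto simp: spins_def PiE_def Pi_def)

lemma finite_edges: "F \<subseteq> vertex_pairs N \<Longrightarrow> finite F"
  using finite_vertex_pairs finite_subset by blast

lemma edge_weight_pos:
  assumes F: "F \<subseteq> vertex_pairs N" and t: "\<And>i j. 0 \<le> t i j" "\<And>i j. t i j < 1"
    and \<sigma>: "\<sigma> \<in> spins N"
  shows "edge_weight t F \<sigma> > 0"
  unfolding edge_weight_def
proof (rule prod_pos, clarify)
  fix i j assume "(i, j) \<in> F"
  then have "i \<in> {1..N}" "j \<in> {1..N}" using F by (auto simp: vertex_pairs_def)
  then have "\<sigma> i = 1 \<or> \<sigma> i = -1" "\<sigma> j = 1 \<or> \<sigma> j = -1" using spins_values[OF \<sigma>] by auto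
  then show "0 < 1 + t i j * \<sigma> i * \<sigma> j"
    using t(1)[of i j] t(2)[of i j] by auto
qed

definition flip_spins :: "nat \<Rightarrow> nat set \<Rightarrow> (nat \<Rightarrow> real) \<Rightarrow> nat \<Rightarrow> real" where
  "flip_spins N A \<sigma> = (\<lambda>i\<in>{1..N}. if i \<in> A then - \<sigma> i else \<sigma> i)"

lemma sum_flip_spins: "(\<Sum>\<sigma>\<in>spins N. f (flip_spins N A \<sigma>)) = (\<Sum>\<sigma>\<in>spins N. f \<sigma>)"
proof (rule sum.reindex_bij_witness[of _ "flip_spins N A" "flip_spins N A"])
  fix \<sigma> assume \<sigma>: "\<sigma> \<in> spins N"
  show "flip_spins N A (flip_spins N A \<sigma>) = \<sigma>"
    using \<sigma> by (auto simp: flip_spins_def spins_def fun_eq_iff PiE_def extensional_def)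
  then show "flip_spins N A (flip_spins N A \<sigma>) = \<sigma>" .
  show "flip_spins N A \<sigma> \<in> spins N"
    using \<sigma> by (auto simp: flip_spins_def spins_def PiE_def Pi_def)
  then show "flip_spins N A \<sigma> \<in> spins N" .
qed auto

text \<open>
  The partition function with a complex activity \<open>z i\<close> for every plus spin. It has degree at most one in each variable,
  which is what the contraction argument needs.
\<close>

definition Lee_Yang_sum :: "nat \<Rightarrow> (nat \<Rightarrow> nat \<Rightarrow> real) \<Rightarrow> (nat \<times> nat) set \<Rightarrow> (nat \<Rightarrow> complex) \<Rightarrow> complex" where
  "Lee_Yang_sum N t F z =
     (\<Sum>\<sigma>\<in>spins N. complex_of_real (edge_weight t F \<sigma>) * (\<Prod>i\<in>{1..N}. if \<sigma> i = 1 then z i else 1))"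

text \<open>
  Without edges the sum factorizes into \<open>\<Prod> (1 + z\<^sub>i)\<close>. Adding an edge multiplies the four coefficients with respect to its two
  endpoints by \<open>1 + t\<close> (aligned spins) or \<open>1 - t\<close>, which is the situation of \<open>Asano_edge\<close>.
\<close>

lemma Lee_Yang_polydisc:
  assumes t: "\<And>i j. 0 \<le> t i j" "\<And>i j. t i j < 1"
    and F: "F \<subseteq> vertex_pairs N"
    and z: "\<And>i. norm (z i) < 1"
  shows "Lee_Yang_sum N t F z \<noteq> 0"
  using finite_edges[OF F] F z
proof (induction F arbitrary: z rule: finite_induct)
  case empty
  have "Lee_Yang_sum N t {} z = (\<Prod>i\<in>{1..N}. \<Sum>s\<in>{-1, 1::real}. if s = 1 then z i else 1)"
    unfolding Lee_Yang_sum_def spins_def by (subst prod_sum_PiE) auto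
  moreover have "1 + z i \<noteq> 0" for i
    using empty(2)[of i] by (metis add_eq_0_iff norm_minus_cancel norm_one order_less_irrefl)
  ultimately show ?case by simp
next
  case (insert e F)
  obtain i j where e: "e = (i, j)" by force
  have ij: "i \<in> {1..N}" "j \<in> {1..N}" "i \<noteq> j"
    using insert.prems(1) by (auto simp: e vertex_pairs_def)
  define R where "R \<sigma> = complex_of_real (edge_weight t F \<sigma>) * (\<Prod>k\<in>{1..N} - {i, j}. if \<sigma> k = 1 then z k else 1)" for \<sigma>
  \<comment> \<open>The coefficients with respect to the activities of the two endpoints.\<close>
  define A where "A = (\<Sum>\<sigma>\<in>spins N. R \<sigma> * (of_bool (\<sigma> i \<noteq> 1 \<and> \<sigma> j \<noteq> 1)))"
  define B where "B = (\<Sum>\<sigma>\<in>spins N. R \<sigma> * (of_bool (\<sigma> i = 1 \<and> \<sigma> j \<noteq> 1)))"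
  define C where "C = (\<Sum>\<sigma>\<in>spins N. R \<sigma> * (of_bool (\<sigma> i \<noteq> 1 \<and> \<sigma> j = 1)))"
  define D where "D = (\<Sum>\<sigma>\<in>spins N. R \<sigma> * (of_bool (\<sigma> i = 1 \<and> \<sigma> j = 1)))"
  have split: "(\<Prod>k\<in>{1..N}. g k) = (\<Prod>k\<in>{1..N} - {i, j}. g k) * g i * g j" for g :: "nat \<Rightarrow> complex"
  proof -
    have "{1..N} = insert i (insert j ({1..N} - {i, j}))" using ij by auto
    then have "(\<Prod>k\<in>{1..N}. g k) = (\<Prod>k\<in>insert i (insert j ({1..N} - {i, j})). g k)" by simp
    then show ?thesis using ij by (simp add: mult_ac)
  qed
  have old: "Lee_Yang_sum N t F (z(i := x, j := y)) = A + B * x + C * y + D * (x * y)" for x y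
  proof -
    have "(\<Prod>k\<in>{1..N} - {i, j}. if \<sigma> k = 1 then (z(i := x, j := y)) k else 1)
        = (\<Prod>k\<in>{1..N} - {i, j}. if \<sigma> k = 1 then z k else 1)" for \<sigma> :: "nat \<Rightarrow> real"
      by (intro prod.cong) auto
    then have "Lee_Yang_sum N t F (z(i := x, j := y)) =
        (\<Sum>\<sigma>\<in>spins N. R \<sigma> * ((if \<sigma> i = 1 then x else 1) * (if \<sigma> j = 1 then y else 1)))"
      unfolding Lee_Yang_sum_def R_def using ij(3)
      by (subst split) (simp add: mult_ac cong: if_cong)
    also have "\<dots> = A + B * x + C * y + D * (x * y)"
      unfolding A_def B_def C_def D_def sum_distrib_right sum.distrib[symmetric]
      by (intro sum.cong) (auto simp: algebra_simps)
    finally show ?thesis .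
  qed
  have new: "Lee_Yang_sum N t (insert e F) z =
      (1 + t i j) * A + (1 - t i j) * B * z i + (1 - t i j) * C * z j + (1 + t i j) * D * (z i * z j)"
  proof -
    have "Lee_Yang_sum N t (insert e F) z =
       (\<Sum>\<sigma>\<in>spins N. complex_of_real (1 + t i j * \<sigma> i * \<sigma> j) * (R \<sigma> * ((if \<sigma> i = 1 then z i else 1) * (if \<sigma> j = 1 then z j else 1))))"
      unfolding Lee_Yang_sum_def R_def e using insert.hyps
      by (subst split) (simp add: mult_ac edge_weight_insert e cong: if_cong)
    also have "\<dots> = (1 + t i j) * A + (1 - t i j) * B * z i + (1 - t i j) * C * z j + (1 + t i j) * D * (z i * z j)"
      unfolding A_def B_def C_def D_def sum_distrib_right sum_distrib_left sum.distrib[symmetric]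
    proof (intro sum.cong refl, goal_cases)
      case (1 \<sigma>)
      then show ?case
        using spins_values[OF 1 ij(1)] spins_values[OF 1 ij(2)] by (auto simp: algebra_simps)
    qed
    finally show ?thesis .
  qed
  have "A + B * x + C * y + D * (x * y) \<noteq> 0" if "norm x < 1" "norm y < 1" for x y
    unfolding old[symmetric] using insert that by (intro insert.IH) auto
  then show ?case unfolding new using insert.prems t by (intro Asano_edge) auto
qed

lemma edge_weight_flip_all:
  assumes "F \<subseteq> vertex_pairs N" "\<sigma> \<in> spins N"
  shows "edge_weight t F (flip_spins N {1..N} \<sigma>) = edge_weight t F \<sigma>"
  unfolding edge_weight_def
proof (intro prod.cong refl, clarify)
  fix i j assume "(i, j) \<in> F"
  then have "i \<in> {1..N}" "j \<in> {1..N}" using assms by (auto simp: vertex_pairs_def)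
  then show "1 + t i j * flip_spins N {1..N} \<sigma> i * flip_spins N {1..N} \<sigma> j = 1 + t i j * \<sigma> i * \<sigma> j"
    using assms by (simp add: flip_spins_def)
qed

definition plus_count :: "nat \<Rightarrow> (nat \<Rightarrow> real) \<Rightarrow> nat" where
  "plus_count N \<sigma> = card {i \<in> {1..N}. \<sigma> i = 1}"

lemma plus_count_le: "plus_count N \<sigma> \<le> N"
  unfolding plus_count_def by (rule order_trans[OF card_mono[of "{1..N}"]]) auto

lemma plus_count_flip:
  assumes "\<sigma> \<in> spins N" shows "plus_count N (flip_spins N {1..N} \<sigma>) = N - plus_count N \<sigma>"
proof -
  have "{i \<in> {1..N}. flip_spins N {1..N} \<sigma> i = 1} = {1..N} - {i \<in> {1..N}. \<sigma> i = 1}"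
    using assms spins_values[OF assms] by (auto simp: flip_spins_def)
  moreover have "card ({1..N} - {i \<in> {1..N}. \<sigma> i = 1}) = card {1..N} - card {i \<in> {1..N}. \<sigma> i = 1}"
    by (rule card_Diff_subset) auto
  ultimately show ?thesis unfolding plus_count_def by simp
qed

lemma total_spin_plus_count:
  assumes "\<sigma> \<in> spins N" shows "total_spin N \<sigma> = 2 * real (plus_count N \<sigma>) - real N"
proof -
  have "total_spin N \<sigma> = (\<Sum>i\<in>{1..N}. 2 * of_bool (\<sigma> i = 1) - 1)"
    unfolding total_spin_def
  proof (rule sum.cong[OF refl])
    fix i assume "i \<in> {1..N}"
    then show "\<sigma> i = 2 * of_bool (\<sigma> i = 1) - 1" using spins_values[OF assms] by force
  qed
  also have "\<dots> = 2 * (\<Sum>i\<in>{1..N}. of_bool (\<sigma> i = 1)) - real N"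
    by (simp add: sum_subtractf sum_distrib_left)
  also have "(\<Sum>i\<in>{1..N}. of_bool (\<sigma> i = 1) :: real) = real (plus_count N \<sigma>)"
    unfolding plus_count_def by (simp add: Int_def)
  finally show ?thesis .
qed

definition Ising_sum :: "nat \<Rightarrow> (nat \<Rightarrow> nat \<Rightarrow> real) \<Rightarrow> (nat \<times> nat) set \<Rightarrow> real \<Rightarrow> real" where
  "Ising_sum N t F B = (\<Sum>\<sigma>\<in>spins N. edge_weight t F \<sigma> * exp (B * total_spin N \<sigma>))"

text \<open>
  The polydisc statement excludes zeros inside the unit disc; flipping all spins replaces \<open>x\<close> by \<open>1 / x\<close> and excludes those
  outside.
\<close>

lemma Lee_Yang_roots:
  assumes t: "\<And>i j. 0 \<le> t i j" "\<And>i j. t i j < 1" and F: "F \<subseteq> vertex_pairs N"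
    and \<zeta>: "(\<Sum>\<sigma>\<in>spins N. complex_of_real (edge_weight t F \<sigma>) * \<zeta> ^ plus_count N \<sigma>) = 0"
  shows "norm \<zeta> = 1"
proof -
  let ?p = "\<lambda>x. \<Sum>\<sigma>\<in>spins N. complex_of_real (edge_weight t F \<sigma>) * x ^ plus_count N \<sigma>"
  have inside: "?p x \<noteq> 0" if "norm x < 1" for x
  proof -
    have "?p x = Lee_Yang_sum N t F (\<lambda>_. x)"
      unfolding Lee_Yang_sum_def plus_count_def by (simp add: prod.If_cases Int_def)
    then show ?thesis using Lee_Yang_polydisc[OF t F] that by simp
  qed
  have outside: "?p x \<noteq> 0" if "norm x > 1" for x
  proof -
    have x: "x \<noteq> 0" using that by auto
    have "?p x = (\<Sum>\<sigma>\<in>spins N. complex_of_real (edge_weight t F (flip_spins N {1..N} \<sigma>))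
                    * x ^ plus_count N (flip_spins N {1..N} \<sigma>))"
      by (rule sum_flip_spins[symmetric])
    also have "\<dots> = x ^ N * ?p (1 / x)"
      unfolding sum_distrib_left
      by (intro sum.cong refl)
        (simp add: edge_weight_flip_all[OF F] plus_count_flip plus_count_le power_diff[OF x] power_divide
          del: One_nat_def)
    also have "\<dots> \<noteq> 0" using inside[of "1 / x"] that x by (simp add: norm_divide)
    finally show ?thesis .
  qed
  show ?thesis using inside outside \<zeta> by (meson linorder_less_linear)
qed

text \<open>
  As a polynomial in \<open>x = e\<^bsup>2B\<^esup>\<close> of degree \<open>N\<close>, the partition function factors over its zeros \<open>\<zeta>\<close>, all of modulus
  one, and \<open>\<bar>x - \<zeta>\<bar>\<^sup>2 = x (x + 1 / x - 2 Re \<zeta>) = 2 x (cosh 2B - Re \<zeta>)\<close>. Squaring the partition function keeps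
  the statement inside the reals.
\<close>

lemma Lee_Yang_factorization:
  assumes t: "\<And>i j. 0 \<le> t i j" "\<And>i j. t i j < 1" and F: "F \<subseteq> vertex_pairs N"
  obtains K c where "K > 0" "\<And>k. \<bar>c k\<bar> \<le> 1"
    "\<And>B. (Ising_sum N t F B)\<^sup>2 = K * (\<Prod>k<N. cosh (2 * B) - c k)"
proof -
  define p :: "complex poly" where
    "p = (\<Sum>\<sigma>\<in>spins N. monom (complex_of_real (edge_weight t F \<sigma>)) (plus_count N \<sigma>))"
  have poly_p: "poly p x = (\<Sum>\<sigma>\<in>spins N. complex_of_real (edge_weight t F \<sigma>) * x ^ plus_count N \<sigma>)" for x
    by (simp add: p_def poly_sum poly_monom)
  have "coeff p N = complex_of_real (\<Sum>\<sigma>\<in>spins N. if plus_count N \<sigma> = N then edge_weight t F \<sigma> else 0)"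
    unfolding p_def coeff_sum of_real_sum by (intro sum.cong) auto
  also have "(\<Sum>\<sigma>\<in>spins N. if plus_count N \<sigma> = N then edge_weight t F \<sigma> else 0) > 0"
  proof (rule sum_pos2[OF finite_spins])
    show ones: "(\<lambda>i\<in>{1..N}. 1) \<in> spins N" by (auto simp: spins_def)
    have "plus_count N (\<lambda>i\<in>{1..N}. 1) = card {1..N}"
      unfolding plus_count_def by (intro arg_cong[of _ _ card]) auto
    then show "0 < (if plus_count N (\<lambda>i\<in>{1..N}. 1) = N then edge_weight t F (\<lambda>i\<in>{1..N}. 1) else 0)"
      using edge_weight_pos[OF F t ones] by simp
  qed (auto intro: less_imp_le edge_weight_pos[OF F t])
  ultimately have coeffN: "coeff p N \<noteq> 0" by (metis of_real_eq_0_iff less_irrefl)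
  moreover have "degree p \<le> N"
    unfolding p_def by (intro degree_sum_le finite_spins order_trans[OF degree_monom_le] plus_count_le)
  ultimately have deg: "degree p = N" using le_degree[of p N] by simp
  obtain zs where zs: "mset zs = proots p" using ex_mset by blast
  have len: "length zs = N" using size_proots_complex[of p] deg by (simp flip: zs)
  have "p = smult (lead_coeff p) (\<Prod>x\<leftarrow>zs. [:- x, 1:])"
    by (subst complex_poly_decompose_multiset[symmetric]) (simp flip: zs prod_mset_prod_list)
  then have "poly p x = poly (smult (lead_coeff p) (\<Prod>x\<leftarrow>zs. [:- x, 1:])) x" for x by simp
  then have fact: "poly p x = coeff p N * (\<Prod>k<N. x - zs ! k)" for x
    by (simp add: deg poly_prod_list poly_prod prod.list_conv_set_nth len o_def atLeast0LessThan)
  have unit: "norm (zs ! k) = 1" if "k < N" for k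
  proof -
    have "poly p (zs ! k) = 0" unfolding fact using that by auto
    then show ?thesis unfolding poly_p by (rule Lee_Yang_roots[OF t F])
  qed
  define c where "c k = (if k < N then Re (zs ! k) else 0)" for k
  have sq: "(norm (complex_of_real x - zs ! k))\<^sup>2 = x * (x + 1 / x - 2 * c k)" if "k < N" "x > 0" for x k
  proof -
    have "(Re (zs ! k))\<^sup>2 + (Im (zs ! k))\<^sup>2 = 1" using unit[OF that(1)] by (simp flip: cmod_power2)
    then show ?thesis using that unfolding cmod_power2 
      by (simp add: c_def field_simps power2_eq_square)
  qed
  show ?thesis
  proof (rule that[of "(norm (coeff p N))\<^sup>2 * 2 ^ N" c])
    show "(norm (coeff p N))\<^sup>2 * 2 ^ N > 0" using coeffN by simp
    show "\<bar>c k\<bar> \<le> 1" for k using unit[of k] abs_Re_le_cmod[of "zs ! k"] by (cases "k < N") (simp_all add: c_def)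
    fix B :: real
    define x :: real where "x = exp (2 * B)"
    have x: "x > 0" by (simp add: x_def)
    have "Ising_sum N t F B = exp (- (B * N)) * (\<Sum>\<sigma>\<in>spins N. edge_weight t F \<sigma> * x ^ plus_count N \<sigma>)"
      unfolding Ising_sum_def sum_distrib_left
    proof (intro sum.cong refl)
      fix \<sigma> assume "\<sigma> \<in> spins N"
      then have "B * total_spin N \<sigma> = - (B * N) + real (plus_count N \<sigma>) * (2 * B)"
        by (simp add: total_spin_plus_count algebra_simps)
      then have "exp (B * total_spin N \<sigma>) = exp (- (B * N)) * x ^ plus_count N \<sigma>"
        unfolding x_def by (simp only: exp_add exp_of_nat_mult)
      then show "edge_weight t F \<sigma> * exp (B * total_spin N \<sigma>)
          = exp (- (B * N)) * (edge_weight t F \<sigma> * x ^ plus_count N \<sigma>)" by simp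
    qed
    also have "(\<Sum>\<sigma>\<in>spins N. edge_weight t F \<sigma> * x ^ plus_count N \<sigma>) = norm (poly p x)"
    proof -
      have "poly p x = complex_of_real (\<Sum>\<sigma>\<in>spins N. edge_weight t F \<sigma> * x ^ plus_count N \<sigma>)"
        unfolding poly_p by simp
      moreover have "(\<Sum>\<sigma>\<in>spins N. edge_weight t F \<sigma> * x ^ plus_count N \<sigma>) \<ge> 0"
        using x by (intro sum_nonneg mult_nonneg_nonneg less_imp_le[OF edge_weight_pos[OF F t]]) auto
      ultimately show ?thesis by (simp only: norm_of_real abs_of_nonneg)
    qed
    also have "norm (poly p x) = norm (coeff p N) * (\<Prod>k<N. norm (x - zs ! k))"
      unfolding fact norm_mult prod_norm[symmetric] ..
    finally have "(Ising_sum N t F B)\<^sup>2 = exp (- (B * N)) ^ 2 * ((norm (coeff p N))\<^sup>2 * (\<Prod>k<N. (norm (x - zs ! k))\<^sup>2))"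
      by (simp add: power_mult_distrib prod_power_distrib)
    also have "exp (- (B * N)) ^ 2 = inverse x ^ N"
    proof -
      have "exp (- (B * N)) ^ 2 = exp (real N * - (2 * B))"
        unfolding exp_double[symmetric] by (simp add: mult_ac)
      then show ?thesis by (simp only: exp_of_nat_mult exp_minus x_def)
    qed
    also have "(\<Prod>k<N. (norm (x - zs ! k))\<^sup>2) = (\<Prod>k<N. x * (2 * (cosh (2 * B) - c k)))"
      using x by (intro prod.cong refl)
        (simp add: sq cosh_def x_def exp_minus field_simps scaleR_conv_of_real)
    also have "\<dots> = x ^ N * (2 ^ N * (\<Prod>k<N. cosh (2 * B) - c k))"
      by (simp only: prod.distrib prod_constant card_lessThan)
    finally show "(Ising_sum N t F B)\<^sup>2 = (norm (coeff p N))\<^sup>2 * 2 ^ N * (\<Prod>k<N. cosh (2 * B) - c k)"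
      using x by (simp add: power_inverse field_simps)
  qed
qed

section \<open>Correlation bound in zero field\<close>

lemma prod_power_add_two:
  fixes \<sigma> :: "nat \<Rightarrow> real"
  assumes "i \<in> {1..N}" "j \<in> {1..N}"
  shows "(\<Prod>k\<in>{1..N}. \<sigma> k ^ (n k + (if k = i then 1 else 0) + (if k = j then 1 else 0)))
       = (\<Prod>k\<in>{1..N}. \<sigma> k ^ n k) * (\<sigma> i * \<sigma> j)"
proof -
  have "(\<Prod>k\<in>{1..N}. \<sigma> k ^ (if k = a then 1 else 0)) = \<sigma> a" if "a \<in> {1..N}" for a
  proof -
    have "(\<Prod>k\<in>{1..N}. \<sigma> k ^ (if k = a then 1 else 0)) = (\<Prod>k\<in>{1..N}. if k = a then \<sigma> k else 1)"
      by (intro prod.cong) auto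
    then show ?thesis using that by (simp add: prod.delta)
  qed
  then show ?thesis using assms by (simp only: power_add prod.distrib mult_ac)
qed

text \<open>
  Expanding the product over edges gives nonnegative multiples of sums of monomials, and summing a monomial over independent
  signs yields \<open>0\<close> or \<open>2\<^sup>N\<close>.
\<close>

lemma Griffiths_first:
  assumes t: "\<And>i j. 0 \<le> t i j" and F: "F \<subseteq> vertex_pairs N"
  shows "0 \<le> (\<Sum>\<sigma>\<in>spins N. edge_weight t F \<sigma> * (\<Prod>k\<in>{1..N}. \<sigma> k ^ n k))"
  using finite_edges[OF F] F
proof (induction F arbitrary: n rule: finite_induct)
  case empty
  have "(\<Sum>\<sigma>\<in>spins N. \<Prod>k\<in>{1..N}. \<sigma> k ^ n k) = (\<Prod>k\<in>{1..N}. \<Sum>s\<in>{-1, 1::real}. s ^ n k)"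
    unfolding spins_def by (subst prod_sum_PiE) auto
  also have "\<dots> \<ge> 0"
  proof (rule prod_nonneg)
    fix k
    have "(-1::real) ^ n k \<ge> -1" by (metis abs_le_iff abs_power_minus abs_one minus_le_iff order_refl power_one)
    then show "(\<Sum>s\<in>{-1, 1::real}. s ^ n k) \<ge> 0" by simp
  qed
  finally show ?case by simp
next
  case (insert e F)
  obtain i j where e: "e = (i, j)" by force
  have ij: "i \<in> {1..N}" "j \<in> {1..N}"
    using insert.prems(1) by (auto simp: e vertex_pairs_def)
  \<comment> \<open>The exponents after multiplication with the spins at the two ends of the new edge.\<close>
  let ?n = "\<lambda>k. n k + (if k = i then 1 else 0) + (if k = j then 1 else 0)"
  have "(\<Sum>\<sigma>\<in>spins N. edge_weight t (insert e F) \<sigma> * (\<Prod>k\<in>{1..N}. \<sigma> k ^ n k))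
      = (\<Sum>\<sigma>\<in>spins N. edge_weight t F \<sigma> * (\<Prod>k\<in>{1..N}. \<sigma> k ^ n k))
        + t i j * (\<Sum>\<sigma>\<in>spins N. edge_weight t F \<sigma> * (\<Prod>k\<in>{1..N}. \<sigma> k ^ ?n k))"
    using insert.hyps unfolding sum_distrib_left sum.distrib[symmetric] prod_power_add_two[OF ij] e
    by (intro sum.cong) (auto simp: edge_weight_insert algebra_simps)
  also have "\<dots> \<ge> 0"
    using insert by (intro add_nonneg_nonneg mult_nonneg_nonneg t) auto
  finally show ?case .
qed

definition spin_pair_sum :: "nat \<Rightarrow> (nat \<Rightarrow> nat \<Rightarrow> real) \<Rightarrow> (nat \<times> nat) set \<Rightarrow> nat \<Rightarrow> nat \<Rightarrow> real" where
  "spin_pair_sum N t F i j = (\<Sum>\<sigma>\<in>spins N. edge_weight t F \<sigma> * (\<sigma> i * \<sigma> j))"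

definition correlation :: "nat \<Rightarrow> (nat \<Rightarrow> nat \<Rightarrow> real) \<Rightarrow> (nat \<times> nat) set \<Rightarrow> nat \<Rightarrow> nat \<Rightarrow> real" where
  "correlation N t F i j = spin_pair_sum N t F i j / Ising_sum N t F 0"

lemma spins_square: "\<sigma> \<in> spins N \<Longrightarrow> i \<in> {1..N} \<Longrightarrow> \<sigma> i * \<sigma> i = 1"
  using spins_values by fastforce

lemma spin_pair_sum_diag: "i \<in> {1..N} \<Longrightarrow> spin_pair_sum N t F i i = Ising_sum N t F 0"
  unfolding spin_pair_sum_def Ising_sum_def by (intro sum.cong) (auto simp: spins_square)

lemma spin_pair_sum_nonneg:
  assumes "\<And>i j. 0 \<le> t i j" "F \<subseteq> vertex_pairs N" "i \<in> {1..N}" "j \<in> {1..N}"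
  shows "0 \<le> spin_pair_sum N t F i j"
  using Griffiths_first[of t, OF assms(1,2), of "\<lambda>k. 0 + (if k = i then 1 else 0) + (if k = j then 1 else 0)"]
  unfolding prod_power_add_two[OF assms(3,4)] spin_pair_sum_def by simp

lemma Ising_sum_pos:
  assumes t: "\<And>i j. 0 \<le> t i j" "\<And>i j. t i j < 1" and F: "F \<subseteq> vertex_pairs N"
  shows "Ising_sum N t F B > 0"
  unfolding Ising_sum_def
  by (rule sum_pos[OF finite_spins])
    (auto simp: spins_def PiE_eq_empty_iff intro!: mult_pos_pos edge_weight_pos[OF F t])

text \<open>
  The edge between \<open>i\<close> and \<open>k\<close> contributes the factor \<open>1 + \<tau> \<sigma>\<^sub>i \<sigma>\<^sub>k\<close>, and \<open>\<sigma>\<^sub>i\<sigma>\<^sub>k \<cdot> \<sigma>\<^sub>i\<sigma>\<^sub>j = \<sigma>\<^sub>k\<sigma>\<^sub>j\<close>. In the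
  quotient the denominator only grows, by the first Griffiths inequality.
\<close>

lemma correlation_edge_deletion:
  assumes t: "\<And>i j. 0 \<le> t i j" "\<And>i j. t i j < 1" and F: "insert e F \<subseteq> vertex_pairs N" "e \<notin> F"
    and e: "e = (i, k) \<or> e = (k, i)" and \<tau>: "\<tau> = t (fst e) (snd e)"
    and V: "i \<in> {1..N}" "j \<in> {1..N}" "k \<in> {1..N}"
  shows "correlation N t (insert e F) i j \<le> correlation N t F i j + \<tau> * correlation N t F k j"
proof -
  have F': "F \<subseteq> vertex_pairs N" using F by auto
  have fin: "finite F" using finite_edges[OF F'] .
  have ew: "edge_weight t (insert e F) \<sigma> = (1 + \<tau> * (\<sigma> i * \<sigma> k)) * edge_weight t F \<sigma>" for \<sigma>
    using e F(2) fin unfolding \<tau> by (auto simp: edge_weight_insert mult_ac)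
  have 1: "spin_pair_sum N t (insert e F) i j = spin_pair_sum N t F i j + \<tau> * spin_pair_sum N t F k j"
    unfolding spin_pair_sum_def ew sum_distrib_left sum.distrib[symmetric]
  proof (intro sum.cong refl, goal_cases)
    case (1 \<sigma>)
    have "\<sigma> i * \<sigma> k * (\<sigma> i * \<sigma> j) = (\<sigma> i * \<sigma> i) * (\<sigma> k * \<sigma> j)" by simp
    also have "\<dots> = \<sigma> k * \<sigma> j" using spins_square[OF 1 V(1)] by simp
    finally have eq: "\<sigma> i * \<sigma> k * (\<sigma> i * \<sigma> j) = \<sigma> k * \<sigma> j" .
    have "(1 + \<tau> * (\<sigma> i * \<sigma> k)) * edge_weight t F \<sigma> * (\<sigma> i * \<sigma> j)
        = edge_weight t F \<sigma> * (\<sigma> i * \<sigma> j)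
          + \<tau> * (edge_weight t F \<sigma> * (\<sigma> i * \<sigma> k * (\<sigma> i * \<sigma> j)))"
      by (simp only: algebra_simps)
    then show ?case by (simp only: eq)
  qed
  have 2: "Ising_sum N t (insert e F) 0 = Ising_sum N t F 0 + \<tau> * spin_pair_sum N t F i k"
    unfolding spin_pair_sum_def ew Ising_sum_def sum_distrib_left sum.distrib[symmetric]
    by (intro sum.cong refl) (simp add: algebra_simps)
  have \<tau>0: "\<tau> \<ge> 0" using t \<tau> by simp
  have pos: "Ising_sum N t F 0 > 0" by (rule Ising_sum_pos[of t, OF t F'])
  have ge: "Ising_sum N t (insert e F) 0 \<ge> Ising_sum N t F 0"
    unfolding 2 using \<tau>0 spin_pair_sum_nonneg[OF t(1) F' V(1,3)] by simp
  have "correlation N t (insert e F) i j \<le> (spin_pair_sum N t F i j + \<tau> * spin_pair_sum N t F k j) / Ising_sum N t F 0"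
    unfolding correlation_def 1
    using ge pos \<tau>0 spin_pair_sum_nonneg[OF t(1) F' V(1,2)] spin_pair_sum_nonneg[OF t(1) F' V(3,2)]
    by (intro divide_left_mono) auto
  then show ?thesis by (simp add: correlation_def add_divide_distrib)
qed

text \<open>
  Flipping the spin at \<open>i\<close> alone changes the sign of the sum.
\<close>

lemma correlation_isolated:
  assumes F: "F \<subseteq> vertex_pairs N" and iso: "\<And>k. (i, k) \<notin> F \<and> (k, i) \<notin> F"
    and V: "i \<in> {1..N}" "j \<in> {1..N}" "i \<noteq> j"
  shows "correlation N t F i j = 0"
proof -
  have "spin_pair_sum N t F i j = (\<Sum>\<sigma>\<in>spins N. edge_weight t F (flip_spins N {i} \<sigma>)
          * (flip_spins N {i} \<sigma> i * flip_spins N {i} \<sigma> j))"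
    unfolding spin_pair_sum_def by (rule sum_flip_spins[symmetric])
  also have "\<dots> = - spin_pair_sum N t F i j"
    unfolding spin_pair_sum_def sum_negf[symmetric]
  proof (intro sum.cong refl)
    fix \<sigma>
    have "edge_weight t F (flip_spins N {i} \<sigma>) = edge_weight t F \<sigma>"
      unfolding edge_weight_def
    proof (intro prod.cong refl, clarify)
      fix a b assume "(a, b) \<in> F"
      then have "a \<noteq> i" "b \<noteq> i" "a \<in> {1..N}" "b \<in> {1..N}"
        using iso F by (auto simp: vertex_pairs_def)
      then show "1 + t a b * flip_spins N {i} \<sigma> a * flip_spins N {i} \<sigma> b = 1 + t a b * \<sigma> a * \<sigma> b"
        by (simp add: flip_spins_def)
    qed
    then show "edge_weight t F (flip_spins N {i} \<sigma>) * (flip_spins N {i} \<sigma> i * flip_spins N {i} \<sigma> j)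
        = - (edge_weight t F \<sigma> * (\<sigma> i * \<sigma> j))"
      using V by (simp add: flip_spins_def)
  qed
  finally show ?thesis by (simp add: correlation_def)
qed

text \<open>
  Deleting all edges at \<open>i\<close> one after the other yields
  \<open>\<langle>\<sigma>\<^sub>i\<sigma>\<^sub>j\<rangle> \<le> \<Sum>\<^sub>k t\<^sub>i\<^sub>k \<langle>\<sigma>\<^sub>k\<sigma>\<^sub>j\<rangle>'\<close>, where the correlations on the right belong to smaller graphs.
  For couplings below the rank-one matrix \<open>s w\<^sub>i w\<^sub>k\<close>, the bound \<open>\<delta>\<^sub>k\<^sub>j + \<kappa> w\<^sub>k w\<^sub>j\<close> reproduces itself under this recursion as soon as
  \<open>\<kappa> = s (1 + \<kappa> \<Sum> w\<^sub>k\<^sup>2)\<close>. The induction on the edge set carries the sum over the neighbours of \<open>i\<close> that are still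
  present, because only that quantity changes by a controlled amount when an edge is deleted.
\<close>

lemma correlation_le_neighbours:
  fixes w :: "nat \<Rightarrow> real"
  assumes t: "\<And>i j. 0 \<le> t i j" "\<And>i j. t i j < 1"
    and tw: "\<And>i j. i \<in> {1..N} \<Longrightarrow> j \<in> {1..N} \<Longrightarrow> t i j \<le> s * w i * w j"
    and w: "\<And>i. i \<in> {1..N} \<Longrightarrow> 0 \<le> w i" and s: "0 \<le> s" and \<kappa>: "0 \<le> \<kappa>"
    and fix_pt: "\<kappa> = s * (1 + \<kappa> * (\<Sum>k\<in>{1..N}. (w k)\<^sup>2))"
    and F: "F \<subseteq> vertex_pairs N" and V: "i \<in> {1..N}" "j \<in> {1..N}" "i \<noteq> j"
  shows "correlation N t F i j
      \<le> (\<Sum>k | (i, k) \<in> F \<or> (k, i) \<in> F. s * w i * w k * (of_bool (k = j) + \<kappa> * w k * w j))"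
    (is "_ \<le> sum (?g i j) (?Nb F i)")
  using finite_edges[OF F] F V
proof (induction F arbitrary: i j rule: finite_psubset_induct)
  case (psubset F)
  note V = psubset.prems(2-4)
  have NbV: "?Nb G i \<subseteq> {1..N}" if "G \<subseteq> F" for G i
    using that psubset.prems(1) by (auto simp: vertex_pairs_def)
  have fin: "finite (?Nb G i)" if "G \<subseteq> F" for G i
    using NbV[OF that] finite_subset by blast
  have g0: "?g i j k \<ge> 0" if "i \<in> {1..N}" "j \<in> {1..N}" "k \<in> {1..N}" for i j k
    using that s w \<kappa> by (intro mult_nonneg_nonneg add_nonneg_nonneg) auto
  \<comment> \<open>For a strictly smaller graph, the sum over neighbours is at most the sum over all vertices, which is \<open>\<kappa> w\<^sub>k w\<^sub>j\<close>.\<close>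
  have coarse: "correlation N t G k j \<le> of_bool (k = j) + \<kappa> * w k * w j"
    if G: "G \<subset> F" and k: "k \<in> {1..N}" for G k
  proof (cases "k = j")
    case True
    have "G \<subseteq> vertex_pairs N" using G psubset.prems(1) by auto
    then have "correlation N t G k j = 1"
      using Ising_sum_pos[of t, OF t, of G N 0] k unfolding correlation_def True
      by (subst spin_pair_sum_diag) auto
    then show ?thesis using True w[OF V(2)] \<kappa> by simp
  next
    case False
    have "correlation N t G k j \<le> sum (?g k j) (?Nb G k)"
      using psubset.IH[OF G _ k V(2) False] G psubset.prems(1) by auto
    also have "\<dots> \<le> sum (?g k j) {1..N}"
      using NbV[of G k] G g0 k V by (intro sum_mono2) auto
    also have "\<dots> = s * w k * (\<Sum>l\<in>{1..N}. w l * of_bool (l = j)) + s * w k * \<kappa> * w j * (\<Sum>l\<in>{1..N}. (w l)\<^sup>2)"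
      unfolding sum_distrib_left sum.distrib[symmetric]
      by (intro sum.cong) (auto simp: algebra_simps power2_eq_square)
    also have "(\<Sum>l\<in>{1..N}. w l * of_bool (l = j)) = w j"
      using V(2) by (simp add: of_bool_def if_distrib[of "\<lambda>x. _ * x"] sum.delta cong: if_cong)
    also have "s * w k * w j + s * w k * \<kappa> * w j * (\<Sum>l\<in>{1..N}. (w l)\<^sup>2)
        = s * (1 + \<kappa> * (\<Sum>k\<in>{1..N}. (w k)\<^sup>2)) * w k * w j" by (simp add: algebra_simps)
    also have "\<dots> = \<kappa> * w k * w j" using fix_pt by simp
    finally show ?thesis using False by simp
  qed
  show ?case
  proof (cases "?Nb F i = {}")
    case True
    then have "correlation N t F i j = 0"
      using psubset.prems by (intro correlation_isolated) auto
    then show ?thesis using True by simp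
  next
    case False
    then obtain k e where e: "e \<in> F" "e = (i, k) \<or> e = (k, i)" by auto
    define G where "G = F - {e}"
    have G: "G \<subset> F" "F = insert e G" "e \<notin> G" using e by (auto simp: G_def)
    have kV: "k \<in> {1..N}" "k \<noteq> i" and asym: "\<And>a b. (a, b) \<in> F \<Longrightarrow> a < b"
      using e psubset.prems(1) by (auto simp: vertex_pairs_def)
    have Nb: "?Nb F i = insert k (?Nb G i)" "k \<notin> ?Nb G i"
      using e asym by (auto simp: G_def) (meson less_asym)+
    define \<tau> where "\<tau> = t (fst e) (snd e)"
    have \<tau>: "0 \<le> \<tau>" "\<tau> \<le> s * w i * w k"
      using e tw[OF V(1) kV(1)] tw[OF kV(1) V(1)] t by (auto simp: \<tau>_def mult_ac)
    have "correlation N t F i j \<le> correlation N t G i j + \<tau> * correlation N t G k j"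
      unfolding G(2) using G psubset.prems e kV
      by (intro correlation_edge_deletion t) (auto simp: \<tau>_def)
    also have "\<dots> \<le> sum (?g i j) (?Nb G i) + s * w i * w k * (of_bool (k = j) + \<kappa> * w k * w j)"
    proof (intro add_mono)
      show "correlation N t G i j \<le> sum (?g i j) (?Nb G i)"
        using psubset.IH[OF G(1) _ V] G psubset.prems(1) by auto
      have "\<tau> * correlation N t G k j \<le> \<tau> * (of_bool (k = j) + \<kappa> * w k * w j)"
        using \<tau> coarse[OF G(1) kV(1)] by (intro mult_left_mono) auto
      also have "\<dots> \<le> s * w i * w k * (of_bool (k = j) + \<kappa> * w k * w j)"
        using \<tau> w \<kappa> kV V by (intro mult_right_mono add_nonneg_nonneg mult_nonneg_nonneg) auto
      finally show "\<tau> * correlation N t G k j \<le> s * w i * w k * (of_bool (k = j) + \<kappa> * w k * w j)" .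
    qed
    also have "\<dots> = sum (?g i j) (?Nb F i)"
      unfolding Nb(1) using Nb(2) fin[of G i] G(1) by (subst sum.insert) auto
    finally show ?thesis .
  qed
qed

text \<open>
  The double sum of the bounds \<open>\<delta>\<^sub>i\<^sub>j + \<kappa> w\<^sub>i w\<^sub>j\<close>.
\<close>

lemma spin_variance_le:
  fixes w :: "nat \<Rightarrow> real"
  assumes t: "\<And>i j. 0 \<le> t i j" "\<And>i j. t i j < 1"
    and tw: "\<And>i j. i \<in> {1..N} \<Longrightarrow> j \<in> {1..N} \<Longrightarrow> t i j \<le> s * w i * w j"
    and w: "\<And>i. i \<in> {1..N} \<Longrightarrow> 0 \<le> w i" and s: "0 \<le> s"
    and small: "s * (\<Sum>k\<in>{1..N}. (w k)\<^sup>2) < 1"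
  shows "(\<Sum>\<sigma>\<in>spins N. edge_weight t (vertex_pairs N) \<sigma> * (total_spin N \<sigma>)\<^sup>2) / Ising_sum N t (vertex_pairs N) 0
      \<le> real N + s / (1 - s * (\<Sum>k\<in>{1..N}. (w k)\<^sup>2)) * (\<Sum>k\<in>{1..N}. w k)\<^sup>2"
proof -
  let ?F = "vertex_pairs N"
  define \<kappa> where "\<kappa> = s / (1 - s * (\<Sum>k\<in>{1..N}. (w k)\<^sup>2))"
  have \<kappa>0: "\<kappa> \<ge> 0" and fix_pt: "\<kappa> = s * (1 + \<kappa> * (\<Sum>k\<in>{1..N}. (w k)\<^sup>2))"
    using s small by (auto simp: \<kappa>_def field_simps)
  have corr: "correlation N t ?F i j \<le> of_bool (i = j) + \<kappa> * w i * w j" if V: "i \<in> {1..N}" "j \<in> {1..N}" for i j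
  proof (cases "i = j")
    case True
    then show ?thesis using spin_pair_sum_diag[OF V(1), of t ?F] Ising_sum_pos[of t, OF t order_refl, of N 0] w[OF V(1)] \<kappa>0 
      by (simp add: correlation_def)
  next
    case False
    have "correlation N t ?F i j
      \<le> (\<Sum>k | (i, k) \<in> ?F \<or> (k, i) \<in> ?F. s * w i * w k * (of_bool (k = j) + \<kappa> * w k * w j))"
      by (rule correlation_le_neighbours[OF t tw w s \<kappa>0 fix_pt order_refl V False])
    also have "\<dots> \<le> (\<Sum>k\<in>{1..N}. s * w i * w k * (of_bool (k = j) + \<kappa> * w k * w j))"
      using V w s \<kappa>0 by (intro sum_mono2 mult_nonneg_nonneg add_nonneg_nonneg) (auto simp: vertex_pairs_def)
    also have "\<dots> = s * w i * (\<Sum>l\<in>{1..N}. w l * of_bool (l = j)) + s * w i * \<kappa> * w j * (\<Sum>l\<in>{1..N}. (w l)\<^sup>2)"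
      unfolding sum_distrib_left sum.distrib[symmetric]
      by (intro sum.cong) (auto simp: algebra_simps power2_eq_square)
    also have "(\<Sum>l\<in>{1..N}. w l * of_bool (l = j)) = w j"
      using V(2) by (simp add: of_bool_def if_distrib[of "\<lambda>x. _ * x"] sum.delta cong: if_cong)
    also have "s * w i * w j + s * w i * \<kappa> * w j * (\<Sum>l\<in>{1..N}. (w l)\<^sup>2)
        = s * (1 + \<kappa> * (\<Sum>k\<in>{1..N}. (w k)\<^sup>2)) * w i * w j" by (simp add: algebra_simps)
    also have "\<dots> = \<kappa> * w i * w j" using fix_pt by simp
    finally show ?thesis using False by simp
  qed
  have "(\<Sum>\<sigma>\<in>spins N. edge_weight t ?F \<sigma> * (total_spin N \<sigma>)\<^sup>2)
      = (\<Sum>\<sigma>\<in>spins N. \<Sum>i\<in>{1..N}. \<Sum>j\<in>{1..N}. edge_weight t ?F \<sigma> * (\<sigma> i * \<sigma> j))"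
    unfolding total_spin_def power2_eq_square sum_product
    by (intro sum.cong refl) (simp only: sum_distrib_left)
  also have "\<dots> = (\<Sum>i\<in>{1..N}. \<Sum>\<sigma>\<in>spins N. \<Sum>j\<in>{1..N}. edge_weight t ?F \<sigma> * (\<sigma> i * \<sigma> j))"
    by (rule sum.swap)
  also have "\<dots> = (\<Sum>i\<in>{1..N}. \<Sum>j\<in>{1..N}. spin_pair_sum N t ?F i j)"
    unfolding spin_pair_sum_def by (intro sum.cong refl sum.swap)
  finally have "(\<Sum>\<sigma>\<in>spins N. edge_weight t ?F \<sigma> * (total_spin N \<sigma>)\<^sup>2) / Ising_sum N t ?F 0
      = (\<Sum>i\<in>{1..N}. \<Sum>j\<in>{1..N}. correlation N t ?F i j)"
    by (simp add: correlation_def sum_divide_distrib)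
  also have "\<dots> \<le> (\<Sum>i\<in>{1..N}. \<Sum>j\<in>{1..N}. of_bool (i = j) + \<kappa> * w i * w j)"
    by (intro sum_mono corr)
  also have "\<dots> = real N + \<kappa> * (\<Sum>k\<in>{1..N}. w k)\<^sup>2"
  proof -
    have "(\<Sum>i\<in>{1..N}. \<Sum>j\<in>{1..N}. \<kappa> * w i * w j) = \<kappa> * (\<Sum>k\<in>{1..N}. w k)\<^sup>2"
      unfolding power2_eq_square sum_product by (simp only: sum_distrib_left mult.assoc)
    then show ?thesis unfolding sum.distrib by (simp add: of_bool_def sum.delta)
  qed
  finally show ?thesis by (simp add: \<kappa>_def)
qed

section \<open>Quadratic bounds and concavity\<close>

text \<open>
  A quantitative route to derivatives of integrals and of limits that avoids exchanging limit operations.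
\<close>

lemma DERIV_of_quadratic_error:
  fixes f :: "real \<Rightarrow> real"
  assumes "\<forall>\<^sub>F y in at x. \<bar>f y - f x - D * (y - x)\<bar> \<le> C * (y - x)\<^sup>2"
  shows "(f has_real_derivative D) (at x)"
  unfolding has_field_derivative_iff
proof -
  have "((\<lambda>y. (f y - f x) / (y - x) - D) \<longlongrightarrow> 0) (at x)"
  proof (rule Lim_null_comparison)
    show "\<forall>\<^sub>F y in at x. norm ((f y - f x) / (y - x) - D) \<le> C * \<bar>y - x\<bar>"
      using assms eventually_neq_at_within[of x x UNIV]
    proof eventually_elim
      case (elim y)
      then have y: "y \<noteq> x" by simp
      then have "(f y - f x) / (y - x) - D = (f y - f x - D * (y - x)) / (y - x)"
        by (simp add: field_simps)
      then have "norm ((f y - f x) / (y - x) - D) = \<bar>f y - f x - D * (y - x)\<bar> / \<bar>y - x\<bar>"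
        by simp
      also have "\<dots> \<le> C * \<bar>y - x\<bar>\<^sup>2 / \<bar>y - x\<bar>"
        using elim(1) by (intro divide_right_mono) auto
      also have "\<dots> = C * \<bar>y - x\<bar>"
        using y nonzero_mult_div_cancel_right[of "\<bar>y - x\<bar>" "C * \<bar>y - x\<bar>"]
        by (simp only: power2_eq_square mult.assoc abs_eq_0 right_minus_eq not_False_eq_True)
      finally show "norm ((f y - f x) / (y - x) - D) \<le> C * \<bar>y - x\<bar>" .
    qed
    have "((\<lambda>y. C * \<bar>y - x\<bar>) \<longlongrightarrow> C * \<bar>x - x\<bar>) (at x)" by (intro tendsto_intros)
    then show "((\<lambda>y. C * \<bar>y - x\<bar>) \<longlongrightarrow> 0) (at x)" by simp
  qed
  then show "((\<lambda>y. (f y - f x) / (y - x)) \<longlongrightarrow> D) (at x)" by (rule LIM_zero_cancel)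
qed


lemma tanh_diff_le: "\<bar>tanh a - tanh b\<bar> \<le> \<bar>a - b :: real\<bar>"
proof -
  have "norm (tanh a - tanh b) \<le> 1 * norm (a - b)"
  proof (rule field_differentiable_bound[where S = UNIV and f' = "\<lambda>x. 1 - tanh x ^ 2"])
    fix z :: real
    show "(tanh has_field_derivative 1 - (tanh z)\<^sup>2) (at z within UNIV)"
      by (auto intro!: derivative_eq_intros simp: power2_eq_square)
    have "(tanh z)\<^sup>2 \<le> 1" using tanh_real_bounds[of z] by (simp add: abs_square_le_1 abs_le_iff)
    then show "norm (1 - (tanh z)\<^sup>2) \<le> 1" by simp
  qed auto
  then show ?thesis by simp
qed

text \<open>
  The derivative \<open>tanh\<close> is increasing and \<open>1\<close>-Lipschitz, so \<open>ln cosh\<close> stays between its tangent and the tangent plus a square.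
\<close>

lemma ln_cosh_convex: "ln (cosh x) + tanh x * (y - x) \<le> ln (cosh (y::real))"
  and ln_cosh_quadratic: "ln (cosh y) \<le> ln (cosh x) + tanh x * (y - x) + (y - x)\<^sup>2"
proof -
  have dc: "((\<lambda>y. ln (cosh y)) has_real_derivative tanh y) (at y)" for y :: real
    by (auto intro!: derivative_eq_intros simp: tanh_def cosh_real_pos)
  have "\<exists>z. ln (cosh y) - ln (cosh x) = (y - x) * tanh z \<and> 0 \<le> (y - x) * (z - x) \<and> \<bar>z - x\<bar> \<le> \<bar>y - x\<bar>"
  proof (cases x y rule: linorder_cases)
    case less
    from MVT2[OF less, of "\<lambda>y. ln (cosh y)" tanh] dc
    obtain z where "x < z" "z < y" "ln (cosh y) - ln (cosh x) = (y - x) * tanh z" by auto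
    then show ?thesis by (intro exI[of _ z]) auto
  next
    case greater
    from MVT2[OF greater, of "\<lambda>y. ln (cosh y)" tanh] dc
    obtain z where "y < z" "z < x" "ln (cosh x) - ln (cosh y) = (x - y) * tanh z" by auto
    then have "ln (cosh y) - ln (cosh x) = (y - x) * tanh z" by (simp add: algebra_simps)
    then show ?thesis using \<open>y < z\<close> \<open>z < x\<close>
      by (intro exI[of _ z]) (auto intro!: mult_nonpos_nonpos)
  qed auto
  then obtain z where z: "ln (cosh y) - ln (cosh x) = (y - x) * tanh z" "0 \<le> (y - x) * (z - x)"
     "\<bar>z - x\<bar> \<le> \<bar>y - x\<bar>" by blast
  have "0 \<le> (y - x) * (tanh z - tanh x)"
    using z(2) by (auto simp: zero_le_mult_iff)
  then show "ln (cosh x) + tanh x * (y - x) \<le> ln (cosh (y::real))"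
    using z(1) by (simp add: algebra_simps)
  have "(y - x) * (tanh z - tanh x) \<le> \<bar>y - x\<bar> * \<bar>tanh z - tanh x\<bar>"
    by (metis abs_ge_self abs_mult)
  also have "\<dots> \<le> \<bar>y - x\<bar> * \<bar>y - x\<bar>"
    using tanh_diff_le[of z x] z(3) by (intro mult_left_mono) auto
  finally show "ln (cosh y) \<le> ln (cosh x) + tanh x * (y - x) + (y - x)\<^sup>2"
    using z(1) by (simp add: algebra_simps power2_eq_square)
qed

lemma concave_tanh: "concave_on {0..} (tanh :: real \<Rightarrow> real)"
proof (rule f''_le0_imp_concave)
  fix x :: real assume x: "x \<in> {0..}"
  show "(tanh has_real_derivative 1 - (tanh x)\<^sup>2) (at x)"
    by (auto intro!: derivative_eq_intros simp: power2_eq_square)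
  show "((\<lambda>x. 1 - (tanh x)\<^sup>2) has_real_derivative - (2 * tanh x * (1 - (tanh x)\<^sup>2))) (at x)"
    by (auto intro!: derivative_eq_intros simp: power2_eq_square)
  have "(tanh x)\<^sup>2 \<le> 1" using tanh_real_bounds[of x] by (simp add: abs_square_le_1 abs_le_iff)
  then show "- (2 * tanh x * (1 - (tanh x)\<^sup>2)) \<le> 0" using x by simp
qed auto

text \<open>
  Concavity together with \<open>tanh 0 = 0\<close>: the quotient \<open>tanh x / x\<close> decreases.
\<close>

lemma tanh_ratio_antimono:
  assumes "0 < x" "x \<le> (y::real)" shows "x * tanh y \<le> y * tanh x"
proof -
  have "(1 - x / y) * tanh 0 + x / y * tanh y \<le> tanh ((1 - x / y) * 0 + x / y * y)"
    using concave_onD[OF concave_tanh, of "x / y" 0 y] assms by simp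
  then show ?thesis using assms by (simp add: field_simps)
qed

lemma tanh_le_self: "0 \<le> x \<Longrightarrow> tanh x \<le> (x::real)"
  using tanh_diff_le[of x 0] by auto

section \<open>The mean-field variational problem\<close>

lemma ln_cosh_nonneg: "0 \<le> ln (cosh (x::real))"
  using cosh_real_ge_1[of x] by simp

lemma ln_cosh_le_abs: "ln (cosh x) \<le> \<bar>x :: real\<bar>"
proof -
  have "ln (cosh x) \<le> tanh x * x" using ln_cosh_convex[of x 0] by simp
  also have "\<dots> \<le> \<bar>tanh x\<bar> * \<bar>x\<bar>" by (metis abs_ge_self abs_mult)
  also have "\<dots> \<le> 1 * \<bar>x\<bar>"
    using tanh_real_bounds[of x] by (intro mult_right_mono) (auto simp: abs_le_iff)
  finally show ?thesis by simp
qed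

lemma abs_tanh_le_1: "\<bar>tanh (x::real)\<bar> \<le> 1"
  using tanh_real_bounds[of x] by (auto simp: abs_le_iff)

lemma tanh_meas [measurable]: "(tanh :: real \<Rightarrow> real) \<in> borel_measurable borel"
  by (intro borel_measurable_continuous_onI continuous_intros) auto

lemma cosh_meas [measurable]: "(cosh :: real \<Rightarrow> real) \<in> borel_measurable borel"
  by (intro borel_measurable_continuous_onI continuous_intros)

text \<open>
  The Curie-Weiss model in which a site of type \<open>V\<close> feels the field \<open>V z + B\<close>. In the application
  \<open>V = sqrt (sinh \<beta> / E[W]) W\<close>.
\<close>

locale mean_field = prob_space M for M :: "'a measure" +
  fixes V :: "'a \<Rightarrow> real"
  assumes V_nonneg: "AE x in M. 0 \<le> V x"
    and V_int: "integrable M V"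
    and V_int2: "integrable M (\<lambda>x. (V x)\<^sup>2)"
begin

definition functional :: "real \<Rightarrow> real \<Rightarrow> real" where
  "functional z B = (\<integral>x. ln (cosh (V x * z + B)) \<partial>M) - z\<^sup>2 / 2"

definition response :: "real \<Rightarrow> real \<Rightarrow> real" where
  "response z B = (\<integral>x. tanh (V x * z + B) * V x \<partial>M)"

definition mean_spin :: "real \<Rightarrow> real \<Rightarrow> real" where
  "mean_spin z B = (\<integral>x. tanh (V x * z + B) \<partial>M)"

abbreviation m1 where "m1 \<equiv> (\<integral>x. V x \<partial>M)"
abbreviation m2 where "m2 \<equiv> (\<integral>x. (V x)\<^sup>2 \<partial>M)"

definition maximizer :: "real \<Rightarrow> real \<Rightarrow> bool" where
  "maximizer B z \<longleftrightarrow> (\<forall>y. functional y B \<le> functional z B)"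

lemma V_meas [measurable]: "V \<in> borel_measurable M"
  using V_int by auto

lemma ln_cosh_int: "integrable M (\<lambda>x. ln (cosh (V x * z + B)))"
proof (rule Bochner_Integration.integrable_bound)
  show "integrable M (\<lambda>x. \<bar>V x * z\<bar> + \<bar>B\<bar>)" using V_int by (intro Bochner_Integration.integrable_add integrable_abs integrable_mult_left) auto
  show "AE x in M. norm (ln (cosh (V x * z + B))) \<le> norm (\<bar>V x * z\<bar> + \<bar>B\<bar>)"
  proof (rule AE_I2)
    fix x
    show "norm (ln (cosh (V x * z + B))) \<le> norm (\<bar>V x * z\<bar> + \<bar>B\<bar>)"
      using ln_cosh_le_abs[of "V x * z + B"] ln_cosh_nonneg[of "V x * z + B"]
        abs_triangle_ineq[of "V x * z" B] by simp
  qed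
qed measurable

lemma tanh_int: "integrable M (\<lambda>x. tanh (V x * z + B))"
  by (rule integrable_const_bound[of _ 1]) (auto simp: abs_tanh_le_1)

lemma tanh_V_int: "integrable M (\<lambda>x. tanh (V x * z + B) * V x)"
proof (rule Bochner_Integration.integrable_bound[OF V_int])
  show "AE x in M. norm (tanh (V x * z + B) * V x) \<le> norm (V x)"
    using mult_right_mono[OF abs_tanh_le_1 abs_ge_zero] by (auto simp: abs_mult)
qed measurable

lemma square_int: "integrable M (\<lambda>x. (V x * h + k)\<^sup>2)"
  and integral_square: "(\<integral>x. (V x * h + k)\<^sup>2 \<partial>M) = m2 * h\<^sup>2 + 2 * m1 * h * k + k\<^sup>2"
proof -
  have eq: "(V x * h + k)\<^sup>2 = (V x)\<^sup>2 * h\<^sup>2 + V x * (2 * h * k) + k\<^sup>2" for x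
    by (simp add: power2_eq_square algebra_simps)
  show "integrable M (\<lambda>x. (V x * h + k)\<^sup>2)"
    unfolding eq using V_int V_int2 by simp
  show "(\<integral>x. (V x * h + k)\<^sup>2 \<partial>M) = m2 * h\<^sup>2 + 2 * m1 * h * k + k\<^sup>2"
    unfolding eq using V_int V_int2 by (simp add: prob_space)
qed

lemma m1_nonneg: "0 \<le> m1"
  using V_nonneg by (rule integral_nonneg_AE)

text \<open>
  Joint tangent bounds in \<open>(z, B)\<close>. Integrating the pointwise bounds for \<open>ln cosh\<close> gives a linear part and a quadratic error whose
  coefficients involve only the first two moments of \<open>V\<close>.
\<close>

lemma functional_lower:
  "functional z B + (y - z) * (response z B - z) + (C - B) * mean_spin z B - (y - z)\<^sup>2 / 2 \<le> functional y C"
proof -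
  have "(\<integral>x. ln (cosh (V x * z + B)) + (y - z) * (tanh (V x * z + B) * V x) + (C - B) * tanh (V x * z + B) \<partial>M)
      \<le> (\<integral>x. ln (cosh (V x * y + C)) \<partial>M)"
  proof (intro integral_mono)
    fix x
    have "ln (cosh (V x * z + B)) + tanh (V x * z + B) * ((V x * y + C) - (V x * z + B)) \<le> ln (cosh (V x * y + C))"
      by (rule ln_cosh_convex)
    then show "ln (cosh (V x * z + B)) + (y - z) * (tanh (V x * z + B) * V x) + (C - B) * tanh (V x * z + B) \<le> ln (cosh (V x * y + C))"
      by (simp add: algebra_simps)
  qed (use ln_cosh_int tanh_int tanh_V_int in simp_all)
  then show ?thesis
    using ln_cosh_int tanh_int tanh_V_int
    by (simp add: functional_def response_def mean_spin_def algebra_simps power2_eq_square)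
      (simp add: field_simps)
qed

lemma functional_upper:
  "functional y C \<le> functional z B + (y - z) * (response z B - z) + (C - B) * mean_spin z B
     + (m2 * (y - z)\<^sup>2 + 2 * m1 * (y - z) * (C - B) + (C - B)\<^sup>2)"
proof -
  have "(\<integral>x. ln (cosh (V x * y + C)) \<partial>M) \<le> (\<integral>x. ln (cosh (V x * z + B)) + (y - z) * (tanh (V x * z + B) * V x) + (C - B) * tanh (V x * z + B) + (V x * (y - z) + (C - B))\<^sup>2 \<partial>M)"
  proof (intro integral_mono)
    fix x
    have *: "(V x * y + C) - (V x * z + B) = V x * (y - z) + (C - B)" by (simp add: algebra_simps)
    have "ln (cosh (V x * y + C)) \<le> ln (cosh (V x * z + B)) + tanh (V x * z + B) * (V x * (y - z) + (C - B)) + (V x * (y - z) + (C - B))\<^sup>2"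
      using ln_cosh_quadratic[of "V x * y + C" "V x * z + B"] unfolding * .
    then show "ln (cosh (V x * y + C)) \<le> ln (cosh (V x * z + B)) + (y - z) * (tanh (V x * z + B) * V x) + (C - B) * tanh (V x * z + B) + (V x * (y - z) + (C - B))\<^sup>2"
      by (simp add: algebra_simps)
  qed (use ln_cosh_int tanh_int tanh_V_int square_int in simp_all)
  also have "\<dots> = (\<integral>x. ln (cosh (V x * z + B)) \<partial>M) + (y - z) * response z B + (C - B) * mean_spin z B
      + (m2 * (y - z)\<^sup>2 + 2 * m1 * (y - z) * (C - B) + (C - B)\<^sup>2)"
    using ln_cosh_int tanh_int tanh_V_int square_int
    by (simp add: response_def mean_spin_def integral_square)
  finally show ?thesis
    using zero_le_power2[of "y - z"] unfolding functional_def by (simp add: algebra_simps power2_eq_square)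
qed

lemma functional_DERIV: "((\<lambda>z. functional z B) has_real_derivative response z B - z) (at z)"
proof (rule DERIV_of_quadratic_error, rule always_eventually, rule allI)
  fix y
  define q where "q = (y - z)\<^sup>2"
  have q: "0 \<le> q" "0 \<le> m2 * q" by (simp_all add: q_def)
  have "functional z B + (y - z) * (response z B - z) - q / 2 \<le> functional y B"
    "functional y B \<le> functional z B + (y - z) * (response z B - z) + m2 * q"
    using functional_lower[of z B y B] functional_upper[of y B z B] by (simp_all add: q_def)
  then show "\<bar>functional y B - functional z B - (response z B - z) * (y - z)\<bar> \<le> (m2 + 1) * (y - z)\<^sup>2"
    unfolding q_def[symmetric] distrib_right mult.commute[of "response z B - z" "y - z"] abs_le_iff
    using q by linarith
qed

text \<open>
  A step of size \<open>response z B - z\<close> would increase the functional by half the square of that size.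
\<close>

lemma maximizer_fixed_point:
  assumes "maximizer B z" shows "response z B = z"
proof -
  have "functional (z + (response z B - z)) B \<le> functional z B" using assms by (simp add: maximizer_def)
  then have "(response z B - z)\<^sup>2 \<le> 0"
    using functional_lower[of z B "z + (response z B - z)" B] by (simp add: power2_eq_square)
  then show ?thesis by simp
qed

text \<open>
  The functional is nonnegative at \<open>0\<close> and, since \<open>ln cosh\<close> grows linearly, nonpositive for large \<open>\<bar>z\<bar>\<close>; so a maximum over a compact
  interval is global.
\<close>

lemma maximizer_exists: "\<exists>z. maximizer B z"
proof -
  define R where "R = 2 * (m1 + \<bar>B\<bar> + 1)"
  have R: "R > 0" using m1_nonneg by (simp add: R_def)
  have "continuous_on {-R..R} (\<lambda>z. functional z B)"
    by (intro continuous_at_imp_continuous_on ballI DERIV_isCont[OF functional_DERIV])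
  then obtain z where z: "z \<in> {-R..R}" "\<And>y. y \<in> {-R..R} \<Longrightarrow> functional y B \<le> functional z B"
    using continuous_attains_sup[of "{-R..R}" "\<lambda>z. functional z B"] R by auto
  have "functional 0 B \<ge> 0" unfolding functional_def using ln_cosh_nonneg by (simp add: prob_space)
  then have z0: "functional z B \<ge> 0" using z(2)[of 0] R by simp
  have "functional y B \<le> 0" if y: "y \<notin> {-R..R}" for y
  proof -
    have "\<bar>y\<bar> \<ge> R" using y by auto
    have "(\<integral>x. ln (cosh (V x * y + B)) \<partial>M) \<le> (\<integral>x. V x * \<bar>y\<bar> + \<bar>B\<bar> \<partial>M)"
    proof (rule integral_mono_AE)
      show "AE x in M. ln (cosh (V x * y + B)) \<le> V x * \<bar>y\<bar> + \<bar>B\<bar>"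
        using V_nonneg
      proof eventually_elim
        case (elim x)
        then show ?case
          using ln_cosh_le_abs[of "V x * y + B"] abs_triangle_ineq[of "V x * y" B] by (simp add: abs_mult)
      qed
    qed (use V_int ln_cosh_int in simp_all)
    also have "\<dots> = m1 * \<bar>y\<bar> + \<bar>B\<bar>" using V_int by (simp add: prob_space)
    also have "\<dots> \<le> y\<^sup>2 / 2"
    proof -
      have "y\<^sup>2 / 2 = \<bar>y\<bar> * (\<bar>y\<bar> / 2)" by (simp add: power2_eq_square)
      also have "\<dots> \<ge> \<bar>y\<bar> * (m1 + \<bar>B\<bar> + 1)"
        using \<open>\<bar>y\<bar> \<ge> R\<close> by (intro mult_left_mono) (auto simp: R_def)
      moreover have "\<bar>y\<bar> * \<bar>B\<bar> \<ge> 1 * \<bar>B\<bar>"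
        using \<open>\<bar>y\<bar> \<ge> R\<close> m1_nonneg by (intro mult_right_mono) (auto simp: R_def)
      ultimately show ?thesis by (simp add: algebra_simps)
    qed
    finally show ?thesis by (simp add: functional_def)
  qed
  then have "maximizer B z" unfolding maximizer_def using z(2) z0 by (meson order_trans)
  then show ?thesis ..
qed

lemma functional_minus: "functional (- z) (- B) = functional z B"
proof -
  have "cosh (V x * (- z) + - B) = cosh (V x * z + B)" for x
    by (metis cosh_minus minus_add_distrib mult_minus_right)
  then show ?thesis unfolding functional_def by (simp only: power2_minus)
qed

lemma maximizer_minus: "maximizer (- B) (- z) \<longleftrightarrow> maximizer B z"
  unfolding maximizer_def using functional_minus by (metis minus_minus)

lemma response_minus: "response (- z) (- B) = - response z B"
proof -
  have "tanh (V x * (- z) + - B) = - tanh (V x * z + B)" for x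
    by (metis tanh_minus minus_add_distrib mult_minus_right)
  then show ?thesis by (simp add: response_def)
qed

text \<open>
  On \<open>[0, \<infinity>)\<close> the map \<open>z \<mapsto> response z B\<close> is concave and its value at \<open>0\<close> is \<open>tanh B \<cdot> m1\<close>. Two fixed points
  \<open>0 \<le> y < z\<close> would force \<open>m1 = 0\<close>, and then \<open>response z B \<le> m1\<close> contradicts \<open>z > 0\<close>.
\<close>

lemma fixed_point_unique:
  assumes B: "B > 0" and z: "response y B = y" "response z B = z" "0 \<le> y" "0 \<le> z"
  shows "y = z"
proof -
  have False if yz: "response y B = y" "response z B = z" "0 \<le> y" "y < z" for y z
  proof -
    define l where "l = y / z"
    have l: "0 \<le> l" "l < 1" "y = l * z" using yz by (auto simp: l_def)
    have "(1 - l) * (tanh B * m1) + l * response z B = (\<integral>x. ((1 - l) * tanh B + l * tanh (V x * z + B)) * V x \<partial>M)"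
    proof -
      have "((1 - l) * tanh B + l * tanh (V x * z + B)) * V x = (1 - l) * tanh B * V x + l * (tanh (V x * z + B) * V x)" for x
        by (simp add: algebra_simps)
      then show ?thesis using V_int tanh_V_int[of z B] by (simp add: response_def)
    qed
    also have "\<dots> \<le> response y B"
      unfolding response_def
    proof (rule integral_mono_AE)
      show "integrable M (\<lambda>x. ((1 - l) * tanh B + l * tanh (V x * z + B)) * V x)"
        using V_int tanh_V_int[of z B] by (simp add: distrib_right mult.assoc)
      show "AE x in M. ((1 - l) * tanh B + l * tanh (V x * z + B)) * V x \<le> tanh (V x * y + B) * V x"
        using V_nonneg
      proof eventually_elim
        case (elim x)
        have "(1 - l) * tanh B + l * tanh (V x * z + B) \<le> tanh ((1 - l) * B + l * (V x * z + B))"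
          using concave_onD[OF concave_tanh, of l B "V x * z + B"] l B elim yz by simp
        also have "(1 - l) * B + l * (V x * z + B) = V x * y + B" by (simp add: l(3) algebra_simps)
        finally show ?case using elim by (rule mult_right_mono)
      qed
    qed (rule tanh_V_int)
    finally have "(1 - l) * (tanh B * m1) \<le> 0" using yz l by simp
    then have "m1 \<le> 0" using l B by (simp add: mult_le_0_iff)
    moreover have "response z B \<le> m1"
      unfolding response_def
    proof (rule integral_mono_AE[OF tanh_V_int V_int])
      show "AE x in M. tanh (V x * z + B) * V x \<le> V x"
        using V_nonneg
      proof eventually_elim
        case (elim x)
        show ?case using mult_right_mono[OF less_imp_le[OF tanh_real_lt_1] elim] by simp
      qed
    qed
    ultimately show False using yz by simp
  qed
  then show ?thesis using z by (metis linorder_less_linear)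
qed

text \<open>
  Since \<open>V \<ge> 0\<close>, reflecting a negative maximizer to \<open>-z\<close> does not lower the functional, so both points are fixed points. Adding
  the two fixed-point equations, the integral of a nonnegative function vanishes, which is possible only for \<open>V = 0\<close>; but then
  the fixed point is \<open>0\<close>.
\<close>

lemma maximizer_nonneg:
  assumes B: "B > 0" and max: "maximizer B z" shows "0 \<le> z"
proof (rule ccontr)
  assume "\<not> ?thesis"
  then have z: "z < 0" by simp
  have "functional z B \<le> functional (- z) B"
  proof -
    have "(\<integral>x. ln (cosh (V x * z + B)) \<partial>M) \<le> (\<integral>x. ln (cosh (V x * (- z) + B)) \<partial>M)"
    proof (rule integral_mono_AE[OF ln_cosh_int ln_cosh_int])
      show "AE x in M. ln (cosh (V x * z + B)) \<le> ln (cosh (V x * (- z) + B))"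
        using V_nonneg
      proof eventually_elim
        case (elim x)
        have "V x * z \<le> 0" using elim z by (simp add: mult_nonneg_nonpos)
        then have "\<bar>V x * z + B\<bar> \<le> \<bar>V x * (- z) + B\<bar>" using B by auto
        then have "cosh \<bar>V x * z + B\<bar> \<le> cosh \<bar>V x * (- z) + B\<bar>" 
          by (subst cosh_real_nonneg_le_iff) auto
        then have "cosh (V x * z + B) \<le> cosh (V x * (- z) + B)" by simp
        then show ?case by (simp add: cosh_real_pos)
      qed
    qed
    then show ?thesis by (simp add: functional_def)
  qed
  then have "maximizer B (- z)" using max unfolding maximizer_def by (meson order_trans)
  then have fp: "response (- z) B = - z" "response z B = z" using max maximizer_fixed_point by auto
  let ?g = "\<lambda>x. tanh (V x * (- z) + B) * V x + tanh (V x * z + B) * V x"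
  have gpos: "?g x \<ge> 0" "V x > 0 \<Longrightarrow> ?g x > 0" if "V x \<ge> 0" for x
  proof -
    have "tanh (V x * z + - B) < tanh (V x * z + B)" using B by simp
    moreover have "tanh (V x * z + - B) = - tanh (V x * (- z) + B)"
      by (metis add.inverse_inverse minus_add_distrib mult_minus_right tanh_minus)
    ultimately have "tanh (V x * (- z) + B) + tanh (V x * z + B) > 0" by linarith
    then show "?g x \<ge> 0" "V x > 0 \<Longrightarrow> ?g x > 0"
      unfolding distrib_right[symmetric] using that by simp_all
  qed
  have int: "integrable M ?g" using tanh_V_int by (intro Bochner_Integration.integrable_add)
  have "(\<integral>x. ?g x \<partial>M) = 0" using fp tanh_V_int[of "- z" B] tanh_V_int[of z B]
    by (simp add: response_def)
  moreover have "AE x in M. 0 \<le> ?g x" using V_nonneg by eventually_elim (rule gpos(1))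
  ultimately have "AE x in M. ?g x = 0"
    using integral_nonneg_eq_0_iff_AE[OF int] by simp
  then have "AE x in M. V x = 0"
    using V_nonneg
  proof eventually_elim
    case (elim x)
    then show ?case using gpos(2)[of x] by (metis less_irrefl order_le_less)
  qed
  then have "response z B = (\<integral>x. 0 \<partial>M)"
    unfolding response_def by (intro integral_cong_AE) auto
  then show False using fp z by simp
qed

lemma maximizer_iff_fixed_point:
  assumes "B \<noteq> 0" shows "maximizer B z \<longleftrightarrow> response z B = z \<and> B * z \<ge> 0"
proof -
  have pos: "maximizer B z \<longleftrightarrow> response z B = z \<and> B * z \<ge> 0" if B: "B > 0" for B z
  proof
    assume "maximizer B z"
    then show "response z B = z \<and> B * z \<ge> 0" using maximizer_nonneg[OF B] maximizer_fixed_point B by simp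
  next
    assume *: "response z B = z \<and> B * z \<ge> 0"
    obtain y where "maximizer B y" using maximizer_exists by blast
    moreover have "y = z"
      using fixed_point_unique[OF B, of y z] * calculation maximizer_fixed_point maximizer_nonneg[OF B] B
      by (auto simp: zero_le_mult_iff)
    ultimately show "maximizer B z" by simp
  qed
  show ?thesis
  proof (cases "B > 0")
    case False
    then have "- B > 0" using assms by simp
    from pos[OF this, of "- z"] show ?thesis
      unfolding maximizer_minus response_minus by simp
  qed (rule pos)
qed

lemma maximizer_unique: "B \<noteq> 0 \<Longrightarrow> \<exists>!z. maximizer B z"
proof -
  have pos: "y = z" if "B > 0" "maximizer B y" "maximizer B z" for B y z
    using that fixed_point_unique maximizer_fixed_point maximizer_nonneg by blast
  assume "B \<noteq> 0"
  then have "y = z" if "maximizer B y" "maximizer B z" for y z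
    using pos[of B y z] pos[of "- B" "- y" "- z"] that unfolding maximizer_minus by fastforce
  then show ?thesis using maximizer_exists by blast
qed

text \<open>
  From \<open>\<bar>tanh x\<bar> \<le> \<bar>x\<bar>\<close> a fixed point satisfies \<open>\<bar>z\<bar> \<le> m2 \<bar>z\<bar>\<close>.
\<close>

lemma maximizer_zero_field:
  assumes "m2 < 1" shows "maximizer 0 z \<longleftrightarrow> z = 0"
proof -
  have "z = 0" if "maximizer 0 z" for z
  proof -
    have "\<bar>z\<bar> = \<bar>response z 0\<bar>" using maximizer_fixed_point[OF that] by simp
    also have "\<dots> \<le> (\<integral>x. \<bar>tanh (V x * z + 0) * V x\<bar> \<partial>M)"
      unfolding response_def by (rule integral_abs_bound)
    also have "\<dots> \<le> (\<integral>x. (V x)\<^sup>2 * \<bar>z\<bar> \<partial>M)"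
    proof (rule integral_mono)
      fix x
      have "\<bar>tanh (V x * z)\<bar> * \<bar>V x\<bar> \<le> \<bar>V x * z\<bar> * \<bar>V x\<bar>"
        using tanh_diff_le[of "V x * z" 0] by (intro mult_right_mono) auto
      also have "\<dots> = \<bar>(V x)\<^sup>2 * z\<bar>" by (simp only: abs_mult[symmetric] power2_eq_square mult_ac)
      finally show "\<bar>tanh (V x * z + 0) * V x\<bar> \<le> (V x)\<^sup>2 * \<bar>z\<bar>"
        by (simp only: abs_mult abs_power2 add_0_right)
    qed (use tanh_V_int[of z 0] V_int2 in \<open>auto intro: integrable_abs\<close>)
    finally have "\<bar>z\<bar> * (1 - m2) \<le> 0" by (simp add: algebra_simps)
    then show ?thesis using assms by (simp add: mult_le_0_iff)
  qed
  then show ?thesis using maximizer_exists[of 0] by metis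
qed

lemma response_le:
  assumes "0 \<le> z" "0 \<le> B" shows "response z B \<le> m2 * z + m1 * B"
proof -
  have "response z B \<le> (\<integral>x. (V x)\<^sup>2 * z + V x * B \<partial>M)"
    unfolding response_def
  proof (rule integral_mono_AE[OF tanh_V_int])
    show "AE x in M. tanh (V x * z + B) * V x \<le> (V x)\<^sup>2 * z + V x * B"
      using V_nonneg
    proof eventually_elim
      case (elim x)
      have "tanh (V x * z + B) * V x \<le> (V x * z + B) * V x"
        using elim assms by (intro mult_right_mono tanh_le_self) auto
      then show ?case by (simp add: power2_eq_square algebra_simps)
    qed
  qed (use V_int V_int2 in simp)
  then show ?thesis using V_int V_int2 by simp
qed

lemma mean_spin_le:
  assumes "0 \<le> z" "0 \<le> B" shows "mean_spin z B \<le> m1 * z + B"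
proof -
  have "mean_spin z B \<le> (\<integral>x. V x * z + B \<partial>M)"
    unfolding mean_spin_def
  proof (rule integral_mono_AE[OF tanh_int])
    show "AE x in M. tanh (V x * z + B) \<le> V x * z + B"
      using V_nonneg by eventually_elim (use assms in \<open>auto intro!: tanh_le_self\<close>)
  qed (use V_int in simp)
  then show ?thesis using V_int by (simp add: prob_space)
qed

lemma fixed_point_le:
  assumes m2: "m2 < 1" and z: "response z B = z" "0 \<le> z" "0 \<le> B"
  shows "z \<le> m1 / (1 - m2) * B"
  using response_le[OF z(2,3)] z(1) m2 by (simp add: field_simps)

text \<open>
  The linear response in the subcritical regime. The upper bound is \<open>tanh x \<le> x\<close>. For the lower bound, \<open>tanh x / x\<close> decreases and
  \<open>z B \<le> Y B\<close> with \<open>Y = m1 / (1 - m2)\<close>, so replacing \<open>tanh (V z + B)\<close> by \<open>\<rho> (V z + B)\<close>, where \<open>\<rho>\<close> is the ratio at the largest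
  possible argument \<open>B (V Y + 1)\<close>, loses only a factor that tends to \<open>1\<close> boundedly. This leaves linear inequalities for
  \<open>y = z B / B\<close> with coefficients converging to the moments of \<open>V\<close>.
\<close>

lemma mean_spin_slope:
  assumes m2: "m2 < 1"
    and z: "\<And>B. B > 0 \<Longrightarrow> response (z B) B = z B" "\<And>B. B > 0 \<Longrightarrow> 0 \<le> z B"
  shows "((\<lambda>B. mean_spin (z B) B / B) \<longlongrightarrow> 1 + m1\<^sup>2 / (1 - m2)) (at_right 0)"
proof -
  define Y where "Y = m1 / (1 - m2)"
  have Y: "Y \<ge> 0" using m1_nonneg m2 by (simp add: Y_def)
  define \<rho> where "\<rho> B v = tanh (B * (v * Y + 1)) / (B * (v * Y + 1))" for B v
  have \<rho>_bound: "\<bar>\<rho> B v\<bar> \<le> 1" for B v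
    using tanh_diff_le[of "B * (v * Y + 1)" 0] by (cases "B * (v * Y + 1) = 0") (auto simp: \<rho>_def)
  have \<rho>_meas [measurable]: "(\<lambda>x. \<rho> B (V x)) \<in> borel_measurable M" for B
    unfolding \<rho>_def by measurable
  have \<rho>_int: "integrable M (\<lambda>x. \<rho> B (V x))" "integrable M (\<lambda>x. V x * \<rho> B (V x))"
    "integrable M (\<lambda>x. (V x)\<^sup>2 * \<rho> B (V x))" for B
  proof -
    show "integrable M (\<lambda>x. \<rho> B (V x))" by (rule integrable_const_bound[of _ 1]) (auto simp: \<rho>_bound)
    show "integrable M (\<lambda>x. V x * \<rho> B (V x))"
      by (rule Bochner_Integration.integrable_bound[OF V_int])
        (auto simp: abs_mult intro!: mult_left_le \<rho>_bound)
    show "integrable M (\<lambda>x. (V x)\<^sup>2 * \<rho> B (V x))"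
      by (rule Bochner_Integration.integrable_bound[OF V_int2])
        (auto simp: abs_mult intro!: mult_left_le \<rho>_bound)
  qed
  have tanh0: "((\<lambda>h::real. tanh h / h) \<longlongrightarrow> 1) (at 0)"
  proof -
    have "(tanh has_real_derivative 1 - (tanh 0)\<^sup>2) (at (0::real))"
      by (auto intro!: derivative_eq_intros simp: power2_eq_square)
    then show ?thesis by (simp add: DERIV_def)
  qed
  have conv: "((\<lambda>B. \<integral>x. g (V x) * \<rho> B (V x) \<partial>M) \<longlongrightarrow> (\<integral>x. g (V x) \<partial>M)) (at_right 0)"
    if g: "integrable M (\<lambda>x. g (V x))" for g :: "real \<Rightarrow> real"
    unfolding tendsto_at_iff_sequentially o_def
  proof (intro allI impI)
    fix X :: "nat \<Rightarrow> real" assume X: "\<forall>i. X i \<in> {0<..} - {0}" "X \<longlonglongrightarrow> 0"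
    have [measurable]: "(\<lambda>x. g (V x)) \<in> borel_measurable M" using g by auto
    show "(\<lambda>n. \<integral>x. g (V x) * \<rho> (X n) (V x) \<partial>M) \<longlonglongrightarrow> (\<integral>x. g (V x) \<partial>M)"
    proof (rule integral_dominated_convergence[where w = "\<lambda>x. \<bar>g (V x)\<bar>"])
      show "AE x in M. (\<lambda>n. g (V x) * \<rho> (X n) (V x)) \<longlonglongrightarrow> g (V x)"
        using V_nonneg
      proof eventually_elim
        case (elim x)
        have c: "V x * Y + 1 > 0" using elim Y by (simp add: add_nonneg_pos)
        have "filterlim (\<lambda>n. X n * (V x * Y + 1)) (at 0) sequentially"
          unfolding filterlim_at
        proof
          show "(\<lambda>n. X n * (V x * Y + 1)) \<longlonglongrightarrow> 0"
            using tendsto_mult_left_zero[OF X(2)] by simp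
          show "\<forall>\<^sub>F n in sequentially. X n * (V x * Y + 1) \<in> UNIV \<and> X n * (V x * Y + 1) \<noteq> 0"
          proof (intro always_eventually allI)
            fix n
            have "X n > 0" using X(1)[rule_format, of n] by auto
            then show "X n * (V x * Y + 1) \<in> UNIV \<and> X n * (V x * Y + 1) \<noteq> 0" using c by simp
          qed
        qed
        from filterlim_compose[OF tanh0 this] have "(\<lambda>n. \<rho> (X n) (V x)) \<longlonglongrightarrow> 1" by (simp add: \<rho>_def)
        from tendsto_mult[OF tendsto_const this] show ?case by simp
      qed
      show "AE x in M. norm (g (V x) * \<rho> (X n) (V x)) \<le> \<bar>g (V x)\<bar>" for n
        by (auto simp: abs_mult intro!: mult_left_le \<rho>_bound)
    qed (use g in simp_all)
  qed
  define p where "p B = (\<integral>x. (V x)\<^sup>2 * \<rho> B (V x) \<partial>M)" for B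
  define q where "q B = (\<integral>x. V x * \<rho> B (V x) \<partial>M)" for B
  define r where "r B = (\<integral>x. \<rho> B (V x) \<partial>M)" for B
  have p: "(p \<longlongrightarrow> m2) (at_right 0)" unfolding p_def using conv[of "\<lambda>v. v\<^sup>2"] V_int2 by simp
  have q: "(q \<longlongrightarrow> m1) (at_right 0)" unfolding q_def using conv[of "\<lambda>v. v"] V_int by simp
  have r: "(r \<longlongrightarrow> 1) (at_right 0)" unfolding r_def using conv[of "\<lambda>v. 1"] by (simp add: prob_space)
  have bounds: "q B * (q B / (1 - p B)) + r B \<le> mean_spin (z B) B / B" "mean_spin (z B) B / B \<le> 1 + m1\<^sup>2 / (1 - m2)"
    if B: "B > 0" for B
  proof -
    define y where "y = z B / B"
    have zB: "z B = B * y" using B by (simp add: y_def)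
    have y: "0 \<le> y" "y \<le> Y" using z[OF B] B fixed_point_le[OF m2 z[OF B]] by (auto simp: y_def Y_def field_simps)
    have "mean_spin (z B) B \<le> m1 * z B + B" using mean_spin_le z(2)[OF B] B by simp
    also have "\<dots> \<le> (m1 * Y + 1) * B"
      using mult_left_mono[OF y(2) m1_nonneg] B by (simp add: zB algebra_simps)
    finally show "mean_spin (z B) B / B \<le> 1 + m1\<^sup>2 / (1 - m2)"
      using B by (simp add: divide_le_eq Y_def power2_eq_square add.commute)
    have pt: "B * ((v * y + 1) * \<rho> B v) \<le> tanh (v * z B + B)" if v: "0 \<le> v" for v
    proof -
      have "v * y \<le> v * Y" using y v by (intro mult_left_mono)
      moreover have "0 \<le> v * y" using y v by simp
      ultimately have "B * (v * y + 1) * tanh (B * (v * Y + 1)) \<le> B * (v * Y + 1) * tanh (B * (v * y + 1))"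
        using B by (intro tanh_ratio_antimono mult_left_mono) auto
      moreover have den: "B * (v * Y + 1) > 0" using B v Y by (simp add: add_nonneg_pos)
      ultimately have "B * (v * y + 1) * tanh (B * (v * Y + 1)) / (B * (v * Y + 1)) \<le> tanh (B * (v * y + 1))"
        unfolding pos_divide_le_eq[OF den] by (simp only: mult.commute)
      moreover have "B * (v * y + 1) = v * z B + B" by (simp add: zB algebra_simps)
      moreover have "B * ((v * y + 1) * \<rho> B v) = B * (v * y + 1) * tanh (B * (v * Y + 1)) / (B * (v * Y + 1))"
        by (simp only: \<rho>_def mult.assoc times_divide_eq_right)
      ultimately show ?thesis by simp
    qed
    have "(\<integral>x. B * y * ((V x)\<^sup>2 * \<rho> B (V x)) + B * (V x * \<rho> B (V x)) \<partial>M) \<le> response (z B) B"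
      unfolding response_def
    proof (rule integral_mono_AE[OF _ tanh_V_int])
      show "AE x in M. B * y * ((V x)\<^sup>2 * \<rho> B (V x)) + B * (V x * \<rho> B (V x)) \<le> tanh (V x * z B + B) * V x"
        using V_nonneg
      proof eventually_elim
        case (elim x)
        from mult_right_mono[OF pt[OF elim] elim] show ?case by (simp add: algebra_simps power2_eq_square)
      qed
    qed (use \<rho>_int in simp)
    then have "B * y * p B + B * q B \<le> B * y"
      using \<rho>_int z(1)[OF B] by (simp add: p_def q_def zB)
    \<comment> \<open>The fixed-point equation, divided by \<open>B\<close>.\<close>
    then have yq: "q B \<le> y * (1 - p B)" using B by (simp add: algebra_simps) (metis distrib_left mult_le_cancel_left_pos)
    have "p B \<le> m2" unfolding p_def
    proof (rule integral_mono[OF \<rho>_int(3) V_int2])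
      show "(V x)\<^sup>2 * \<rho> B (V x) \<le> (V x)\<^sup>2" for x
        using \<rho>_bound[of B "V x"] by (intro mult_left_le) auto
    qed
    then have yq': "q B / (1 - p B) \<le> y" using yq m2 by (simp add: pos_divide_le_eq)
    have q0: "0 \<le> q B" unfolding q_def
    proof (rule integral_nonneg_AE)
      show "AE x in M. 0 \<le> V x * \<rho> B (V x)"
        using V_nonneg by eventually_elim (use B Y in \<open>auto simp: \<rho>_def intro!: mult_nonneg_nonneg divide_nonneg_nonneg\<close>)
    qed
    have "(\<integral>x. B * y * (V x * \<rho> B (V x)) + B * \<rho> B (V x) \<partial>M) \<le> mean_spin (z B) B"
      unfolding mean_spin_def
    proof (rule integral_mono_AE[OF _ tanh_int])
      show "AE x in M. B * y * (V x * \<rho> B (V x)) + B * \<rho> B (V x) \<le> tanh (V x * z B + B)"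
        using V_nonneg
      proof eventually_elim
        case (elim x)
        from pt[OF elim] show ?case by (simp add: algebra_simps)
      qed
    qed (use \<rho>_int in simp)
    then have "B * y * q B + B * r B \<le> mean_spin (z B) B"
      using \<rho>_int by (simp add: q_def r_def)
    then have "q B * y + r B \<le> mean_spin (z B) B / B" using B by (simp add: field_simps)
    then show "q B * (q B / (1 - p B)) + r B \<le> mean_spin (z B) B / B"
      using mult_left_mono[OF yq' q0] by linarith
  qed
  have "((\<lambda>B. q B * (q B / (1 - p B)) + r B) \<longlongrightarrow> m1 * (m1 / (1 - m2)) + 1) (at_right 0)"
    using m2 by (intro tendsto_intros p q r) auto
  then have lim: "((\<lambda>B. q B * (q B / (1 - p B)) + r B) \<longlongrightarrow> 1 + m1\<^sup>2 / (1 - m2)) (at_right 0)"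
    by (simp add: power2_eq_square add.commute)
  have ev: "\<forall>\<^sub>F B in at_right (0::real). B > 0" by (simp add: eventually_at_right_less)
  show ?thesis
    by (rule tendsto_sandwich[OF _ _ lim tendsto_const])
      (use ev in \<open>eventually_elim, use bounds in auto\<close>)+
qed

text \<open>
  For small \<open>\<delta>\<close> the ratio \<open>response \<delta> 0 / \<delta>\<close> exceeds \<open>1\<close>, since it tends to \<open>m2\<close>, and it decreases in \<open>\<delta>\<close>. A
  fixed point in \<open>(0, \<delta>]\<close> for a positive field would then exceed itself; so \<open>z > \<delta>\<close> for every \<open>B > 0\<close>.
\<close>

lemma fixed_point_bounded_away:
  assumes m2: "m2 > 1"
  obtains c where "c > 0" "\<And>B z. B > 0 \<Longrightarrow> response z B = z \<Longrightarrow> 0 \<le> z \<Longrightarrow> c \<le> mean_spin z B"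
proof -
  have notAE: "\<not> (AE x in M. V x = 0)"
  proof
    assume "AE x in M. V x = 0"
    then have "m2 = (\<integral>x. 0 \<partial>M)" by (intro integral_cong_AE) auto
    then show False using m2 by simp
  qed
  have "(\<lambda>n. \<integral>x. tanh (V x * inverse (real (Suc n))) / inverse (real (Suc n)) * V x \<partial>M) \<longlonglongrightarrow> m2"
  proof (rule integral_dominated_convergence[where w = "\<lambda>x. (V x)\<^sup>2"])
    show "AE x in M. (\<lambda>n. tanh (V x * inverse (real (Suc n))) / inverse (real (Suc n)) * V x) \<longlonglongrightarrow> (V x)\<^sup>2"
    proof (rule AE_I2)
      fix x
      have "((\<lambda>h. tanh (V x * h)) has_real_derivative V x) (at 0)"
        by (auto intro!: derivative_eq_intros)
      then have 1: "((\<lambda>h. tanh (V x * h) / h) \<longlongrightarrow> V x) (at 0)" by (simp add: DERIV_def)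
      have "filterlim (\<lambda>n. inverse (real (Suc n))) (at 0) sequentially"
        unfolding filterlim_at using LIMSEQ_inverse_real_of_nat by auto
      from tendsto_mult_right[OF filterlim_compose[OF 1 this], of "V x"]
      show "(\<lambda>n. tanh (V x * inverse (real (Suc n))) / inverse (real (Suc n)) * V x) \<longlonglongrightarrow> (V x)\<^sup>2"
        by (simp add: power2_eq_square)
    qed
    show "AE x in M. norm (tanh (V x * inverse (real (Suc n))) / inverse (real (Suc n)) * V x) \<le> (V x)\<^sup>2" for n
    proof (rule AE_I2)
      fix x
      define h where "h = inverse (real (Suc n))"
      have h: "h > 0" by (simp add: h_def)
      have "\<bar>tanh (V x * h)\<bar> / h \<le> \<bar>V x * h\<bar> / h"
        using tanh_diff_le[of "V x * h" 0] h by (intro divide_right_mono) auto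
      then have "\<bar>tanh (V x * h)\<bar> / h \<le> \<bar>V x\<bar>" using h by (simp add: abs_mult)
      from mult_right_mono[OF this abs_ge_zero[of "V x"]]
      show "norm (tanh (V x * inverse (real (Suc n))) / inverse (real (Suc n)) * V x) \<le> (V x)\<^sup>2"
        unfolding h_def[symmetric] using h by (simp add: abs_mult power2_eq_square)
    qed
  qed (use V_int2 in simp_all)
  from order_tendstoD(1)[OF this m2] obtain n where
    n: "1 < (\<integral>x. tanh (V x * inverse (real (Suc n))) / inverse (real (Suc n)) * V x \<partial>M)"
    by (auto simp: eventually_sequentially)
  define \<delta> where "\<delta> = inverse (real (Suc n))"
  have \<delta>: "\<delta> > 0" by (simp add: \<delta>_def)
  have int\<delta>: "integrable M (\<lambda>x. tanh (V x * \<delta>) / \<delta> * V x)"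
    using tanh_V_int[of \<delta> 0] by simp
  have away: "\<delta> < z" if z: "B > 0" "response z B = z" "0 \<le> z" for z B
  proof (rule ccontr)
    assume "\<not> \<delta> < z"
    have "z \<noteq> 0"
    proof
      assume "z = 0"
      then have "tanh B * m1 = 0" using z unfolding response_def by simp
      then have "m1 = 0" using z by simp
      then have "AE x in M. V x = 0" using integral_nonneg_eq_0_iff_AE[OF V_int V_nonneg] by simp
      then show False using notAE by simp
    qed
    then have z': "0 < z" "z \<le> \<delta>" using z \<open>\<not> \<delta> < z\<close> by auto
    have "z < z * (\<integral>x. tanh (V x * \<delta>) / \<delta> * V x \<partial>M)"
      using mult_strict_left_mono[OF n z'(1)] by (simp only: \<delta>_def mult_1_right)
    also have "\<dots> = (\<integral>x. z * (tanh (V x * \<delta>) / \<delta> * V x) \<partial>M)" by simp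
    also have "\<dots> \<le> response z B"
      unfolding response_def
    proof (rule integral_mono_AE[OF _ tanh_V_int])
      show "integrable M (\<lambda>x. z * (tanh (V x * \<delta>) / \<delta> * V x))" using int\<delta> by (rule integrable_mult_right)
      show "AE x in M. z * (tanh (V x * \<delta>) / \<delta> * V x) \<le> tanh (V x * z + B) * V x"
        using V_nonneg
      proof eventually_elim
        case (elim x)
        show ?case
        proof (cases "V x = 0")
          case False
          then have v: "V x > 0" using elim by simp
          have "V x * z * tanh (V x * \<delta>) \<le> V x * \<delta> * tanh (V x * z)"
            using v z' by (intro tanh_ratio_antimono mult_left_mono) auto
          then have "z * tanh (V x * \<delta>) \<le> \<delta> * tanh (V x * z)"
            using v by (simp add: mult.assoc)
          then have "z * (tanh (V x * \<delta>) / \<delta>) \<le> tanh (V x * z)"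
            using \<delta> by (simp add: field_simps)
          also have "\<dots> \<le> tanh (V x * z + B)" using z by simp
          finally have "z * (tanh (V x * \<delta>) / \<delta>) * V x \<le> tanh (V x * z + B) * V x"
            using elim by (rule mult_right_mono)
          then show ?thesis by (simp only: mult.assoc)
        qed simp
      qed
    qed
    finally show False using z by simp
  qed
  have int0: "integrable M (\<lambda>x. tanh (V x * \<delta>))" using tanh_int[of \<delta> 0] by simp
  have nn: "AE x in M. 0 \<le> tanh (V x * \<delta>)" using V_nonneg by eventually_elim (use \<delta> in auto)
  show ?thesis
  proof (rule that[of "\<integral>x. tanh (V x * \<delta>) \<partial>M"])
    have "(\<integral>x. tanh (V x * \<delta>) \<partial>M) \<noteq> 0"
      unfolding integral_nonneg_eq_0_iff_AE[OF int0 nn] using notAE \<delta> by simp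
    then show "(\<integral>x. tanh (V x * \<delta>) \<partial>M) > 0" using integral_nonneg_AE[OF nn] by simp
    fix B z assume z: "B > 0" "response z B = z" "0 \<le> z"
    show "(\<integral>x. tanh (V x * \<delta>) \<partial>M) \<le> mean_spin z B"
      unfolding mean_spin_def
    proof (rule integral_mono_AE[OF int0 tanh_int])
      show "AE x in M. tanh (V x * \<delta>) \<le> tanh (V x * z + B)"
        using V_nonneg
      proof eventually_elim
        case (elim x)
        have "V x * \<delta> \<le> V x * z" using away[OF z] elim by (intro mult_left_mono) auto
        then show ?case using z by simp
      qed
    qed
  qed
qed

text \<open>
  The difference between \<open>\<psi>\<close> and the tangent of \<open>functional z\<close> in the field variable is minimal at \<open>B\<close>.
\<close>

lemma envelope:
  assumes max: "maximizer B z" and \<psi>: "\<And>C. functional z C + K \<le> \<psi> C" "\<psi> B = functional z B + K"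
    and der: "(\<psi> has_real_derivative D) (at B)"
  shows "D = mean_spin z B"
proof -
  let ?g = "\<lambda>C. \<psi> C - K - (functional z B + (C - B) * mean_spin z B)"
  have "(?g has_real_derivative (D - mean_spin z B)) (at B)"
    by (auto intro!: derivative_eq_intros der)
  moreover have "?g B \<le> ?g C" for C
    using functional_lower[of z B z C] \<psi>(1)[of C] \<psi>(2) by simp
  ultimately show ?thesis using DERIV_local_min[of ?g "D - mean_spin z B" B 1] by simp
qed

text \<open>
  In the subcritical regime the maximizer is of order \<open>B\<close>, so the maximal value differs from its value at \<open>B = 0\<close> by \<open>O(B\<^sup>2)\<close>. This
  gives the derivative of the pressure at \<open>B = 0\<close>.
\<close>

lemma functional_quadratic_near_zero:
  assumes m2: "m2 < 1" and max: "maximizer B z"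
  shows "\<bar>functional z B - functional 0 0\<bar> \<le> (m2 * (m1 / (1 - m2))\<^sup>2 + 2 * m1 * (m1 / (1 - m2)) + 1) * B\<^sup>2"
proof -
  define Y where "Y = m1 / (1 - m2)"
  have Y: "Y \<ge> 0" using m1_nonneg m2 by (simp add: Y_def)
  have pos: "\<bar>functional z B - functional 0 0\<bar> \<le> (m2 * Y\<^sup>2 + 2 * m1 * Y + 1) * B\<^sup>2"
    if B: "0 \<le> B" and max: "maximizer B z" and z: "0 \<le> z" for B z
  proof -
    have zY: "z \<le> Y * B" unfolding Y_def using fixed_point_le[OF m2 maximizer_fixed_point[OF max] z B] .
    have 0: "response 0 0 = 0" "mean_spin 0 0 = 0" by (simp_all add: response_def mean_spin_def)
    have "functional 0 0 \<le> functional 0 B" using functional_lower[of 0 0 0 B] 0 by simp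
    also have "\<dots> \<le> functional z B" using max by (simp add: maximizer_def)
    finally have lo: "functional 0 0 \<le> functional z B" .
    have "functional z B \<le> functional 0 0 + (m2 * z\<^sup>2 + 2 * m1 * z * B + B\<^sup>2)"
      using functional_upper[of z B 0 0] 0 by simp
    also have "\<dots> \<le> functional 0 0 + (m2 * (Y * B)\<^sup>2 + 2 * m1 * (Y * B) * B + B\<^sup>2)"
      using zY z B m1_nonneg by (intro add_left_mono add_right_mono add_mono mult_left_mono mult_right_mono power_mono) auto
    also have "\<dots> = functional 0 0 + (m2 * Y\<^sup>2 + 2 * m1 * Y + 1) * B\<^sup>2"
      by (simp add: power2_eq_square algebra_simps)
    finally show ?thesis using lo by simp
  qed
  have "\<bar>functional z B - functional 0 0\<bar> \<le> (m2 * Y\<^sup>2 + 2 * m1 * Y + 1) * B\<^sup>2"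
  proof (cases B "0::real" rule: linorder_cases)
    case greater
    then show ?thesis using pos[of B z] maximizer_nonneg[OF greater max] max by simp
  next
    case equal
    then show ?thesis using max maximizer_zero_field[OF m2] by simp
  next
    case less
    then have "- B > 0" by simp
    moreover have "maximizer (- B) (- z)" using max maximizer_minus by simp
    ultimately show ?thesis using pos[of "- B" "- z"] maximizer_nonneg[of "- B" "- z"] functional_minus[of z B] by simp
  qed
  then show ?thesis by (simp add: Y_def)
qed

end

section \<open>Differentiating a limit\<close>

text \<open>
  A uniform Lipschitz constant for the derivatives turns difference quotients into approximations of the derivative with an error
  that does not depend on \<open>n\<close>. Hence pointwise convergence of the functions makes the derivatives Cauchy, and the same error
  bound survives the limit.
\<close>

lemma derivative_of_limit:
  fixes f f' :: "nat \<Rightarrow> real \<Rightarrow> real"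
  assumes lim: "\<And>x. x \<in> {a<..<b} \<Longrightarrow> (\<lambda>n. f n x) \<longlonglongrightarrow> F x"
    and der: "\<And>n x. x \<in> {a<..<b} \<Longrightarrow> (f n has_real_derivative f' n x) (at x)"
    and lip: "\<And>n x y. x \<in> {a<..<b} \<Longrightarrow> y \<in> {a<..<b} \<Longrightarrow> \<bar>f' n x - f' n y\<bar> \<le> L * \<bar>x - y\<bar>"
    and x: "x \<in> {a<..<b}"
  shows "\<exists>D. (\<lambda>n. f' n x) \<longlonglongrightarrow> D \<and> (F has_real_derivative D) (at x)"
proof -
  have err: "\<bar>f n y - f n x - f' n x * (y - x)\<bar> \<le> L * (y - x)\<^sup>2" if y: "y \<in> {a<..<b}" for n y
  proof -
    have "\<exists>z. z \<in> {a<..<b} \<and> f n y - f n x = (y - x) * f' n z \<and> \<bar>z - x\<bar> \<le> \<bar>y - x\<bar>"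
    proof (cases x y rule: linorder_cases)
      case less
      have "\<exists>z>x. z < y \<and> f n y - f n x = (y - x) * f' n z"
        using less x y by (intro MVT2 der) auto
      then obtain z where "x < z" "z < y" "f n y - f n x = (y - x) * f' n z" by blast
      then show ?thesis using x y by (intro exI[of _ z]) auto
    next
      case greater
      have "\<exists>z>y. z < x \<and> f n x - f n y = (x - y) * f' n z"
        using greater x y by (intro MVT2 der) auto
      then obtain z where z: "y < z" "z < x" "f n x - f n y = (x - y) * f' n z" by blast
      then have "f n y - f n x = (y - x) * f' n z" by (simp add: algebra_simps)
      then show ?thesis using x y z(1,2) by (intro exI[of _ z]) auto
    next
      case equal
      then show ?thesis using x by auto
    qed
    then obtain z where z: "z \<in> {a<..<b}" "f n y - f n x = (y - x) * f' n z" "\<bar>z - x\<bar> \<le> \<bar>y - x\<bar>" by blast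
    have "\<bar>f n y - f n x - f' n x * (y - x)\<bar> = \<bar>y - x\<bar> * \<bar>f' n z - f' n x\<bar>"
      unfolding z(2) abs_mult[symmetric] by (simp add: algebra_simps)
    also have "\<dots> \<le> \<bar>y - x\<bar> * (L * \<bar>z - x\<bar>)" using lip[OF z(1) x] by (intro mult_left_mono) auto
    also have "\<dots> \<le> \<bar>y - x\<bar> * (L * \<bar>y - x\<bar>)"
    proof (cases "y = x")
      case False
      have "0 \<le> L * \<bar>y - x\<bar>" using lip[OF y x, of n] by linarith
      then have "0 \<le> L" using False by (simp add: zero_le_mult_iff)
      then show ?thesis using z(3) by (intro mult_left_mono) auto
    qed simp
    also have "\<dots> = L * (\<bar>y - x\<bar> * \<bar>y - x\<bar>)" by (simp only: mult_ac)
    also have "\<dots> = L * (y - x)\<^sup>2" by (simp add: power2_eq_square)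
    finally show ?thesis .
  qed
  have "Cauchy (\<lambda>n. f' n x)"
  proof (rule metric_CauchyI)
    fix e :: real assume e: "e > 0"
    \<comment> \<open>A step small enough for an error of at most \<open>e / 4\<close> in every difference quotient.\<close>
    define h where "h = min ((b - x) / 2) (e / (4 * (\<bar>L\<bar> + 1)))"
    have "h > 0" using x e by (auto simp: h_def)
    moreover have "h \<le> (b - x) / 2" unfolding h_def by (rule min.cobounded1)
    ultimately have h: "h > 0" "x + h \<in> {a<..<b}" using x by (auto simp: field_simps)
    have "L * h \<le> (\<bar>L\<bar> + 1) * (e / (4 * (\<bar>L\<bar> + 1)))"
      using h(1) by (intro mult_mono) (auto simp: h_def)
    also have "\<dots> = e / 4" using abs_ge_zero[of L] by (simp add: field_simps add_nonneg_eq_0_iff)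
    finally have Lh: "L * h \<le> e / 4" .
    have "(\<lambda>n. (f n (x + h) - f n x) / h) \<longlonglongrightarrow> (F (x + h) - F x) / h"
      using h by (intro tendsto_intros lim x) auto
    then have "Cauchy (\<lambda>n. (f n (x + h) - f n x) / h)" by (rule LIMSEQ_imp_Cauchy)
    then have "\<exists>M. \<forall>m\<ge>M. \<forall>n\<ge>M. dist ((f m (x + h) - f m x) / h) ((f n (x + h) - f n x) / h) < e / 4"
      using e by (intro metric_CauchyD) auto
    then obtain M where M: "\<And>m n. m \<ge> M \<Longrightarrow> n \<ge> M \<Longrightarrow>
        \<bar>(f m (x + h) - f m x) / h - (f n (x + h) - f n x) / h\<bar> < e / 4"
      unfolding dist_real_def by blast
    have q: "\<bar>(f n (x + h) - f n x) / h - f' n x\<bar> \<le> e / 4" for n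
    proof -
      have "f n (x + h) - f n x - f' n x * h = ((f n (x + h) - f n x) / h - f' n x) * h"
        using h by (simp add: field_simps)
      then have "\<bar>(f n (x + h) - f n x) / h - f' n x\<bar> * h = \<bar>f n (x + h) - f n x - f' n x * h\<bar>"
        using h by (simp only: abs_mult abs_of_pos)
      also have "\<dots> \<le> L * h * h" using err[OF h(2), of n] by (simp add: power2_eq_square)
      finally have "\<bar>(f n (x + h) - f n x) / h - f' n x\<bar> \<le> L * h" using h by simp
      then show ?thesis using Lh by simp
    qed
    have "dist (f' m x) (f' n x) < e" if "m \<ge> M" "n \<ge> M" for m n
      using M[OF that] q[of m] q[of n] e unfolding dist_real_def by linarith
    then show "\<exists>M. \<forall>m\<ge>M. \<forall>n\<ge>M. dist (f' m x) (f' n x) < e" by blast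
  qed
  then obtain D where D: "(\<lambda>n. f' n x) \<longlonglongrightarrow> D" using Cauchy_convergent convergent_def by blast
  have bound: "\<bar>F y - F x - D * (y - x)\<bar> \<le> L * (y - x)\<^sup>2" if y: "y \<in> {a<..<b}" for y
  proof (rule tendsto_upperbound)
    show "(\<lambda>n. \<bar>f n y - f n x - f' n x * (y - x)\<bar>) \<longlonglongrightarrow> \<bar>F y - F x - D * (y - x)\<bar>"
      by (intro tendsto_intros lim x y D)
  qed (use err[OF y] in auto)
  have "\<forall>\<^sub>F y in at x. y \<in> {a<..<b}" using x by (intro eventually_at_in_open') auto
  then have "\<forall>\<^sub>F y in at x. \<bar>F y - F x - D * (y - x)\<bar> \<le> L * (y - x)\<^sup>2"
    by eventually_elim (rule bound)
  then have "(F has_real_derivative D) (at x)" by (rule DERIV_of_quadratic_error)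
  with D show ?thesis by blast
qed

section \<open>The annealed measure as an Ising model\<close>

definition edge_load :: "(nat \<Rightarrow> nat \<Rightarrow> real) \<Rightarrow> nat \<Rightarrow> nat \<Rightarrow> nat \<Rightarrow> real" where
  "edge_load w N i j = w N i * w N j / total_weight w N"

text \<open>
  The hyperbolic tangent of the effective coupling \<open>\<beta>\<^sub>i\<^sub>j\<close>. The value \<open>0\<close> outside the vertex set makes the bounds
  \<open>0 \<le> t < 1\<close> hold for all indices.
\<close>

definition coupling :: "(nat \<Rightarrow> nat \<Rightarrow> real) \<Rightarrow> nat \<Rightarrow> real \<Rightarrow> nat \<Rightarrow> nat \<Rightarrow> real" where
  "coupling w N \<beta> i j =
     (if i \<in> {1..N} \<and> j \<in> {1..N} then edge_load w N i j * sinh \<beta> / (1 + edge_load w N i j * cosh \<beta>) else 0)"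

text \<open>
  The product of the factors \<open>p\<^sub>i\<^sub>j cosh \<beta> + 1 - p\<^sub>i\<^sub>j\<close>.
\<close>

definition edge_norm :: "(nat \<Rightarrow> nat \<Rightarrow> real) \<Rightarrow> nat \<Rightarrow> real \<Rightarrow> real" where
  "edge_norm w N \<beta> = (\<Prod>(i, j)\<in>vertex_pairs N. (1 + edge_load w N i j * cosh \<beta>) / (1 + edge_load w N i j))"

lemma Ising_sum_minus:
  assumes F: "F \<subseteq> vertex_pairs N" shows "Ising_sum N t F (- B) = Ising_sum N t F B"
proof -
  have "Ising_sum N t F B = (\<Sum>\<sigma>\<in>spins N. edge_weight t F (flip_spins N {1..N} \<sigma>) * exp (B * total_spin N (flip_spins N {1..N} \<sigma>)))"
    unfolding Ising_sum_def by (rule sum_flip_spins[symmetric])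
  also have "\<dots> = Ising_sum N t F (- B)"
    unfolding Ising_sum_def
  proof (intro sum.cong refl)
    fix \<sigma> assume \<sigma>: "\<sigma> \<in> spins N"
    have "total_spin N (flip_spins N {1..N} \<sigma>) = - total_spin N \<sigma>"
      unfolding total_spin_def sum_negf[symmetric] using \<sigma> by (intro sum.cong) (auto simp: flip_spins_def)
    then show "edge_weight t F (flip_spins N {1..N} \<sigma>) * exp (B * total_spin N (flip_spins N {1..N} \<sigma>))
        = edge_weight t F \<sigma> * exp (- B * total_spin N \<sigma>)"
      using edge_weight_flip_all[OF F \<sigma>] by simp
  qed
  finally show ?thesis ..
qed

locale positive_weights =
  fixes w :: "nat \<Rightarrow> nat \<Rightarrow> real"
  assumes w_pos: "\<And>N i. i \<in> {1..N} \<Longrightarrow> w N i > 0"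
begin

lemma total_weight_pos: "i \<in> {1..N} \<Longrightarrow> total_weight w N > 0"
  unfolding total_weight_def by (rule sum_pos) (use w_pos in auto)

lemma edge_load_pos: "i \<in> {1..N} \<Longrightarrow> j \<in> {1..N} \<Longrightarrow> edge_load w N i j > 0"
  unfolding edge_load_def using w_pos total_weight_pos by simp

lemma edge_prob_load:
  assumes "i \<in> {1..N}" "j \<in> {1..N}"
  shows "edge_prob w N i j = edge_load w N i j / (1 + edge_load w N i j)"
  using total_weight_pos[OF assms(1)] edge_load_pos[OF assms] w_pos[of i N] w_pos[of j N] assms
  unfolding edge_prob_def edge_load_def by (simp add: field_simps)

lemma edge_load_cosh_pos: "i \<in> {1..N} \<Longrightarrow> j \<in> {1..N} \<Longrightarrow> 0 < 1 + edge_load w N i j * cosh \<beta>"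
  using edge_load_pos cosh_real_pos[of \<beta>] by (simp add: add_pos_pos del: atLeastAtMost_iff)

lemma coupling_nonneg: "0 \<le> \<beta> \<Longrightarrow> 0 \<le> coupling w N \<beta> i j"
  unfolding coupling_def using edge_load_pos[of i N j] edge_load_cosh_pos[of i N j \<beta>]
  by (auto simp del: atLeastAtMost_iff)

lemma coupling_less_1: "coupling w N \<beta> i j < 1"
proof (cases "i \<in> {1..N} \<and> j \<in> {1..N}")
  case True
  then have x: "edge_load w N i j > 0" using edge_load_pos by simp
  have "edge_load w N i j * sinh \<beta> \<le> edge_load w N i j * cosh \<beta>" using x sinh_less_cosh_real[of \<beta>] by (intro mult_left_mono) auto
  moreover have "0 < 1 + edge_load w N i j * cosh \<beta>" using True edge_load_cosh_pos by blast
  ultimately show ?thesis using True unfolding coupling_def by (simp add: pos_divide_less_eq)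
qed (auto simp: coupling_def)

lemma coupling_le:
  assumes "0 \<le> \<beta>" "i \<in> {1..N}" "j \<in> {1..N}"
  shows "coupling w N \<beta> i j \<le> sinh \<beta> / total_weight w N * w N i * w N j"
proof -
  have x: "edge_load w N i j > 0" using edge_load_pos assms by simp
  have "edge_load w N i j * sinh \<beta> / (1 + edge_load w N i j * cosh \<beta>) \<le> edge_load w N i j * sinh \<beta> / 1"
    using x assms edge_load_cosh_pos[OF assms(2,3), of \<beta>] cosh_real_pos[of \<beta>]
    by (intro divide_left_mono) auto
  then show ?thesis using assms by (simp add: coupling_def edge_load_def mult_ac)
qed

lemma edge_norm_pos: "edge_norm w N \<beta> > 0"
  unfolding edge_norm_def
proof (rule prod_pos, clarify)
  fix i j assume "(i, j) \<in> vertex_pairs N"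
  then have "edge_load w N i j > 0" using edge_load_pos by (auto simp: vertex_pairs_def)
  then show "0 < (1 + edge_load w N i j * cosh \<beta>) / (1 + edge_load w N i j)"
    using cosh_real_pos[of \<beta>] by (auto intro!: divide_pos_pos add_pos_pos)
qed

text \<open>
  Edges are independent, so the expectation factorizes, and \<open>e\<^bsup>\<beta> s\<^esup> = cosh \<beta> + s sinh \<beta>\<close> for \<open>s = \<plusminus>1\<close>.
\<close>

lemma annealed_boltzmann:
  assumes \<sigma>: "\<sigma> \<in> spins N"
  shows "measure_pmf.expectation (GRG w N) (\<lambda>E. boltzmann N \<beta> B E \<sigma>) =
     edge_norm w N \<beta> * edge_weight (coupling w N \<beta>) (vertex_pairs N) \<sigma> * exp (B * total_spin N \<sigma>)"
proof -
  let ?V = "vertex_pairs N"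
  let ?f = "\<lambda>(i, j) b. if b then exp (\<beta> * (\<sigma> i * \<sigma> j)) else 1"
  have "measure_pmf.expectation (GRG w N) (\<lambda>E. boltzmann N \<beta> 0 E \<sigma>)
      = measure_pmf.expectation (Pi_pmf ?V False (\<lambda>(i, j). bernoulli_pmf (edge_prob w N i j)))
          (\<lambda>x. \<Prod>e\<in>?V. ?f e (x e))"
    unfolding GRG_def integral_map_pmf
  proof (rule Bochner_Integration.integral_cong[OF refl])
    fix x
    have "boltzmann N \<beta> 0 {e \<in> ?V. x e} \<sigma> = exp (\<Sum>(i, j)\<in>{e \<in> ?V. x e}. \<beta> * (\<sigma> i * \<sigma> j))"
      by (simp add: boltzmann_def sum_distrib_left case_prod_unfold)
    also have "\<dots> = (\<Prod>(i, j)\<in>{e \<in> ?V. x e}. exp (\<beta> * (\<sigma> i * \<sigma> j)))"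
      using finite_vertex_pairs by (subst exp_sum) (auto simp: case_prod_unfold)
    also have "\<dots> = (\<Prod>e\<in>?V. if x e then (case e of (i, j) \<Rightarrow> exp (\<beta> * (\<sigma> i * \<sigma> j))) else 1)"
      using finite_vertex_pairs by (subst prod.inter_filter) auto
    also have "\<dots> = (\<Prod>e\<in>?V. ?f e (x e))" by (intro prod.cong) auto
    finally show "boltzmann N \<beta> 0 {e \<in> ?V. x e} \<sigma> = (\<Prod>e\<in>?V. ?f e (x e))" .
  qed
  also have "\<dots> = (\<Prod>e\<in>?V. measure_pmf.expectation (case e of (i, j) \<Rightarrow> bernoulli_pmf (edge_prob w N i j)) (?f e))"
    using finite_vertex_pairs
    by (intro expectation_prod_Pi_pmf) (auto simp: integrable_measure_pmf_finite)
  also have "\<dots> = (\<Prod>e\<in>?V. (case e of (i, j) \<Rightarrow> (1 + edge_load w N i j * cosh \<beta>) / (1 + edge_load w N i j)) *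
       (case e of (i, j) \<Rightarrow> 1 + coupling w N \<beta> i j * \<sigma> i * \<sigma> j))"
  proof (intro prod.cong refl)
    fix e assume "e \<in> ?V"
    then obtain i j where e: "e = (i, j)" and ij: "i \<in> {1..N}" "j \<in> {1..N}"
      by (auto simp: vertex_pairs_def)
    define x where "x = edge_load w N i j"
    have x: "x > 0" unfolding x_def using edge_load_pos ij .
    have p: "edge_prob w N i j = x / (1 + x)" unfolding x_def using edge_prob_load ij .
    have p01: "0 \<le> x / (1 + x)" "x / (1 + x) \<le> 1" using x by auto
    have c: "1 + x * cosh \<beta> > 0" using x cosh_real_pos[of \<beta>] by (simp add: add_pos_pos)
    have ex: "exp (\<beta> * (\<sigma> i * \<sigma> j)) = cosh \<beta> + \<sigma> i * \<sigma> j * sinh \<beta>"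
      using spins_values[OF \<sigma> ij(1)] spins_values[OF \<sigma> ij(2)]
      by (auto simp: cosh_plus_sinh cosh_minus_sinh)
    have "measure_pmf.expectation (bernoulli_pmf (x / (1 + x))) (\<lambda>b. if b then exp (\<beta> * (\<sigma> i * \<sigma> j)) else 1)
        = x / (1 + x) * (cosh \<beta> + \<sigma> i * \<sigma> j * sinh \<beta>) + (1 - x / (1 + x))"
      using p01 by (simp add: ex)
    also have "\<dots> = (1 + x * cosh \<beta> + x * sinh \<beta> * \<sigma> i * \<sigma> j) / (1 + x)"
      using x by (simp add: field_simps)
    also have "1 + x * cosh \<beta> + x * sinh \<beta> * \<sigma> i * \<sigma> j
        = (1 + x * cosh \<beta>) * (1 + x * sinh \<beta> / (1 + x * cosh \<beta>) * \<sigma> i * \<sigma> j)"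
      using c by (simp add: distrib_left)
    also have "\<dots> / (1 + x) = (1 + x * cosh \<beta>) / (1 + x) * (1 + x * sinh \<beta> / (1 + x * cosh \<beta>) * \<sigma> i * \<sigma> j)"
      by simp
    finally show "measure_pmf.expectation (case e of (i, j) \<Rightarrow> bernoulli_pmf (edge_prob w N i j)) (?f e)
       = (case e of (i, j) \<Rightarrow> (1 + edge_load w N i j * cosh \<beta>) / (1 + edge_load w N i j)) *
         (case e of (i, j) \<Rightarrow> 1 + coupling w N \<beta> i j * \<sigma> i * \<sigma> j)"
      using ij by (simp add: e p coupling_def flip: x_def)
  qed
  also have "\<dots> = edge_norm w N \<beta> * edge_weight (coupling w N \<beta>) ?V \<sigma>"
    unfolding prod.distrib edge_norm_def edge_weight_def ..
  finally show ?thesis by (subst expectation_boltzmann) simp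
qed

abbreviation Z :: "nat \<Rightarrow> real \<Rightarrow> real \<Rightarrow> real" where
  "Z N \<beta> B \<equiv> Ising_sum N (coupling w N \<beta>) (vertex_pairs N) B"

lemma annealed_partition_function:
  "measure_pmf.expectation (GRG w N) (partition_function N \<beta> B) = edge_norm w N \<beta> * Z N \<beta> B"
  unfolding expectation_partition_function Ising_sum_def sum_distrib_left
  by (intro sum.cong refl) (simp add: annealed_boltzmann)

lemma Z_pos: "0 \<le> \<beta> \<Longrightarrow> Z N \<beta> B > 0"
  by (rule Ising_sum_pos[of "coupling w N \<beta>", OF coupling_nonneg coupling_less_1 order_refl])

lemma pressure_N_eq: "0 \<le> \<beta> \<Longrightarrow> pressure_N w N \<beta> B = (ln (edge_norm w N \<beta>) + ln (Z N \<beta> B)) / real N"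
  unfolding pressure_N_def annealed_partition_function using edge_norm_pos Z_pos
  by (simp add: ln_mult less_imp_neq[symmetric])

lemma annealed_prob_eq:
  assumes "\<sigma> \<in> spins N"
  shows "annealed_prob w N \<beta> B \<sigma> = edge_weight (coupling w N \<beta>) (vertex_pairs N) \<sigma> * exp (B * total_spin N \<sigma>) / Z N \<beta> B"
  unfolding annealed_prob_def annealed_partition_function annealed_boltzmann[OF assms]
  using edge_norm_pos[of N \<beta>] by simp

text \<open>
  The logarithmic derivative of the partition function in \<open>B\<close> is the mean total spin.
\<close>

lemma pressure_N_DERIV:
  assumes "0 \<le> \<beta>"
  shows "(pressure_N w N \<beta> has_real_derivative magnetization_N w N \<beta> B) (at B)"
proof -
  let ?e = "\<lambda>\<sigma>. edge_weight (coupling w N \<beta>) (vertex_pairs N) \<sigma>"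
  define Y where "Y = (\<Sum>\<sigma>\<in>spins N. total_spin N \<sigma> * (?e \<sigma> * exp (B * total_spin N \<sigma>)))"
  have "(Z N \<beta> has_real_derivative Y) (at B)"
    unfolding Ising_sum_def[abs_def] Y_def
    by (auto intro!: derivative_eq_intros sum.cong simp: algebra_simps)
  then have "((\<lambda>B. (ln (edge_norm w N \<beta>) + ln (Z N \<beta> B)) / real N) has_real_derivative Y / Z N \<beta> B / real N) (at B)"
    using Z_pos[OF assms, of N B] by (intro DERIV_cdivide) (auto intro!: derivative_eq_intros)
  moreover have "magnetization_N w N \<beta> B = Y / Z N \<beta> B / real N"
    unfolding magnetization_N_def annealed_expectation_def Y_def sum_divide_distrib
    by (intro sum.cong refl) (simp add: annealed_prob_eq)
  ultimately show ?thesis using pressure_N_eq[OF assms] by presburger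
qed

lemma magnetization_N_DERIV:
  "(magnetization_N w N \<beta> has_real_derivative susceptibility_N w N \<beta> B) (at B)"
  using susceptibility_N_eq_variance[of w N \<beta> B] by simp

lemma pressure_N_minus: "0 \<le> \<beta> \<Longrightarrow> pressure_N w N \<beta> (- B) = pressure_N w N \<beta> B"
  by (simp add: pressure_N_eq Ising_sum_minus)

lemma magnetization_N_minus:
  assumes "0 \<le> \<beta>" shows "magnetization_N w N \<beta> (- B) = - magnetization_N w N \<beta> B"
proof -
  have "((\<lambda>B. pressure_N w N \<beta> (- B)) has_real_derivative - magnetization_N w N \<beta> (- B)) (at B)"
    using DERIV_mirror[of "pressure_N w N \<beta>" "magnetization_N w N \<beta> (- B)" B] pressure_N_DERIV[OF assms, of N "- B"] by simp
  then have "(pressure_N w N \<beta> has_real_derivative - magnetization_N w N \<beta> (- B)) (at B)"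
    by (simp add: pressure_N_minus[OF assms])
  from DERIV_unique[OF this pressure_N_DERIV[OF assms]] show ?thesis by simp
qed

end

section \<open>Lee-Yang representation of the magnetization\<close>

text \<open>
  The contribution of a Lee-Yang zero with real part \<open>c\<close> to the total spin, followed by its first two derivatives in \<open>B\<close>.
\<close>

definition Lee_Yang_term :: "real \<Rightarrow> real \<Rightarrow> real" where
  "Lee_Yang_term c B = sinh (2 * B) / (cosh (2 * B) - c)"

definition Lee_Yang_term' :: "real \<Rightarrow> real \<Rightarrow> real" where
  "Lee_Yang_term' c B = 2 * cosh (2 * B) / (cosh (2 * B) - c) - 2 * (sinh (2 * B))\<^sup>2 / (cosh (2 * B) - c)\<^sup>2"

definition Lee_Yang_term'' :: "real \<Rightarrow> real \<Rightarrow> real" where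
  "Lee_Yang_term'' c B = 4 * sinh (2 * B) / (cosh (2 * B) - c)
     - 12 * sinh (2 * B) * cosh (2 * B) / (cosh (2 * B) - c)\<^sup>2
     + 8 * (sinh (2 * B)) ^ 3 / (cosh (2 * B) - c) ^ 3"

lemma cosh_double_gt_1: "B \<noteq> 0 \<Longrightarrow> 1 < cosh (2 * B :: real)"
  using cosh_real_strict_mono[of 0 "\<bar>2 * B\<bar>"] by simp

lemma DERIV_Lee_Yang_term:
  assumes "cosh (2 * B) - c \<noteq> 0" shows "(Lee_Yang_term c has_real_derivative Lee_Yang_term' c B) (at B)"
  unfolding Lee_Yang_term_def[abs_def]
  by (rule derivative_eq_intros refl assms | simp)+
    (use assms in \<open>simp add: Lee_Yang_term'_def power2_eq_square diff_divide_distrib mult_ac\<close>)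

lemma DERIV_Lee_Yang_term':
  assumes "cosh (2 * B) - c \<noteq> 0" shows "(Lee_Yang_term' c has_real_derivative Lee_Yang_term'' c B) (at B)"
proof -
  define d where "d = cosh (2 * B) - c"
  have d: "d \<noteq> 0" using assms by (simp add: d_def)
  have "(Lee_Yang_term' c has_real_derivative
    (2 * (sinh (2 * B) * 2) * d - 2 * cosh (2 * B) * (sinh (2 * B) * 2)) / (d * d)
     - (2 * (2 * sinh (2 * B) * (cosh (2 * B) * 2)) * d\<^sup>2 - 2 * (sinh (2 * B))\<^sup>2 * (2 * d * (sinh (2 * B) * 2))) / (d\<^sup>2 * d\<^sup>2)) (at B)"
    unfolding Lee_Yang_term'_def[abs_def] using d
    by (auto intro!: derivative_eq_intros simp: d_def)
  also have "(2 * (sinh (2 * B) * 2) * d - 2 * cosh (2 * B) * (sinh (2 * B) * 2)) / (d * d)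
     - (2 * (2 * sinh (2 * B) * (cosh (2 * B) * 2)) * d\<^sup>2 - 2 * (sinh (2 * B))\<^sup>2 * (2 * d * (sinh (2 * B) * 2))) / (d\<^sup>2 * d\<^sup>2)
     = Lee_Yang_term'' c B"
    unfolding Lee_Yang_term''_def d_def[symmetric] using d
    by (simp add: field_simps power2_eq_square power3_eq_cube)
  finally show ?thesis .
qed

text \<open>
  Only \<open>cosh 2B - c \<ge> cosh 2B - 1 > 0\<close> enters, so the bounds hold for every position of the zero.
\<close>

lemma Lee_Yang_term_bounds:
  assumes c: "\<bar>c\<bar> \<le> 1" and C: "cosh (2 * B) \<le> C" and d: "0 < d" "d \<le> cosh (2 * B) - 1"
  shows "\<bar>Lee_Yang_term' c B\<bar> \<le> 2 * C / d + 2 * C\<^sup>2 / d\<^sup>2"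
    and "\<bar>Lee_Yang_term'' c B\<bar> \<le> 4 * C / d + 12 * C * C / d\<^sup>2 + 8 * C ^ 3 / d ^ 3"
proof -
  define D where "D = cosh (2 * B) - c"
  have D: "d \<le> D" "0 < D" using c d by (auto simp: D_def)
  have ch: "0 \<le> cosh (2 * B)" and sh: "\<bar>sinh (2 * B)\<bar> \<le> C"
    using C sinh_le_cosh_real[of "2 * B"] sinh_le_cosh_real[of "- (2 * B)"] by (auto simp: abs_le_iff)
  have C0: "0 \<le> C" using ch C by linarith
  have q: "x / D ^ k \<le> y / d ^ k" if "0 \<le> x" "x \<le> y" for x y k
    using that D d by (intro frac_le power_mono) auto
  have "\<bar>Lee_Yang_term' c B\<bar> \<le> 2 * cosh (2 * B) / D ^ 1 + 2 * \<bar>sinh (2 * B)\<bar>\<^sup>2 / D\<^sup>2"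
    unfolding Lee_Yang_term'_def D_def[symmetric] using D(2) ch
    by (intro order_trans[OF abs_triangle_ineq4]) (simp add: abs_mult)
  also have "\<dots> \<le> 2 * C / d ^ 1 + 2 * C\<^sup>2 / d\<^sup>2"
    using ch C sh by (intro add_mono q mult_left_mono power_mono) auto
  finally show "\<bar>Lee_Yang_term' c B\<bar> \<le> 2 * C / d + 2 * C\<^sup>2 / d\<^sup>2" by simp
  have "\<bar>Lee_Yang_term'' c B\<bar> \<le> 4 * \<bar>sinh (2 * B)\<bar> / D ^ 1 + 12 * \<bar>sinh (2 * B)\<bar> * cosh (2 * B) / D\<^sup>2 + 8 * \<bar>sinh (2 * B)\<bar> ^ 3 / D ^ 3"
    unfolding Lee_Yang_term''_def D_def[symmetric] using D(2) ch
    by (intro order_trans[OF abs_triangle_ineq] add_mono order_trans[OF abs_triangle_ineq4])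
      (simp_all add: abs_mult power_abs)
  also have "\<dots> \<le> 4 * C / d ^ 1 + 12 * C * C / d\<^sup>2 + 8 * C ^ 3 / d ^ 3"
    using ch C sh C0 by (intro add_mono q mult_mono power_mono mult_nonneg_nonneg) auto
  finally show "\<bar>Lee_Yang_term'' c B\<bar> \<le> 4 * C / d + 12 * C * C / d\<^sup>2 + 8 * C ^ 3 / d ^ 3" by simp
qed

lemma average_bound:
  assumes "\<And>k. \<bar>g k :: real\<bar> \<le> L" "0 \<le> L" shows "\<bar>(\<Sum>k<N. g k) / real N\<bar> \<le> L"
proof (cases "N = 0")
  case False
  have "\<bar>\<Sum>k<N. g k\<bar> \<le> (\<Sum>k<N. \<bar>g k\<bar>)" by (rule sum_abs)
  also have "\<dots> \<le> (\<Sum>k<N. L)" by (intro sum_mono assms)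
  finally show ?thesis using False by (simp add: field_simps)
qed (use assms in simp)

context positive_weights
begin

text \<open>
  Differentiate the logarithm of the Lee-Yang factorization.
\<close>

lemma magnetization_N_Lee_Yang:
  assumes \<beta>: "0 \<le> \<beta>"
  obtains c where "\<And>k. \<bar>c k\<bar> \<le> 1"
    "\<And>B. B \<noteq> 0 \<Longrightarrow> magnetization_N w N \<beta> B = (\<Sum>k<N. Lee_Yang_term (c k) B) / real N"
proof -
  obtain K c where K: "K > 0" and c: "\<And>k. \<bar>c k\<bar> \<le> 1"
    and fact: "\<And>B. (Z N \<beta> B)\<^sup>2 = K * (\<Prod>k<N. cosh (2 * B) - c k)"
    using Lee_Yang_factorization[of "coupling w N \<beta>", OF coupling_nonneg[OF \<beta>] coupling_less_1 order_refl] by blast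
  have d: "cosh (2 * B) - c k > 0" if "B \<noteq> 0" for B k
    using cosh_double_gt_1[OF that] c[of k] by auto
  let ?f = "\<lambda>B. (ln (edge_norm w N \<beta>) + (ln K + (\<Sum>k<N. ln (cosh (2 * B) - c k))) / 2) / real N"
  have P: "pressure_N w N \<beta> B = ?f B" if B: "B \<noteq> 0" for B
  proof -
    have "2 * ln (Z N \<beta> B) = ln ((Z N \<beta> B)\<^sup>2)" using Z_pos[OF \<beta>, of N B] by (simp add: ln_realpow)
    also have "\<dots> = ln K + (\<Sum>k<N. ln (cosh (2 * B) - c k))"
    proof -
      have "(\<Prod>k<N. cosh (2 * B) - c k) > 0" using d[OF B] by (intro prod_pos) auto
      moreover have "ln (\<Prod>k<N. cosh (2 * B) - c k) = (\<Sum>k<N. ln (cosh (2 * B) - c k))"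
        by (rule ln_prod) (use d[OF B] in \<open>auto simp: less_imp_neq[symmetric]\<close>)
      ultimately show ?thesis unfolding fact using K by (simp only: ln_mult_pos)
    qed
    finally show ?thesis by (simp add: pressure_N_eq[OF \<beta>])
  qed
  have "magnetization_N w N \<beta> B = (\<Sum>k<N. Lee_Yang_term (c k) B) / real N" if B: "B \<noteq> 0" for B
  proof -
    have sumd: "((\<lambda>B. \<Sum>k<N. ln (cosh (2 * B) - c k)) has_real_derivative (\<Sum>k<N. 2 * Lee_Yang_term (c k) B)) (at B)"
    proof (rule DERIV_sum)
      show "((\<lambda>B. ln (cosh (2 * B) - c k)) has_real_derivative 2 * Lee_Yang_term (c k) B) (at B)" for k
        using d[OF B, of k] by (auto intro!: derivative_eq_intros simp: Lee_Yang_term_def)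
    qed
    have "(?f has_real_derivative ((\<Sum>k<N. 2 * Lee_Yang_term (c k) B) / 2) / real N) (at B)"
      by (rule DERIV_cong[OF DERIV_cdivide[OF DERIV_add[OF DERIV_const
            DERIV_cdivide[OF DERIV_add[OF DERIV_const sumd]]]]]) simp
    then have "(pressure_N w N \<beta> has_real_derivative ((\<Sum>k<N. 2 * Lee_Yang_term (c k) B) / 2) / real N) (at B)"
      by (rule has_field_derivative_transform_within_open[where S = "- {0}"]) (use B P in auto)
    from DERIV_unique[OF pressure_N_DERIV[OF \<beta>] this] show ?thesis
      by (simp add: sum_distrib_left[symmetric])
  qed
  with c that show ?thesis by blast
qed

lemma susceptibility_N_Lee_Yang:
  assumes \<beta>: "0 \<le> \<beta>" and c: "\<And>k. \<bar>c k\<bar> \<le> 1"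
    and m: "\<And>B. B \<noteq> 0 \<Longrightarrow> magnetization_N w N \<beta> B = (\<Sum>k<N. Lee_Yang_term (c k) B) / real N"
    and B: "B \<noteq> 0"
  shows "susceptibility_N w N \<beta> B = (\<Sum>k<N. Lee_Yang_term' (c k) B) / real N"
proof -
  have d: "cosh (2 * B) - c k \<noteq> 0" for k
    using cosh_double_gt_1[OF B] c[of k] by auto
  have "((\<lambda>B. (\<Sum>k<N. Lee_Yang_term (c k) B) / real N) has_real_derivative (\<Sum>k<N. Lee_Yang_term' (c k) B) / real N) (at B)"
    by (intro DERIV_cdivide DERIV_sum DERIV_Lee_Yang_term d)
  then have "(magnetization_N w N \<beta> has_real_derivative (\<Sum>k<N. Lee_Yang_term' (c k) B) / real N) (at B)"
    by (rule has_field_derivative_transform_within_open[where S = "- {0}"]) (use B m in auto)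
  from DERIV_unique[OF magnetization_N_DERIV this] show ?thesis .
qed

text \<open>
  The condition \<open>a * b > 0\<close> keeps the interval on one side of \<open>0\<close>, where the zeros of the partition function may accumulate.
  The constant does not depend on \<open>N\<close>.
\<close>

lemma magnetization_N_lipschitz:
  assumes \<beta>: "0 \<le> \<beta>" and ab: "0 < a * b" "a < b"
  obtains L where "\<And>N x y. x \<in> {a<..<b} \<Longrightarrow> y \<in> {a<..<b} \<Longrightarrow>
      \<bar>magnetization_N w N \<beta> x - magnetization_N w N \<beta> y\<bar> \<le> L * \<bar>x - y\<bar>"
    "\<And>N x y. x \<in> {a<..<b} \<Longrightarrow> y \<in> {a<..<b} \<Longrightarrow>
      \<bar>susceptibility_N w N \<beta> x - susceptibility_N w N \<beta> y\<bar> \<le> L * \<bar>x - y\<bar>"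
proof -
  define m where "m = min \<bar>a\<bar> \<bar>b\<bar>"
  define R where "R = max \<bar>a\<bar> \<bar>b\<bar>"
  have m: "m > 0" using ab by (auto simp: m_def)
  have range: "m \<le> \<bar>x\<bar>" "\<bar>x\<bar> \<le> R" "x \<noteq> 0" if "x \<in> {a<..<b}" for x
    using that ab m by (auto simp: m_def R_def zero_less_mult_iff)
  define C where "C = cosh (2 * R)"
  define d where "d = cosh (2 * m) - 1"
  have d0: "d > 0" using cosh_double_gt_1[of m] m by (simp add: d_def)
  have C0: "C > 0" by (simp add: C_def)
  have Cd: "cosh (2 * x) \<le> C" "d \<le> cosh (2 * x) - 1" if x: "x \<in> {a<..<b}" for x
  proof -
    have "cosh (2 * x) = cosh (2 * \<bar>x\<bar>)" by (cases "0 \<le> x") simp_all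
    moreover have "cosh (2 * \<bar>x\<bar>) \<le> cosh (2 * R)" "cosh (2 * m) \<le> cosh (2 * \<bar>x\<bar>)"
      using range[OF x] m by (auto simp: cosh_real_nonneg_le_iff)
    ultimately show "cosh (2 * x) \<le> C" "d \<le> cosh (2 * x) - 1" unfolding C_def d_def by linarith+
  qed
  define L1 where "L1 = 2 * C / d + 2 * C\<^sup>2 / d\<^sup>2"
  define L2 where "L2 = 4 * C / d + 12 * C * C / d\<^sup>2 + 8 * C ^ 3 / d ^ 3"
  have L0: "0 \<le> L1" "0 \<le> L2" using d0 C0 by (simp_all add: L1_def L2_def)
  note bnd = Lee_Yang_term_bounds[OF _ Cd(1) d0 Cd(2), folded L1_def L2_def]
  show ?thesis
  proof (rule that[of "L1 + L2"])
    fix N x y assume x: "x \<in> {a<..<b}" and y: "y \<in> {a<..<b}"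
    obtain c where c: "\<And>k. \<bar>c k\<bar> \<le> 1"
      "\<And>B. B \<noteq> 0 \<Longrightarrow> magnetization_N w N \<beta> B = (\<Sum>k<N. Lee_Yang_term (c k) B) / real N"
      using magnetization_N_Lee_Yang[OF \<beta>] by blast
    have sus: "susceptibility_N w N \<beta> B = (\<Sum>k<N. Lee_Yang_term' (c k) B) / real N" if "B \<noteq> 0" for B
      by (rule susceptibility_N_Lee_Yang[OF \<beta> _ _ that]) (use c in auto)
    have dk: "cosh (2 * z) - c k \<noteq> 0" if "z \<in> {a<..<b}" for z k
      using cosh_double_gt_1[OF range(3)[OF that]] c(1)[of k] by auto
    have "norm (magnetization_N w N \<beta> x - magnetization_N w N \<beta> y) \<le> L1 * norm (x - y)"
    proof (rule field_differentiable_bound[where S = "{a<..<b}" and f' = "susceptibility_N w N \<beta>"])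
      fix z assume z: "z \<in> {a<..<b}"
      show "(magnetization_N w N \<beta> has_field_derivative susceptibility_N w N \<beta> z) (at z within {a<..<b})"
        using magnetization_N_DERIV by (rule has_field_derivative_at_within)
      show "norm (susceptibility_N w N \<beta> z) \<le> L1"
        unfolding sus[OF range(3)[OF z]] real_norm_def
        by (rule average_bound[OF bnd(1)[OF c(1) z z] L0(1)])
    qed (use x y in auto)
    also have "\<dots> \<le> (L1 + L2) * norm (x - y)" using L0 by (intro mult_right_mono) auto
    finally show "\<bar>magnetization_N w N \<beta> x - magnetization_N w N \<beta> y\<bar> \<le> (L1 + L2) * \<bar>x - y\<bar>" by simp
    have "norm ((\<Sum>k<N. Lee_Yang_term' (c k) x) / real N - (\<Sum>k<N. Lee_Yang_term' (c k) y) / real N) \<le> L2 * norm (x - y)"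
    proof (rule field_differentiable_bound[where S = "{a<..<b}" and f' = "\<lambda>z. (\<Sum>k<N. Lee_Yang_term'' (c k) z) / real N"])
      fix z assume z: "z \<in> {a<..<b}"
      show "((\<lambda>x. (\<Sum>k<N. Lee_Yang_term' (c k) x) / real N) has_field_derivative (\<Sum>k<N. Lee_Yang_term'' (c k) z) / real N) (at z within {a<..<b})"
        by (rule has_field_derivative_at_within) (intro DERIV_cdivide DERIV_sum DERIV_Lee_Yang_term' dk z)
      show "norm ((\<Sum>k<N. Lee_Yang_term'' (c k) z) / real N) \<le> L2"
        unfolding real_norm_def by (rule average_bound[OF bnd(2)[OF c(1) z z] L0(2)])
    qed (use x y in auto)
    also have "\<dots> \<le> (L1 + L2) * norm (x - y)" using L0 by (intro mult_right_mono) auto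
    finally show "\<bar>susceptibility_N w N \<beta> x - susceptibility_N w N \<beta> y\<bar> \<le> (L1 + L2) * \<bar>x - y\<bar>"
      unfolding sus[OF range(3)[OF x]] sus[OF range(3)[OF y]] by simp
  qed
qed

lemma magnetization_N_nonneg:
  assumes \<beta>: "0 \<le> \<beta>" and B: "0 < B" shows "0 \<le> magnetization_N w N \<beta> B"
proof -
  obtain c where c: "\<And>k. \<bar>c k\<bar> \<le> 1"
    "\<And>B. B \<noteq> 0 \<Longrightarrow> magnetization_N w N \<beta> B = (\<Sum>k<N. Lee_Yang_term (c k) B) / real N"
    using magnetization_N_Lee_Yang[OF \<beta>] by blast
  have "0 \<le> Lee_Yang_term (c k) B" for k
    unfolding Lee_Yang_term_def using B cosh_double_gt_1[of B] c(1)[of k]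
    by (intro divide_nonneg_nonneg) auto
  then show ?thesis using c(2) B by (simp add: sum_nonneg)
qed

text \<open>
  Each Lee-Yang term divided by \<open>sinh 2b\<close> equals \<open>1 / (cosh 2b - c)\<close>, which decreases in \<open>b\<close>. Since
  \<open>sinh 2b \<ge> 2b\<close>, it follows that \<open>M\<^sub>N(b) / b \<ge> 2 M\<^sub>N(b) / sinh 2b \<ge> 2 M\<^sub>N(B) / sinh 2B\<close> for \<open>0 < b < B\<close>; let \<open>b\<close> tend to
  \<open>0\<close>.
\<close>

lemma susceptibility_N_zero_ge:
  assumes \<beta>: "0 \<le> \<beta>" and B: "0 < B"
  shows "2 * magnetization_N w N \<beta> B / sinh (2 * B) \<le> susceptibility_N w N \<beta> 0"
proof -
  let ?m = "magnetization_N w N \<beta>"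
  obtain c where c: "\<And>k. \<bar>c k\<bar> \<le> 1"
    "\<And>B. B \<noteq> 0 \<Longrightarrow> ?m B = (\<Sum>k<N. Lee_Yang_term (c k) B) / real N"
    using magnetization_N_Lee_Yang[OF \<beta>] by blast
  define r where "r = ?m B / sinh (2 * B)"
  have sB: "sinh (2 * B) > 0" using B by simp
  have r0: "0 \<le> r" using magnetization_N_nonneg[OF \<beta> B] sB by (simp add: r_def)
  have ge: "2 * r \<le> ?m b / b" if b: "0 < b" "b < B" for b
  proof -
    have sb: "sinh (2 * b) > 0" using b by simp
    have "Lee_Yang_term (c k) B / sinh (2 * B) \<le> Lee_Yang_term (c k) b / sinh (2 * b)" for k
    proof -
      have "0 < cosh (2 * b) - c k" using cosh_double_gt_1[of b] b c(1)[of k] by auto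
      moreover have "cosh (2 * b) \<le> cosh (2 * B)" using b by (simp add: cosh_real_nonneg_le_iff)
      ultimately have "1 / (cosh (2 * B) - c k) \<le> 1 / (cosh (2 * b) - c k)"
        by (intro divide_left_mono) auto
      then show ?thesis using sB sb by (simp add: Lee_Yang_term_def)
    qed
    then have "(\<Sum>k<N. Lee_Yang_term (c k) B / sinh (2 * B)) / real N \<le> (\<Sum>k<N. Lee_Yang_term (c k) b / sinh (2 * b)) / real N"
      by (intro divide_right_mono sum_mono) auto
    then have rb: "r \<le> ?m b / sinh (2 * b)"
      using c(2)[of b] c(2)[of B] b B by (simp add: r_def sum_divide_distrib[symmetric] mult.commute)
    have "2 * b \<le> sinh (2 * b)"
    proof -
      have "sinh 0 - 0 \<le> sinh (2 * b) - 2 * b"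
      proof (rule DERIV_nonneg_imp_nondecreasing[where f = "\<lambda>x. sinh x - x" and a = 0 and b = "2 * b"])
        show "\<exists>y. ((\<lambda>x. sinh x - x) has_real_derivative y) (at x) \<and> 0 \<le> y" for x :: real
          using cosh_real_ge_1[of x] by (intro exI[of _ "cosh x - 1"]) (auto intro!: derivative_eq_intros)
      qed (use b in auto)
      then show ?thesis by simp
    qed
    then have "2 * b * r \<le> sinh (2 * b) * r" using r0 by (intro mult_right_mono)
    also have "\<dots> \<le> ?m b" using rb sb by (simp add: field_simps)
    finally show ?thesis using b by (simp add: field_simps)
  qed
  have m0: "?m 0 = 0" using magnetization_N_minus[OF \<beta>, of N 0] by simp
  have "((\<lambda>b. ?m b / b) \<longlongrightarrow> susceptibility_N w N \<beta> 0) (at 0)"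
    using magnetization_N_DERIV[of N \<beta> 0] m0 by (simp add: DERIV_def)
  then have lim: "((\<lambda>b. ?m b / b) \<longlongrightarrow> susceptibility_N w N \<beta> 0) (at_right 0)"
    by (rule filterlim_mono) (auto simp: at_within_le_at)
  have "\<forall>\<^sub>F b in at_right 0. 2 * r \<le> ?m b / b"
    using eventually_at_right_real[OF B] by eventually_elim (use ge in auto)
  from tendsto_lowerbound[OF lim this] show ?thesis by (simp add: r_def)
qed

text \<open>
  In zero field the mean spin vanishes and the susceptibility is the mean of \<open>S\<^sub>N\<^sup>2 / N\<close>; the correlation bound applies with
  \<open>s = sinh \<beta> / \<ell>\<^sub>N\<close>.
\<close>

lemma susceptibility_N_zero_le:
  assumes \<beta>: "0 \<le> \<beta>" and N: "0 < N"
    and small: "sinh \<beta> / total_weight w N * (\<Sum>k\<in>{1..N}. (w N k)\<^sup>2) < 1"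
  shows "susceptibility_N w N \<beta> 0 \<le> 1 + sinh \<beta> * (total_weight w N / real N)
       / (1 - sinh \<beta> / total_weight w N * (\<Sum>k\<in>{1..N}. (w N k)\<^sup>2))"
proof -
  let ?e = "edge_weight (coupling w N \<beta>) (vertex_pairs N)"
  define s where "s = sinh \<beta> / total_weight w N"
  have l: "total_weight w N > 0" using total_weight_pos[of N N] N by simp
  have s: "0 \<le> s" using \<beta> l by (simp add: s_def)
  have m0: "magnetization_N w N \<beta> 0 = 0" using magnetization_N_minus[OF \<beta>, of N 0] by simp
  then have "annealed_expectation w N \<beta> 0 (\<lambda>\<sigma>. total_spin N \<sigma> / real N) = 0" by (simp add: magnetization_N_def)
  then have "(\<Sum>\<sigma>\<in>spins N. total_spin N \<sigma> * annealed_prob w N \<beta> 0 \<sigma>) / real N = 0"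
    unfolding annealed_expectation_def sum_divide_distrib by (simp add: field_simps)
  then have "(\<Sum>\<sigma>\<in>spins N. total_spin N \<sigma> * annealed_prob w N \<beta> 0 \<sigma>) = 0" using N by simp
  then have e0: "annealed_expectation w N \<beta> 0 (\<lambda>\<sigma>. total_spin N \<sigma> / sqrt (real N)) = 0"
    unfolding annealed_expectation_def by (simp add: sum_divide_distrib[symmetric])
  have "susceptibility_N w N \<beta> 0 = (\<Sum>\<sigma>\<in>spins N. (total_spin N \<sigma>)\<^sup>2 / real N * annealed_prob w N \<beta> 0 \<sigma>)"
    unfolding susceptibility_N_eq_variance(2) annealed_variance_def e0
    by (simp add: annealed_expectation_def power_divide)
  also have "\<dots> = (\<Sum>\<sigma>\<in>spins N. ?e \<sigma> * (total_spin N \<sigma>)\<^sup>2) / Z N \<beta> 0 / real N"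
    unfolding sum_divide_distrib by (intro sum.cong refl) (simp add: annealed_prob_eq mult.commute)
  also have "\<dots> \<le> (real N + s / (1 - s * (\<Sum>k\<in>{1..N}. (w N k)\<^sup>2)) * (\<Sum>k\<in>{1..N}. w N k)\<^sup>2) / real N"
  proof (intro divide_right_mono spin_variance_le)
    show "s * (\<Sum>k\<in>{1..N}. (w N k)\<^sup>2) < 1" using small by (simp add: s_def)
  qed (use coupling_nonneg[OF \<beta>] coupling_less_1 s w_pos coupling_le[OF \<beta>] in \<open>auto simp: s_def intro: less_imp_le\<close>)
  also have "\<dots> = 1 + sinh \<beta> * (total_weight w N / real N) / (1 - s * (\<Sum>k\<in>{1..N}. (w N k)\<^sup>2))"
  proof -
    have sl: "sinh \<beta> = s * total_weight w N" using l by (simp add: s_def)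
    show ?thesis unfolding sl total_weight_def[symmetric] using N
      by (simp add: add_divide_distrib power2_eq_square mult_ac)
  qed
  finally show ?thesis by (simp add: s_def)
qed

end

section \<open>Empirical averages of the weights\<close>

locale regular_weights = positive_weights w for w +
  fixes M :: "'a measure" and W :: "'a \<Rightarrow> real"
  assumes regular: "weight_regularity w M W"
begin

abbreviation EW where "EW \<equiv> (\<integral>x. W x \<partial>M)"
abbreviation EW2 where "EW2 \<equiv> (\<integral>x. (W x)\<^sup>2 \<partial>M)"

definition empirical_mean :: "nat \<Rightarrow> (real \<Rightarrow> real) \<Rightarrow> real" where
  "empirical_mean N f = (\<Sum>i\<in>{1..N}. f (w N i)) / real N"

lemma prob_M: "prob_space M" and W_meas [measurable]: "W \<in> borel_measurable M"
  and W_int: "integrable M W" and W_int2: "integrable M (\<lambda>x. (W x)\<^sup>2)" and EW_pos: "0 < EW"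
  using regular by (auto simp: weight_regularity_def)

lemma expectation_empirical_mean: "0 < N \<Longrightarrow> measure_pmf.expectation (pmf_of_set {1..N}) (\<lambda>i. f (w N i)) = empirical_mean N f"
  unfolding empirical_mean_def by (subst integral_pmf_of_set) auto

lemma tendsto_empirical_mean:
  assumes "(\<lambda>N. measure_pmf.expectation (pmf_of_set {1..N}) (\<lambda>i. f (w N i))) \<longlonglongrightarrow> l"
  shows "(\<lambda>N. empirical_mean N f) \<longlonglongrightarrow> l"
  by (rule Lim_transform_eventually[OF assms])
    (use eventually_gt_at_top[of 0] in eventually_elim, use expectation_empirical_mean in auto)

lemma empirical_first_moment: "(\<lambda>N. empirical_mean N (\<lambda>x. x)) \<longlonglongrightarrow> EW"
  and empirical_second_moment: "(\<lambda>N. empirical_mean N (\<lambda>x. x\<^sup>2)) \<longlonglongrightarrow> EW2"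
  using regular by (auto simp: weight_regularity_def intro!: tendsto_empirical_mean)

lemma empirical_mean_bounded_continuous:
  assumes f: "continuous_on UNIV f" "\<And>x. \<bar>f x\<bar> \<le> K"
  shows "(\<lambda>N. empirical_mean N f) \<longlonglongrightarrow> (\<integral>x. f (W x) \<partial>M)"
proof (rule tendsto_empirical_mean)
  interpret prob_space M by (rule prob_M)
  let ?\<mu> = "\<lambda>N. distr (measure_pmf (pmf_of_set {1..N})) borel (w N)"
  have rd: "real_distribution (?\<mu> N)" for N
    by (intro prob_space.real_distribution_distr measure_pmf.prob_space_axioms) simp
  have rdM: "real_distribution (distr M borel W)" by (intro real_distribution_distr) simp
  have [measurable]: "f \<in> borel_measurable borel" using f(1) by (rule borel_measurable_continuous_onI)
  have "(\<lambda>N. integral\<^sup>L (?\<mu> N) f) \<longlonglongrightarrow> integral\<^sup>L (distr M borel W) f"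
  proof (rule weak_conv_imp_integral_bdd_continuous_conv[OF rd rdM])
    show "weak_conv_m ?\<mu> (distr M borel W)" using regular by (simp add: weight_regularity_def)
    show "isCont f x" for x using f(1) by (simp add: continuous_on_eq_continuous_at)
    show "norm (f x) \<le> K" for x using f(2) by simp
  qed
  then show "(\<lambda>N. measure_pmf.expectation (pmf_of_set {1..N}) (\<lambda>i. f (w N i))) \<longlonglongrightarrow> (\<integral>x. f (W x) \<partial>M)"
    by (simp add: integral_distr)
qed

text \<open>
  Truncating the argument at \<open>\<plusminus>K\<close> makes the function bounded and costs at most \<open>L x\<^sup>2 / K\<close>; the second moments are bounded, so
  the cost is small uniformly in \<open>N\<close>.
\<close>

lemma empirical_mean_lipschitz:
  assumes lip: "\<And>x y. \<bar>f x - f y\<bar> \<le> L * \<bar>x - y\<bar>"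
  shows "(\<lambda>N. empirical_mean N f) \<longlonglongrightarrow> (\<integral>x. f (W x) \<partial>M)"
proof -
  interpret prob_space M by (rule prob_M)
  have L: "0 \<le> L" using lip[of 1 0] by simp
  have cont: "continuous_on UNIV f"
  proof (rule lipschitz_on_continuous_on[of L])
    show "L-lipschitz_on UNIV f" using L lip by (auto simp: lipschitz_on_def dist_real_def)
  qed
  have [measurable]: "f \<in> borel_measurable borel" using cont by (rule borel_measurable_continuous_onI)
  define g where "g K x = f (max (- K) (min x K))" for K x
  have gcont: "continuous_on UNIV (g K)" for K
    unfolding g_def by (intro continuous_on_compose2[OF cont] continuous_intros) auto
  have gbound: "\<bar>g K x\<bar> \<le> \<bar>f 0\<bar> + L * \<bar>K\<bar>" for K x
  proof -
    have "\<bar>g K x - f 0\<bar> \<le> L * \<bar>max (- K) (min x K)\<bar>" unfolding g_def using lip[of _ 0] by simp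
    also have "\<dots> \<le> L * \<bar>K\<bar>" using L by (intro mult_left_mono) (auto simp: max_def min_def)
    finally show ?thesis by linarith
  qed
  have [measurable]: "g K \<in> borel_measurable borel" for K using gcont by (rule borel_measurable_continuous_onI)
  have diff: "\<bar>f x - g K x\<bar> \<le> L / K * x\<^sup>2" if K: "K > 0" for K x
  proof -
    have "\<bar>f x - g K x\<bar> \<le> L * \<bar>x - max (- K) (min x K)\<bar>" unfolding g_def by (rule lip)
    also have "\<bar>x - max (- K) (min x K)\<bar> \<le> x\<^sup>2 / K"
    proof (cases "\<bar>x\<bar> \<le> K")
      case True
      then have "x - max (- K) (min x K) = 0" by (auto simp: max_def min_def)
      then show ?thesis using K by simp
    next
      case False
      have "\<bar>x - max (- K) (min x K)\<bar> \<le> \<bar>x\<bar>" using False K by (auto simp: max_def min_def)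
      also have "\<dots> \<le> x\<^sup>2 / K"
      proof -
        have "K * \<bar>x\<bar> \<le> \<bar>x\<bar> * \<bar>x\<bar>" using False by (intro mult_right_mono) auto
        then show ?thesis using K by (simp add: field_simps power2_eq_square)
      qed
      finally show ?thesis .
    qed
    finally show ?thesis using L by (simp add: mult_left_mono)
  qed
  have f_int: "integrable M (\<lambda>x. f (W x))"
  proof (rule Bochner_Integration.integrable_bound)
    show "integrable M (\<lambda>x. \<bar>f 0\<bar> + L * \<bar>W x\<bar>)" using W_int by simp
    show "AE x in M. norm (f (W x)) \<le> norm (\<bar>f 0\<bar> + L * \<bar>W x\<bar>)"
      using lip[of _ 0] L by (intro AE_I2) (smt (verit) abs_ge_zero diff_zero mult_nonneg_nonneg real_norm_def)
  qed measurable
  have g_int: "integrable M (\<lambda>x. g K (W x))" for K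
    by (rule integrable_const_bound[of _ "\<bar>f 0\<bar> + L * \<bar>K\<bar>"]) (auto simp: gbound)
  define S where "S = EW2 + 1"
  have S: "S > 0" using integral_nonneg_AE[of "\<lambda>x. (W x)\<^sup>2" M] by (simp add: S_def add_nonneg_pos)
  have evS: "\<forall>\<^sub>F N in sequentially. empirical_mean N (\<lambda>x. x\<^sup>2) < S"
    using order_tendstoD(2)[OF empirical_second_moment, of S] by (simp add: S_def)
  show ?thesis
  proof (rule LIMSEQ_I)
    fix e :: real assume e: "e > 0"
    define L' where "L' = L + 1"
    have L': "L' > 0" "L \<le> L'" using L by (auto simp: L'_def)
    define K where "K = 3 * L' * S / e"
    have K: "K > 0" using S L' e by (simp add: K_def)
    have "L / K * S \<le> L' / K * S" using K S L' by (intro mult_right_mono divide_right_mono) auto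
    also have "\<dots> = e / 3" using S L' e by (simp add: K_def)
    finally have LK: "L / K * S \<le> e / 3" .
    have "\<bar>(\<integral>x. f (W x) \<partial>M) - (\<integral>x. g K (W x) \<partial>M)\<bar> = \<bar>\<integral>x. f (W x) - g K (W x) \<partial>M\<bar>"
      using f_int g_int by simp
    also have "\<dots> \<le> (\<integral>x. \<bar>f (W x) - g K (W x)\<bar> \<partial>M)" by (rule integral_abs_bound)
    also have "\<dots> \<le> (\<integral>x. L / K * (W x)\<^sup>2 \<partial>M)"
    proof (rule integral_mono)
      show "integrable M (\<lambda>x. \<bar>f (W x) - g K (W x)\<bar>)" using f_int g_int by simp
      show "integrable M (\<lambda>x. L / K * (W x)\<^sup>2)" using W_int2 by simp
    qed (rule diff[OF K])
    also have "\<dots> \<le> L / K * S" using L K by (simp add: S_def mult_left_mono divide_right_mono)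
    also note LK
    finally have 1: "\<bar>(\<integral>x. f (W x) \<partial>M) - (\<integral>x. g K (W x) \<partial>M)\<bar> \<le> e / 3" .
    have "\<forall>\<^sub>F N in sequentially. \<bar>empirical_mean N (g K) - (\<integral>x. g K (W x) \<partial>M)\<bar> < e / 3"
      using tendstoD[OF empirical_mean_bounded_continuous[OF gcont gbound], of "e / 3" K] e by (simp add: dist_real_def)
    with evS have "\<forall>\<^sub>F N in sequentially. norm (empirical_mean N f - (\<integral>x. f (W x) \<partial>M)) < e"
    proof eventually_elim
      case (elim N)
      have "\<bar>empirical_mean N f - empirical_mean N (g K)\<bar> = \<bar>\<Sum>i\<in>{1..N}. f (w N i) - g K (w N i)\<bar> / real N"
        unfolding empirical_mean_def by (simp add: sum_subtractf diff_divide_distrib[symmetric])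
      also have "\<dots> \<le> (\<Sum>i\<in>{1..N}. L / K * (w N i)\<^sup>2) / real N"
        by (intro divide_right_mono order_trans[OF sum_abs] sum_mono diff[OF K]) auto
      also have "\<dots> = L / K * empirical_mean N (\<lambda>x. x\<^sup>2)" by (simp add: empirical_mean_def sum_distrib_left)
      also have "\<dots> \<le> L / K * S" using elim(1) L K by (intro mult_left_mono) auto
      finally show ?case using 1 elim(2) LK unfolding real_norm_def by linarith
    qed
    then show "\<exists>no. \<forall>N\<ge>no. norm (empirical_mean N f - (\<integral>x. f (W x) \<partial>M)) < e"
      by (simp add: eventually_sequentially)
  qed
qed

text \<open>
  Weak limits of positive weights are nonnegative: test with a bounded continuous function that is positive exactly on the negative
  half-line.
\<close>

lemma W_nonneg: "AE x in M. 0 \<le> W x"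
proof -
  interpret prob_space M by (rule prob_M)
  let ?f = "\<lambda>x::real. min 1 (max 0 (- x))"
  have fc: "continuous_on UNIV ?f" by (intro continuous_intros)
  have fb: "\<bar>?f x\<bar> \<le> 1" for x by auto
  have "(\<lambda>N. empirical_mean N ?f) \<longlonglongrightarrow> (\<integral>x. ?f (W x) \<partial>M)" by (rule empirical_mean_bounded_continuous[OF fc fb])
  moreover have "empirical_mean N ?f = 0" for N
  proof -
    have "?f (w N i) = 0" if "i \<in> {1..N}" for i using w_pos[OF that] by simp
    then show ?thesis unfolding empirical_mean_def by simp
  qed
  ultimately have "(\<integral>x. ?f (W x) \<partial>M) = 0" by (simp add: LIMSEQ_const_iff)
  moreover have "integrable M (\<lambda>x. ?f (W x))" by (rule integrable_const_bound[of _ 1]) auto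
  ultimately have "AE x in M. ?f (W x) = 0"
    using integral_nonneg_eq_0_iff_AE[of M "\<lambda>x. ?f (W x)"] by auto
  then show ?thesis by eventually_elim (auto simp: min_def max_def split: if_splits)
qed

lemma total_weight_over_N: "(\<lambda>N. total_weight w N / real N) \<longlonglongrightarrow> EW"
  using empirical_first_moment by (simp add: empirical_mean_def total_weight_def)

definition sum_sq :: "nat \<Rightarrow> real" where "sum_sq N = (\<Sum>i\<in>{1..N}. (w N i)\<^sup>2)"

lemma sum_sq_over_total: "(\<lambda>N. sum_sq N / total_weight w N) \<longlonglongrightarrow> EW2 / EW"
proof (rule Lim_transform_eventually)
  show "(\<lambda>N. empirical_mean N (\<lambda>x. x\<^sup>2) / (total_weight w N / real N)) \<longlonglongrightarrow> EW2 / EW"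
    using EW_pos by (intro tendsto_divide empirical_second_moment total_weight_over_N) auto
  show "\<forall>\<^sub>F N in sequentially. empirical_mean N (\<lambda>x. x\<^sup>2) / (total_weight w N / real N) = sum_sq N / total_weight w N"
    using eventually_gt_at_top[of 0] by eventually_elim (simp add: empirical_mean_def sum_sq_def)
qed

lemma over_N_null: "(\<lambda>N. c N) \<longlonglongrightarrow> l \<Longrightarrow> (\<lambda>N. c N / real N) \<longlonglongrightarrow> (0::real)"
  using tendsto_divide_0 filterlim_at_top_imp_at_infinity filterlim_real_sequentially by blast

end

section \<open>Reduction to a rank-one interaction\<close>

lemma sum_vertex_pairs_symmetric:
  fixes g :: "nat \<Rightarrow> nat \<Rightarrow> real"
  assumes sym: "\<And>i j. g i j = g j i"
  shows "(\<Sum>i\<in>{1..N}. \<Sum>j\<in>{1..N}. g i j) = 2 * (\<Sum>(i, j)\<in>vertex_pairs N. g i j) + (\<Sum>i\<in>{1..N}. g i i)"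
proof -
  let ?U = "vertex_pairs N" and ?L = "(\<lambda>(i, j). (j, i)) ` vertex_pairs N" and ?D = "(\<lambda>i. (i, i)) ` {1..N}"
  have split: "{1..N} \<times> {1..N} = (?U \<union> ?L) \<union> ?D"
  proof (rule set_eqI, clarify)
    fix a b
    show "(a, b) \<in> {1..N} \<times> {1..N} \<longleftrightarrow> (a, b) \<in> ?U \<union> ?L \<union> ?D"
      by (cases a b rule: linorder_cases) (auto simp: vertex_pairs_def image_iff)
  qed
  have "(\<Sum>i\<in>{1..N}. \<Sum>j\<in>{1..N}. g i j) = (\<Sum>(i, j)\<in>{1..N} \<times> {1..N}. g i j)"
    by (rule sum.cartesian_product)
  also have "\<dots> = (\<Sum>(i, j)\<in>?U \<union> ?L. g i j) + (\<Sum>(i, j)\<in>?D. g i j)"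
    unfolding split using finite_vertex_pairs
    by (intro sum.union_disjoint) (auto simp: vertex_pairs_def)
  also have "(\<Sum>(i, j)\<in>?U \<union> ?L. g i j) = (\<Sum>(i, j)\<in>?U. g i j) + (\<Sum>(i, j)\<in>?L. g i j)"
    using finite_vertex_pairs by (intro sum.union_disjoint) (auto simp: vertex_pairs_def)
  also have "(\<Sum>(i, j)\<in>?L. g i j) = (\<Sum>(i, j)\<in>?U. g i j)"
    by (subst sum.reindex) (auto simp: inj_on_def o_def case_prod_unfold sym[of "snd _"])
  also have "(\<Sum>(i, j)\<in>?D. g i j) = (\<Sum>i\<in>{1..N}. g i i)"
    by (subst sum.reindex) (auto simp: inj_on_def)
  finally show ?thesis by simp
qed

lemma ln_one_plus_error: "0 \<le> x \<Longrightarrow> \<bar>ln (1 + x) - x\<bar> \<le> (x::real)\<^sup>2"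
proof -
  assume x: "0 \<le> x"
  have up: "ln (1 + x) \<le> x" using x by (rule ln_add_one_self_le_self)
  have "x - x\<^sup>2 \<le> ln (1 + x)"
  proof (cases "x \<le> 1")
    case True
    then show ?thesis using x by (intro ln_one_plus_pos_lower_bound)
  next
    case False
    then have "1 * x \<le> x * x" by (intro mult_right_mono) auto
    moreover have "0 \<le> ln (1 + x)" using x by simp
    ultimately show ?thesis by (simp add: power2_eq_square)
  qed
  then show ?thesis using up by (simp add: abs_le_iff)
qed

context positive_weights
begin

lemma beta_edge_load:
  assumes "i \<in> {1..N}" "j \<in> {1..N}"
  shows "beta_edge w N \<beta> i j = (ln (1 + exp \<beta> * edge_load w N i j) - ln (1 + exp (- \<beta>) * edge_load w N i j)) / 2"
proof -
  define x where "x = edge_load w N i j"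
  have x: "x > 0" unfolding x_def using edge_load_pos[OF assms] .
  have p: "edge_prob w N i j = x / (1 + x)" unfolding x_def by (rule edge_prob_load[OF assms])
  have "c * (x / (1 + x)) + (1 - x / (1 + x)) = (1 + c * x) / (1 + x)" for c
    using x by (simp add: field_simps)
  then have "beta_edge w N \<beta> i j = 1 / 2 * ln ((1 + exp \<beta> * x) / (1 + exp (- \<beta>) * x))"
    unfolding beta_edge_def p using x by simp
  also have "\<dots> = (ln (1 + exp \<beta> * x) - ln (1 + exp (- \<beta>) * x)) / 2"
  proof -
    have "0 < 1 + exp \<beta> * x" "0 < 1 + exp (- \<beta>) * x" using x by (simp_all add: add_pos_pos)
    then show ?thesis by (simp only: ln_divide_pos)
  qed
  finally show ?thesis unfolding x_def .
qed

lemma beta_edge_bounds: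
  assumes \<beta>: "0 \<le> \<beta>" and ij: "i \<in> {1..N}" "j \<in> {1..N}"
  shows "0 \<le> beta_edge w N \<beta> i j" "beta_edge w N \<beta> i j \<le> exp \<beta> * edge_load w N i j"
proof -
  define x where "x = edge_load w N i j"
  have x: "x > 0" unfolding x_def using edge_load_pos[OF ij] .
  have b: "beta_edge w N \<beta> i j = (ln (1 + exp \<beta> * x) - ln (1 + exp (- \<beta>) * x)) / 2"
    unfolding x_def by (rule beta_edge_load[OF ij])
  have "1 + exp (- \<beta>) * x \<le> 1 + exp \<beta> * x" using x \<beta> by simp
  moreover have p: "0 < 1 + exp (- \<beta>) * x" using x by (simp add: add_pos_pos)
  ultimately show "0 \<le> beta_edge w N \<beta> i j" unfolding b by simp
  have half: "(a - b) / 2 \<le> p" if "0 \<le> b" "0 \<le> p" "a \<le> p" for a b p :: real using that by simp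
  have "0 \<le> ln (1 + exp (- \<beta>) * x)" "0 \<le> exp \<beta> * x" using x by auto
  moreover have "ln (1 + exp \<beta> * x) \<le> exp \<beta> * x" using x by (intro ln_add_one_self_le_self) simp
  ultimately show "beta_edge w N \<beta> i j \<le> exp \<beta> * edge_load w N i j" unfolding b x_def[symmetric] by (intro half)
qed

lemma edge_norm_factor_error:
  assumes ij: "i \<in> {1..N}" "j \<in> {1..N}"
  shows "\<bar>ln ((1 + edge_load w N i j * cosh \<beta>) / (1 + edge_load w N i j)) - (cosh \<beta> - 1) * edge_load w N i j\<bar>
      \<le> ((cosh \<beta>)\<^sup>2 + 1) * (edge_load w N i j)\<^sup>2"
proof -
  define x where "x = edge_load w N i j"
  have x: "x > 0" unfolding x_def using edge_load_pos[OF ij] .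
  have c: "0 < 1 + x * cosh \<beta>" using edge_load_cosh_pos[OF ij] by (simp add: x_def)
  have "ln ((1 + x * cosh \<beta>) / (1 + x)) = ln (1 + x * cosh \<beta>) - ln (1 + x)"
    using x c by (subst ln_div) auto
  moreover have "\<bar>ln (1 + x * cosh \<beta>) - x * cosh \<beta>\<bar> \<le> (x * cosh \<beta>)\<^sup>2" "\<bar>ln (1 + x) - x\<bar> \<le> x\<^sup>2"
    using x cosh_real_pos[of \<beta>] by (auto intro!: ln_one_plus_error)
  ultimately show ?thesis unfolding x_def[symmetric]
    by (simp add: algebra_simps power_mult_distrib)
qed

text \<open>
  Writing \<open>1 + t s = (1 + x e\<^bsup>s\<beta>\<^esup>) / (1 + x cosh \<beta>)\<close>, both logarithms are linear in \<open>x\<close> up to \<open>O(x\<^sup>2)\<close>, and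
  \<open>e\<^bsup>s\<beta>\<^esup> - cosh \<beta> = s sinh \<beta>\<close>.
\<close>

lemma coupling_factor_error:
  assumes \<beta>: "0 \<le> \<beta>" and ij: "i \<in> {1..N}" "j \<in> {1..N}" and \<sigma>: "\<sigma> \<in> spins N"
  shows "\<bar>ln (1 + coupling w N \<beta> i j * \<sigma> i * \<sigma> j) - sinh \<beta> * (edge_load w N i j * (\<sigma> i * \<sigma> j))\<bar>
      \<le> ((exp \<beta>)\<^sup>2 + (cosh \<beta>)\<^sup>2) * (edge_load w N i j)\<^sup>2"
proof -
  define x where "x = edge_load w N i j"
  have x: "x > 0" unfolding x_def using edge_load_pos[OF ij] .
  have c: "0 < 1 + x * cosh \<beta>" using edge_load_cosh_pos[OF ij] by (simp add: x_def)
  define s where "s = \<sigma> i * \<sigma> j"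
  have s: "s = 1 \<or> s = -1" using spins_values[OF \<sigma> ij(1)] spins_values[OF \<sigma> ij(2)] by (auto simp: s_def)
  have e: "exp (s * \<beta>) = cosh \<beta> + s * sinh \<beta>" using s by (auto simp: cosh_plus_sinh cosh_minus_sinh)
  have e2: "exp (s * \<beta>) \<le> exp \<beta>" using s \<beta> by auto
  have "1 + coupling w N \<beta> i j * \<sigma> i * \<sigma> j = (1 + x * exp (s * \<beta>)) / (1 + x * cosh \<beta>)"
    unfolding e coupling_def x_def[symmetric] using c ij by (simp add: s_def field_simps)
  moreover have "0 < 1 + x * exp (s * \<beta>)" using x by (simp add: add_pos_pos)
  ultimately have "ln (1 + coupling w N \<beta> i j * \<sigma> i * \<sigma> j) = ln (1 + x * exp (s * \<beta>)) - ln (1 + x * cosh \<beta>)"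
    using c by (simp add: ln_div less_imp_neq[symmetric])
  moreover have "\<bar>ln (1 + x * cosh \<beta>) - x * cosh \<beta>\<bar> \<le> (x * cosh \<beta>)\<^sup>2"
    "\<bar>ln (1 + x * exp (s * \<beta>)) - x * exp (s * \<beta>)\<bar> \<le> (x * exp (s * \<beta>))\<^sup>2"
    using x cosh_real_pos[of \<beta>] by (auto intro!: ln_one_plus_error)
  moreover have "(x * exp (s * \<beta>))\<^sup>2 \<le> (x * exp \<beta>)\<^sup>2" using x e2 by (intro power_mono mult_left_mono) auto
  moreover have "sinh \<beta> * (x * s) = x * exp (s * \<beta>) - x * cosh \<beta>" unfolding e by (simp add: algebra_simps)
  ultimately have "\<bar>ln (1 + coupling w N \<beta> i j * \<sigma> i * \<sigma> j) - sinh \<beta> * (x * s)\<bar> \<le> (x * exp \<beta>)\<^sup>2 + (x * cosh \<beta>)\<^sup>2"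
    by linarith
  then show ?thesis unfolding x_def s_def by (simp add: algebra_simps power_mult_distrib)
qed

text \<open>
  Since \<open>0 \<le> \<beta>\<^sub>i\<^sub>j \<le> e\<^sup>\<beta> x\<^sub>i\<^sub>j\<close>, the factor \<open>cosh \<beta>\<^sub>i\<^sub>j\<close> is \<open>1 + O(x\<^sub>i\<^sub>j\<^sup>2)\<close> and the rest is the factor of
  \<open>edge_norm\<close>.
\<close>

lemma C_edge_error:
  assumes \<beta>: "0 \<le> \<beta>" and ij: "i \<in> {1..N}" "j \<in> {1..N}"
  shows "0 < C_edge w N \<beta> i j"
    "\<bar>ln (C_edge w N \<beta> i j) - (cosh \<beta> - 1) * edge_load w N i j\<bar> \<le> ((cosh \<beta>)\<^sup>2 + 1 + (exp \<beta>)\<^sup>2) * (edge_load w N i j)\<^sup>2"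
proof -
  define x where "x = edge_load w N i j"
  have x: "x > 0" unfolding x_def using edge_load_pos[OF ij] .
  have c: "0 < 1 + x * cosh \<beta>" using edge_load_cosh_pos[OF ij] by (simp add: x_def)
  let ?b = "beta_edge w N \<beta> i j"
  have "edge_prob w N i j * cosh \<beta> + (1 - edge_prob w N i j) = (1 + x * cosh \<beta>) / (1 + x)"
    unfolding edge_prob_load[OF ij] x_def[symmetric] using x by (simp add: field_simps)
  then have C: "C_edge w N \<beta> i j = (1 + x * cosh \<beta>) / (1 + x) / cosh ?b" by (simp add: C_edge_def)
  have q: "0 < (1 + x * cosh \<beta>) / (1 + x)" using x c by simp
  then show "0 < C_edge w N \<beta> i j" unfolding C by (rule divide_pos_pos[OF _ cosh_real_pos])
  have "ln (C_edge w N \<beta> i j) = ln ((1 + x * cosh \<beta>) / (1 + x)) - ln (cosh ?b)"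
    unfolding C using q cosh_real_pos[of ?b] by (subst ln_div) auto
  moreover have "0 \<le> ln (cosh ?b)" by (rule ln_cosh_nonneg)
  moreover have "ln (cosh ?b) \<le> ?b\<^sup>2" using ln_cosh_quadratic[of ?b 0] by simp
  moreover have "?b\<^sup>2 \<le> (exp \<beta> * x)\<^sup>2"
    unfolding x_def using beta_edge_bounds[OF \<beta> ij] by (intro power_mono) auto
  moreover have "\<bar>ln ((1 + x * cosh \<beta>) / (1 + x)) - (cosh \<beta> - 1) * x\<bar> \<le> ((cosh \<beta>)\<^sup>2 + 1) * x\<^sup>2"
    unfolding x_def by (rule edge_norm_factor_error[OF ij])
  ultimately have "\<bar>ln (C_edge w N \<beta> i j) - (cosh \<beta> - 1) * x\<bar> \<le> ((cosh \<beta>)\<^sup>2 + 1) * x\<^sup>2 + (exp \<beta> * x)\<^sup>2" by linarith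
  then show "\<bar>ln (C_edge w N \<beta> i j) - (cosh \<beta> - 1) * edge_load w N i j\<bar> \<le> ((cosh \<beta>)\<^sup>2 + 1 + (exp \<beta>)\<^sup>2) * (edge_load w N i j)\<^sup>2"
    unfolding x_def by (simp add: algebra_simps power_mult_distrib)
qed

end

context regular_weights
begin

lemma edge_load_sum:
  "(\<Sum>(i, j)\<in>vertex_pairs N. edge_load w N i j * (g i * g j))
      = ((\<Sum>i\<in>{1..N}. w N i * g i)\<^sup>2 - (\<Sum>i\<in>{1..N}. (w N i * g i)\<^sup>2)) / (2 * total_weight w N)"
proof -
  let ?h = "\<lambda>i. w N i * g i"
  have "(\<Sum>(i, j)\<in>vertex_pairs N. edge_load w N i j * (g i * g j)) = (\<Sum>(i, j)\<in>vertex_pairs N. ?h i * ?h j) / total_weight w N"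
    unfolding sum_divide_distrib by (intro sum.cong) (auto simp: edge_load_def)
  moreover have "(\<Sum>i\<in>{1..N}. ?h i)\<^sup>2 = 2 * (\<Sum>(i, j)\<in>vertex_pairs N. ?h i * ?h j) + (\<Sum>i\<in>{1..N}. (?h i)\<^sup>2)"
    unfolding power2_eq_square sum_product by (rule sum_vertex_pairs_symmetric) simp
  ultimately show ?thesis by (simp add: field_simps)
qed

lemma edge_load_square_sum: "(\<Sum>(i, j)\<in>vertex_pairs N. (edge_load w N i j)\<^sup>2) \<le> (sum_sq N / total_weight w N)\<^sup>2"
proof -
  have "(\<Sum>(i, j)\<in>vertex_pairs N. (edge_load w N i j)\<^sup>2) \<le> (\<Sum>(i, j)\<in>{1..N} \<times> {1..N}. (edge_load w N i j)\<^sup>2)"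
    by (intro sum_mono2) (auto simp: vertex_pairs_def)
  also have "\<dots> = (\<Sum>i\<in>{1..N}. \<Sum>j\<in>{1..N}. (w N i)\<^sup>2 * (w N j)\<^sup>2) / (total_weight w N)\<^sup>2"
    unfolding sum.cartesian_product[symmetric] sum_divide_distrib
    by (simp add: edge_load_def power_divide power_mult_distrib)
  also have "\<dots> = (sum_sq N / total_weight w N)\<^sup>2"
    unfolding sum_sq_def power_divide power2_eq_square[of "sum _ _"] sum_product ..
  finally show ?thesis .
qed

text \<open>
  The reason why all errors of order \<open>x\<^sub>i\<^sub>j\<^sup>2\<close> are bounded in total.
\<close>

lemma sum_pairs_error:
  assumes f: "\<And>i j. i \<in> {1..N} \<Longrightarrow> j \<in> {1..N} \<Longrightarrow> \<bar>f i j - k i j\<bar> \<le> A * (edge_load w N i j)\<^sup>2" and A: "0 \<le> A"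
  shows "\<bar>(\<Sum>(i, j)\<in>vertex_pairs N. f i j) - (\<Sum>(i, j)\<in>vertex_pairs N. k i j)\<bar> \<le> A * (sum_sq N / total_weight w N)\<^sup>2"
proof -
  have "\<bar>(\<Sum>(i, j)\<in>vertex_pairs N. f i j) - (\<Sum>(i, j)\<in>vertex_pairs N. k i j)\<bar> \<le> (\<Sum>(i, j)\<in>vertex_pairs N. \<bar>f i j - k i j\<bar>)"
    unfolding sum_subtractf[symmetric] case_prod_unfold by (rule sum_abs)
  also have "\<dots> \<le> (\<Sum>(i, j)\<in>vertex_pairs N. A * (edge_load w N i j)\<^sup>2)"
    by (intro sum_mono) (auto simp: vertex_pairs_def intro!: f)
  also have "\<dots> = A * (\<Sum>(i, j)\<in>vertex_pairs N. (edge_load w N i j)\<^sup>2)"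
    by (simp add: sum_distrib_left case_prod_unfold)
  also have "\<dots> \<le> A * (sum_sq N / total_weight w N)\<^sup>2" using A edge_load_square_sum by (intro mult_left_mono) auto
  finally show ?thesis .
qed

lemma edge_load_pairs_total:
  "0 < N \<Longrightarrow> (\<Sum>(i, j)\<in>vertex_pairs N. c * edge_load w N i j) = c * (total_weight w N - sum_sq N / total_weight w N) / 2"
proof -
  assume N: "0 < N"
  have "(\<Sum>(i, j)\<in>vertex_pairs N. edge_load w N i j) = (total_weight w N - sum_sq N / total_weight w N) / 2"
  proof -
    have "(\<Sum>i\<in>{1..N}. w N i * 1) = total_weight w N" "(\<Sum>i\<in>{1..N}. (w N i * 1)\<^sup>2) = sum_sq N"
      by (simp_all add: total_weight_def sum_sq_def)
    from edge_load_sum[of N "\<lambda>_. 1", unfolded this] total_weight_pos[of N N] N show ?thesis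
      by (simp add: power2_eq_square diff_divide_distrib)
  qed
  then show ?thesis by (simp add: sum_distrib_left[symmetric] case_prod_unfold)
qed

text \<open>
  A bounded error disappears after division by \<open>N\<close>. The main term is \<open>c\<close> times the sum of the loads over pairs, and
  \<open>\<Sum>\<^sub>i\<^sub><\<^sub>j x\<^sub>i\<^sub>j = (\<ell>\<^sub>N - \<Sum> w\<^sub>i\<^sup>2 / \<ell>\<^sub>N) / 2\<close>.
\<close>

lemma limit_of_bounded_error:
  assumes "\<And>N. 0 < N \<Longrightarrow> \<bar>f N - c * (total_weight w N - sum_sq N / total_weight w N) / 2\<bar>
      \<le> A * (sum_sq N / total_weight w N)\<^sup>2 + A' * (sum_sq N / total_weight w N)"
  shows "(\<lambda>N. f N / real N) \<longlonglongrightarrow> c * EW / 2"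
proof -
  let ?q = "\<lambda>N. sum_sq N / total_weight w N"
  have "(\<lambda>N. c * (total_weight w N / real N - ?q N / real N) / 2) \<longlonglongrightarrow> c * (EW - 0) / 2"
    by (intro tendsto_intros total_weight_over_N over_N_null[OF sum_sq_over_total]) simp
  moreover have "(\<lambda>N. f N / real N - c * (total_weight w N / real N - ?q N / real N) / 2) \<longlonglongrightarrow> 0"
  proof (rule Lim_null_comparison)
    show "(\<lambda>N. (A * (?q N)\<^sup>2 + A' * ?q N) / real N) \<longlonglongrightarrow> 0"
      by (rule over_N_null[where l = "A * (EW2 / EW)\<^sup>2 + A' * (EW2 / EW)"]) (intro tendsto_intros sum_sq_over_total)
    show "\<forall>\<^sub>F N in sequentially. norm (f N / real N - c * (total_weight w N / real N - ?q N / real N) / 2)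
        \<le> (A * (?q N)\<^sup>2 + A' * ?q N) / real N"
      using eventually_gt_at_top[of 0]
    proof eventually_elim
      case (elim N)
      have "f N / real N - c * (total_weight w N / real N - ?q N / real N) / 2 = (f N - c * (total_weight w N - ?q N) / 2) / real N"
        using elim by (simp add: field_simps)
      then have "norm (f N / real N - c * (total_weight w N / real N - ?q N / real N) / 2) = \<bar>f N - c * (total_weight w N - ?q N) / 2\<bar> / real N"
        by (simp add: abs_divide)
      also have "\<dots> \<le> (A * (?q N)\<^sup>2 + A' * ?q N) / real N" by (intro divide_right_mono assms elim) auto
      finally show ?case .
    qed
  qed
  ultimately show ?thesis using tendsto_add[of _ "c * (EW - 0) / 2" sequentially] by fastforce
qed

text \<open>
  Each edge contributes \<open>(cosh \<beta> - 1) x\<^sub>i\<^sub>j + O(x\<^sub>i\<^sub>j\<^sup>2)\<close>, and the diagonal factors contribute a bounded amount. The product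
  \<open>edge_norm\<close> has the same exponential rate, so the pressure can be computed from the latter.
\<close>

lemma G2_limit:
  assumes \<beta>: "0 \<le> \<beta>" shows "(\<lambda>N. 1 / real N * ln (G2 w N \<beta>)) \<longlonglongrightarrow> (cosh \<beta> - 1) * EW / 2"
proof -
  have "(\<lambda>N. ln (G2 w N \<beta>) / real N) \<longlonglongrightarrow> (cosh \<beta> - 1) * EW / 2"
  proof (rule limit_of_bounded_error)
    fix N :: nat assume N: "0 < N"
    let ?l = "total_weight w N" and ?A = "(cosh \<beta>)\<^sup>2 + 1 + (exp \<beta>)\<^sup>2"
    have l: "?l > 0" using total_weight_pos[of N N] N by simp
    have C: "0 < C_edge w N \<beta> i j" if "(i, j) \<in> vertex_pairs N" for i j
      using that C_edge_error(1)[OF \<beta>] by (auto simp: vertex_pairs_def)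
    have "ln (G2 w N \<beta>) = ln (\<Prod>(i, j)\<in>vertex_pairs N. C_edge w N \<beta> i j) + ln (\<Prod>i\<in>{1..N}. exp (- beta_edge w N \<beta> i i / 2))"
      unfolding G2_def by (rule ln_mult_pos) (auto intro!: prod_pos C)
    also have "ln (\<Prod>(i, j)\<in>vertex_pairs N. C_edge w N \<beta> i j) = (\<Sum>(i, j)\<in>vertex_pairs N. ln (C_edge w N \<beta> i j))"
      unfolding case_prod_unfold by (rule ln_prod[OF finite_vertex_pairs]) (use C in \<open>force simp: less_imp_neq[symmetric]\<close>)
    also have "ln (\<Prod>i\<in>{1..N}. exp (- beta_edge w N \<beta> i i / 2)) = - (\<Sum>i\<in>{1..N}. beta_edge w N \<beta> i i) / 2"
      by (simp add: exp_sum[symmetric] sum_negf[symmetric] sum_divide_distrib)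
    finally have G: "ln (G2 w N \<beta>) = (\<Sum>(i, j)\<in>vertex_pairs N. ln (C_edge w N \<beta> i j)) - (\<Sum>i\<in>{1..N}. beta_edge w N \<beta> i i) / 2" by simp
    have 1: "\<bar>(\<Sum>(i, j)\<in>vertex_pairs N. ln (C_edge w N \<beta> i j)) - (\<Sum>(i, j)\<in>vertex_pairs N. (cosh \<beta> - 1) * edge_load w N i j)\<bar> \<le> ?A * (sum_sq N / ?l)\<^sup>2"
      by (intro sum_pairs_error C_edge_error(2)[OF \<beta>]) auto
    have 2: "0 \<le> (\<Sum>i\<in>{1..N}. beta_edge w N \<beta> i i)" by (intro sum_nonneg beta_edge_bounds \<beta>)
    have "(\<Sum>i\<in>{1..N}. beta_edge w N \<beta> i i) \<le> (\<Sum>i\<in>{1..N}. exp \<beta> * edge_load w N i i)"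
      by (intro sum_mono beta_edge_bounds \<beta>)
    also have "\<dots> = exp \<beta> * (sum_sq N / ?l)"
      by (simp add: edge_load_def sum_sq_def sum_distrib_left sum_divide_distrib power2_eq_square)
    finally have 3: "(\<Sum>i\<in>{1..N}. beta_edge w N \<beta> i i) \<le> exp \<beta> * (sum_sq N / ?l)" .
    show "\<bar>ln (G2 w N \<beta>) - (cosh \<beta> - 1) * (?l - sum_sq N / ?l) / 2\<bar> \<le> ?A * (sum_sq N / ?l)\<^sup>2 + exp \<beta> * (sum_sq N / ?l)"
      using 1 2 3 unfolding G edge_load_pairs_total[OF N] by linarith
  qed
  then show ?thesis by simp
qed

lemma edge_norm_limit: "(\<lambda>N. ln (edge_norm w N \<beta>) / real N) \<longlonglongrightarrow> (cosh \<beta> - 1) * EW / 2"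
proof (rule limit_of_bounded_error)
  fix N :: nat assume N: "0 < N"
  have p: "0 < (1 + edge_load w N i j * cosh \<beta>) / (1 + edge_load w N i j)" if "(i, j) \<in> vertex_pairs N" for i j
    using that edge_load_cosh_pos[of i N j \<beta>] edge_load_pos[of i N j] by (auto simp: vertex_pairs_def)
  have "ln (edge_norm w N \<beta>) = (\<Sum>(i, j)\<in>vertex_pairs N. ln ((1 + edge_load w N i j * cosh \<beta>) / (1 + edge_load w N i j)))"
    unfolding edge_norm_def case_prod_unfold by (rule ln_prod[OF finite_vertex_pairs]) (use p in \<open>force simp: less_imp_neq[symmetric]\<close>)
  moreover have "\<bar>(\<Sum>(i, j)\<in>vertex_pairs N. ln ((1 + edge_load w N i j * cosh \<beta>) / (1 + edge_load w N i j)))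
      - (\<Sum>(i, j)\<in>vertex_pairs N. (cosh \<beta> - 1) * edge_load w N i j)\<bar> \<le> ((cosh \<beta>)\<^sup>2 + 1) * (sum_sq N / total_weight w N)\<^sup>2"
    by (intro sum_pairs_error edge_norm_factor_error) auto
  ultimately show "\<bar>ln (edge_norm w N \<beta>) - (cosh \<beta> - 1) * (total_weight w N - sum_sq N / total_weight w N) / 2\<bar>
      \<le> ((cosh \<beta>)\<^sup>2 + 1) * (sum_sq N / total_weight w N)\<^sup>2 + 0 * (sum_sq N / total_weight w N)"
    unfolding edge_load_pairs_total[OF N] by simp
qed

text \<open>
  The rank-one approximation of the energy, uniformly in the spins.
\<close>

lemma edge_weight_error:
  assumes \<beta>: "0 \<le> \<beta>" and N: "0 < N" and \<sigma>: "\<sigma> \<in> spins N"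
  shows "\<bar>ln (edge_weight (coupling w N \<beta>) (vertex_pairs N) \<sigma>)
       - sinh \<beta> / (2 * total_weight w N) * (\<Sum>i\<in>{1..N}. w N i * \<sigma> i)\<^sup>2\<bar>
      \<le> ((exp \<beta>)\<^sup>2 + (cosh \<beta>)\<^sup>2) * (sum_sq N / total_weight w N)\<^sup>2 + sinh \<beta> * (sum_sq N / total_weight w N)"
proof -
  let ?l = "total_weight w N"
  have l: "?l > 0" using total_weight_pos[of N N] N by simp
  have p: "0 < 1 + coupling w N \<beta> i j * \<sigma> i * \<sigma> j" if "(i, j) \<in> vertex_pairs N" for i j
  proof -
    have "0 < edge_weight (coupling w N \<beta>) {(i, j)} \<sigma>"
      using that by (intro edge_weight_pos[OF _ coupling_nonneg[OF \<beta>] coupling_less_1 \<sigma>]) auto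
    then show ?thesis by (simp add: edge_weight_def)
  qed
  have "ln (edge_weight (coupling w N \<beta>) (vertex_pairs N) \<sigma>) = (\<Sum>(i, j)\<in>vertex_pairs N. ln (1 + coupling w N \<beta> i j * \<sigma> i * \<sigma> j))"
    unfolding edge_weight_def case_prod_unfold by (rule ln_prod[OF finite_vertex_pairs]) (use p in \<open>force simp: less_imp_neq[symmetric]\<close>)
  moreover have "\<bar>(\<Sum>(i, j)\<in>vertex_pairs N. ln (1 + coupling w N \<beta> i j * \<sigma> i * \<sigma> j))
      - (\<Sum>(i, j)\<in>vertex_pairs N. sinh \<beta> * (edge_load w N i j * (\<sigma> i * \<sigma> j)))\<bar>
      \<le> ((exp \<beta>)\<^sup>2 + (cosh \<beta>)\<^sup>2) * (sum_sq N / ?l)\<^sup>2"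
    by (intro sum_pairs_error coupling_factor_error \<beta> \<sigma>) auto
  moreover have "(\<Sum>(i, j)\<in>vertex_pairs N. sinh \<beta> * (edge_load w N i j * (\<sigma> i * \<sigma> j)))
      = sinh \<beta> / (2 * ?l) * (\<Sum>i\<in>{1..N}. w N i * \<sigma> i)\<^sup>2 - sinh \<beta> * (sum_sq N / ?l) / 2"
  proof -
    have sq: "(\<Sum>i\<in>{1..N}. (w N i * \<sigma> i)\<^sup>2) = sum_sq N"
      unfolding sum_sq_def using spins_square[OF \<sigma>]
      by (intro sum.cong refl) (simp add: power_mult_distrib power2_eq_square)
    have "(\<Sum>(i, j)\<in>vertex_pairs N. sinh \<beta> * (edge_load w N i j * (\<sigma> i * \<sigma> j))) = sinh \<beta> * (\<Sum>(i, j)\<in>vertex_pairs N. edge_load w N i j * (\<sigma> i * \<sigma> j))"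
      by (simp add: sum_distrib_left case_prod_unfold)
    then show ?thesis unfolding edge_load_sum sq using l by (simp add: field_simps)
  qed
  moreover have "0 \<le> sinh \<beta> * (sum_sq N / ?l)" using \<beta> l unfolding sum_sq_def
    by (intro mult_nonneg_nonneg divide_nonneg_nonneg sum_nonneg) auto
  moreover have "\<bar>a - b\<bar> \<le> p + q" if "a = c" "\<bar>c - d\<bar> \<le> p" "d = b - q / 2" "0 \<le> q" for a b c d p q :: real
    using that by linarith
  ultimately show ?thesis by blast
qed

end

section \<open>The thermodynamic limit of the pressure\<close>

lemma ln_cosh_lipschitz: "\<bar>ln (cosh x) - ln (cosh y)\<bar> \<le> \<bar>x - y :: real\<bar>"
proof -
  have 1: "ln (cosh x) - ln (cosh y) \<le> \<bar>x - y\<bar>" for x y :: real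
  proof -
    have "ln (cosh x) - ln (cosh y) \<le> tanh x * (x - y)"
      using ln_cosh_convex[of x y] by (simp add: algebra_simps)
    also have "\<dots> \<le> \<bar>tanh x\<bar> * \<bar>x - y\<bar>" by (metis abs_ge_self abs_mult)
    also have "\<dots> \<le> 1 * \<bar>x - y\<bar>" by (intro mult_right_mono abs_tanh_le_1) simp
    finally show ?thesis by simp
  qed
  show ?thesis using 1[of x y] 1[of y x] by (simp add: abs_le_iff)
qed

context regular_weights
begin

abbreviation scale :: "real \<Rightarrow> real" where "scale \<beta> \<equiv> sqrt (sinh \<beta> / EW)"

abbreviation V :: "real \<Rightarrow> 'a \<Rightarrow> real" where "V \<beta> \<equiv> \<lambda>x. scale \<beta> * W x"

text \<open>
  The finite-size version of \<open>scale \<beta>\<close>; with it the rank-one energy is exactly \<open>N u\<^sup>2 / 2\<close> for the order parameter \<open>u\<close>.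
\<close>

definition scale_N :: "real \<Rightarrow> nat \<Rightarrow> real" where
  "scale_N \<beta> N = sqrt (sinh \<beta> / (total_weight w N / real N))"

definition functional_N :: "real \<Rightarrow> real \<Rightarrow> nat \<Rightarrow> real \<Rightarrow> real" where
  "functional_N \<beta> B N s = empirical_mean N (\<lambda>x. ln (cosh (scale_N \<beta> N * x * s + B))) - s\<^sup>2 / 2"

lemma mean_field: "mean_field M (V \<beta>)" if "0 \<le> \<beta>"
proof -
  interpret prob_space M by (rule prob_M)
  show ?thesis
  proof
    show "AE x in M. 0 \<le> scale \<beta> * W x"
      using W_nonneg EW_pos that by (auto elim!: eventually_mono)
    show "integrable M (V \<beta>)" "integrable M (\<lambda>x. (scale \<beta> * W x)\<^sup>2)"
      using W_int W_int2 by (simp_all add: power_mult_distrib)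
  qed
qed

abbreviation F where "F \<beta> \<equiv> mean_field.functional M (V \<beta>)"

lemma scale_N_limit: "(\<lambda>N. scale_N \<beta> N) \<longlonglongrightarrow> scale \<beta>"
  unfolding scale_N_def using EW_pos by (intro tendsto_intros total_weight_over_N) auto

text \<open>
  The integrand is Lipschitz in the weight, and replacing \<open>scale_N\<close> by its limit costs at most a multiple of the mean weight.
\<close>

lemma functional_N_limit:
  assumes \<beta>: "0 \<le> \<beta>" shows "(\<lambda>N. functional_N \<beta> B N s) \<longlonglongrightarrow> F \<beta> s B"
proof -
  let ?g = "\<lambda>x. ln (cosh (scale \<beta> * x * s + B))"
  have "(\<lambda>N. empirical_mean N ?g) \<longlonglongrightarrow> (\<integral>x. ?g (W x) \<partial>M)"
  proof (rule empirical_mean_lipschitz[where L = "\<bar>scale \<beta> * s\<bar>"])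
    fix x y
    have "\<bar>?g x - ?g y\<bar> \<le> \<bar>(scale \<beta> * x * s + B) - (scale \<beta> * y * s + B)\<bar>" by (rule ln_cosh_lipschitz)
    also have "\<dots> = \<bar>scale \<beta> * s\<bar> * \<bar>x - y\<bar>" unfolding abs_mult[symmetric] by (simp add: algebra_simps)
    finally show "\<bar>?g x - ?g y\<bar> \<le> \<bar>scale \<beta> * s\<bar> * \<bar>x - y\<bar>" .
  qed
  moreover have "(\<lambda>N. empirical_mean N (\<lambda>x. ln (cosh (scale_N \<beta> N * x * s + B))) - empirical_mean N ?g) \<longlonglongrightarrow> 0"
  proof (rule Lim_null_comparison)
    have "(\<lambda>N. \<bar>scale_N \<beta> N - scale \<beta>\<bar> * \<bar>s\<bar> * empirical_mean N (\<lambda>x. x)) \<longlonglongrightarrow> \<bar>scale \<beta> - scale \<beta>\<bar> * \<bar>s\<bar> * EW"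
      by (intro tendsto_intros scale_N_limit empirical_first_moment)
    then show "(\<lambda>N. \<bar>scale_N \<beta> N - scale \<beta>\<bar> * \<bar>s\<bar> * empirical_mean N (\<lambda>x. x)) \<longlonglongrightarrow> 0" by simp
    show "\<forall>\<^sub>F N in sequentially. norm (empirical_mean N (\<lambda>x. ln (cosh (scale_N \<beta> N * x * s + B))) - empirical_mean N ?g)
        \<le> \<bar>scale_N \<beta> N - scale \<beta>\<bar> * \<bar>s\<bar> * empirical_mean N (\<lambda>x. x)"
    proof (intro always_eventually allI)
      fix N
      have "\<bar>\<Sum>i\<in>{1..N}. ln (cosh (scale_N \<beta> N * w N i * s + B)) - ?g (w N i)\<bar>
          \<le> (\<Sum>i\<in>{1..N}. \<bar>scale_N \<beta> N - scale \<beta>\<bar> * \<bar>s\<bar> * w N i)"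
      proof (intro order_trans[OF sum_abs] sum_mono)
        fix i assume i: "i \<in> {1..N}"
        have "\<bar>ln (cosh (scale_N \<beta> N * w N i * s + B)) - ?g (w N i)\<bar> \<le> \<bar>(scale_N \<beta> N * w N i * s + B) - (scale \<beta> * w N i * s + B)\<bar>"
          by (rule ln_cosh_lipschitz)
        also have "(scale_N \<beta> N * w N i * s + B) - (scale \<beta> * w N i * s + B) = (scale_N \<beta> N - scale \<beta>) * s * w N i"
          by (simp add: algebra_simps)
        finally show "\<bar>ln (cosh (scale_N \<beta> N * w N i * s + B)) - ?g (w N i)\<bar> \<le> \<bar>scale_N \<beta> N - scale \<beta>\<bar> * \<bar>s\<bar> * w N i"
          using w_pos[OF i] by (simp add: abs_mult)
      qed
      then have "\<bar>\<Sum>i\<in>{1..N}. ln (cosh (scale_N \<beta> N * w N i * s + B)) - ?g (w N i)\<bar> / real N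
          \<le> (\<Sum>i\<in>{1..N}. \<bar>scale_N \<beta> N - scale \<beta>\<bar> * \<bar>s\<bar> * w N i) / real N"
        by (intro divide_right_mono) auto
      then show "norm (empirical_mean N (\<lambda>x. ln (cosh (scale_N \<beta> N * x * s + B))) - empirical_mean N ?g)
        \<le> \<bar>scale_N \<beta> N - scale \<beta>\<bar> * \<bar>s\<bar> * empirical_mean N (\<lambda>x. x)"
        by (simp add: empirical_mean_def sum_subtractf diff_divide_distrib[symmetric] sum_distrib_left)
    qed
  qed
  ultimately have "(\<lambda>N. empirical_mean N (\<lambda>x. ln (cosh (scale_N \<beta> N * x * s + B)))) \<longlonglongrightarrow> (\<integral>x. ?g (W x) \<partial>M)"
    using tendsto_add by fastforce
  then have "(\<lambda>N. functional_N \<beta> B N s) \<longlonglongrightarrow> (\<integral>x. ?g (W x) \<partial>M) - s\<^sup>2 / 2"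
    unfolding functional_N_def by (intro tendsto_intros)
  then show ?thesis by (simp add: mean_field.functional_def[OF mean_field[OF \<beta>]])
qed

definition order_parameter :: "real \<Rightarrow> nat \<Rightarrow> (nat \<Rightarrow> real) \<Rightarrow> real" where
  "order_parameter \<beta> N \<sigma> = scale_N \<beta> N * (\<Sum>i\<in>{1..N}. w N i * \<sigma> i) / real N"

definition rank_one_sum :: "real \<Rightarrow> nat \<Rightarrow> real \<Rightarrow> real" where
  "rank_one_sum \<beta> N B = (\<Sum>\<sigma>\<in>spins N. exp (real N * ((order_parameter \<beta> N \<sigma>)\<^sup>2 / 2) + B * total_spin N \<sigma>))"

text \<open>
  An energy linear in the order parameter is a sum of one-site energies, so the sum over spins is a product of factors
  \<open>2 cosh (scale_N w\<^sub>i s + B)\<close>.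
\<close>

lemma linearised_sum:
  assumes N: "0 < N"
  shows "(\<Sum>\<sigma>\<in>spins N. exp (real N * (s * order_parameter \<beta> N \<sigma> - s\<^sup>2 / 2) + B * total_spin N \<sigma>))
      = exp (real N * (ln 2 + functional_N \<beta> B N s))"
proof -
  let ?h = "\<lambda>i. scale_N \<beta> N * w N i * s + B"
  have "(\<Sum>\<sigma>\<in>spins N. exp (real N * (s * order_parameter \<beta> N \<sigma> - s\<^sup>2 / 2) + B * total_spin N \<sigma>))
      = (\<Sum>\<sigma>\<in>spins N. exp (- real N * s\<^sup>2 / 2) * (\<Prod>i\<in>{1..N}. exp (?h i * \<sigma> i)))"
  proof (intro sum.cong refl)
    fix \<sigma>
    have "real N * (s * order_parameter \<beta> N \<sigma>) = (\<Sum>i\<in>{1..N}. scale_N \<beta> N * w N i * s * \<sigma> i)"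
    proof -
      have "real N * (s * order_parameter \<beta> N \<sigma>) = scale_N \<beta> N * s * (\<Sum>i\<in>{1..N}. w N i * \<sigma> i)"
        using N by (simp add: order_parameter_def)
      then show ?thesis by (simp add: sum_distrib_left mult_ac)
    qed
    then have "real N * (s * order_parameter \<beta> N \<sigma> - s\<^sup>2 / 2) + B * total_spin N \<sigma>
        = - real N * s\<^sup>2 / 2 + (\<Sum>i\<in>{1..N}. ?h i * \<sigma> i)"
      by (simp add: total_spin_def sum_distrib_left sum.distrib distrib_right right_diff_distrib)
    then show "exp (real N * (s * order_parameter \<beta> N \<sigma> - s\<^sup>2 / 2) + B * total_spin N \<sigma>)
       = exp (- real N * s\<^sup>2 / 2) * (\<Prod>i\<in>{1..N}. exp (?h i * \<sigma> i))"
      by (simp only: exp_add exp_sum[OF finite_atLeastAtMost])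
  qed
  also have "\<dots> = exp (- real N * s\<^sup>2 / 2) * (\<Prod>i\<in>{1..N}. \<Sum>t\<in>{-1, 1::real}. exp (?h i * t))"
    unfolding sum_distrib_left[symmetric] spins_def by (subst prod_sum_PiE) auto
  also have "(\<Prod>i\<in>{1..N}. \<Sum>t\<in>{-1, 1::real}. exp (?h i * t)) = (\<Prod>i\<in>{1..N}. exp (ln 2 + ln (cosh (?h i))))"
  proof (intro prod.cong refl)
    fix i
    have "exp (ln 2 + ln (cosh (?h i))) = 2 * cosh (?h i)"
      unfolding exp_add by (simp only: exp_ln[OF cosh_real_pos] exp_ln[OF zero_less_numeral])
    moreover have "2 * cosh (?h i) = (\<Sum>t\<in>{-1, 1::real}. exp (?h i * t))" by (simp add: cosh_def)
    ultimately show "(\<Sum>t\<in>{-1, 1::real}. exp (?h i * t)) = exp (ln 2 + ln (cosh (?h i)))" by simp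
  qed
  also have "\<dots> = exp (\<Sum>i\<in>{1..N}. ln 2 + ln (cosh (?h i)))" by (rule exp_sum[symmetric]) simp
  also have "exp (- real N * s\<^sup>2 / 2) * \<dots> = exp (real N * (ln 2 + functional_N \<beta> B N s))"
    unfolding exp_add[symmetric] using N
    by (simp add: functional_N_def empirical_mean_def sum.distrib field_simps)
  finally show ?thesis .
qed

text \<open>
  From \<open>s u - s\<^sup>2 / 2 \<le> u\<^sup>2 / 2\<close>.
\<close>

lemma rank_one_lower:
  assumes N: "0 < N" shows "exp (real N * (ln 2 + functional_N \<beta> B N s)) \<le> rank_one_sum \<beta> N B"
  unfolding linearised_sum[OF N, symmetric] rank_one_sum_def
proof (intro sum_mono)
  fix \<sigma>
  have "0 \<le> (order_parameter \<beta> N \<sigma> - s)\<^sup>2" by simp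
  then have "s * order_parameter \<beta> N \<sigma> - s\<^sup>2 / 2 \<le> (order_parameter \<beta> N \<sigma>)\<^sup>2 / 2"
    by (simp add: power2_eq_square algebra_simps)
  then have "real N * (s * order_parameter \<beta> N \<sigma> - s\<^sup>2 / 2) \<le> real N * ((order_parameter \<beta> N \<sigma>)\<^sup>2 / 2)"
    by (intro mult_left_mono) auto
  then show "exp (real N * (s * order_parameter \<beta> N \<sigma> - s\<^sup>2 / 2) + B * total_spin N \<sigma>)
      \<le> exp (real N * ((order_parameter \<beta> N \<sigma>)\<^sup>2 / 2) + B * total_spin N \<sigma>)" by simp
qed

lemma order_parameter_bound:
  assumes \<beta>: "0 \<le> \<beta>" and \<sigma>: "\<sigma> \<in> spins N"
  shows "\<bar>order_parameter \<beta> N \<sigma>\<bar> \<le> scale_N \<beta> N * (total_weight w N / real N)"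
proof -
  have s: "0 \<le> scale_N \<beta> N"
    unfolding scale_N_def total_weight_def using \<beta> less_imp_le[OF w_pos]
    by (intro real_sqrt_ge_zero divide_nonneg_nonneg sum_nonneg) auto
  have "\<bar>\<Sum>i\<in>{1..N}. w N i * \<sigma> i\<bar> \<le> (\<Sum>i\<in>{1..N}. w N i)"
  proof (intro order_trans[OF sum_abs] sum_mono)
    fix i assume "i \<in> {1..N}"
    then show "\<bar>w N i * \<sigma> i\<bar> \<le> w N i" using w_pos[of i N] spins_values[OF \<sigma>, of i] by (auto simp: abs_mult)
  qed
  from mult_left_mono[OF divide_right_mono[OF this, of "real N"] s] show ?thesis
    by (simp add: order_parameter_def total_weight_def abs_mult abs_of_nonneg[OF s])
qed

text \<open>
  If the grid point \<open>s\<close> is within \<open>\<epsilon>\<close> of \<open>u\<close>, then \<open>u\<^sup>2 / 2 \<le> s u - s\<^sup>2 / 2 + \<epsilon>\<^sup>2 / 2\<close>; summing over all grid points avoids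
  choosing one.
\<close>

lemma rank_one_upper:
  assumes \<beta>: "0 \<le> \<beta>" and N: "0 < N" and G: "finite G" "G \<noteq> {}"
    and cover: "\<And>u. \<bar>u\<bar> \<le> scale_N \<beta> N * (total_weight w N / real N) \<Longrightarrow> \<exists>s\<in>G. \<bar>u - s\<bar> \<le> \<epsilon>"
    and max: "\<And>s. s \<in> G \<Longrightarrow> functional_N \<beta> B N s \<le> m"
  shows "rank_one_sum \<beta> N B \<le> real (card G) * exp (real N * (ln 2 + m + \<epsilon>\<^sup>2 / 2))"
proof -
  let ?e = "\<lambda>s \<sigma>. exp (real N * (s * order_parameter \<beta> N \<sigma> - s\<^sup>2 / 2) + B * total_spin N \<sigma>)"
  have "rank_one_sum \<beta> N B \<le> (\<Sum>\<sigma>\<in>spins N. \<Sum>s\<in>G. exp (real N * (\<epsilon>\<^sup>2 / 2)) * ?e s \<sigma>)"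
    unfolding rank_one_sum_def
  proof (rule sum_mono)
    fix \<sigma> assume \<sigma>: "\<sigma> \<in> spins N"
    let ?u = "order_parameter \<beta> N \<sigma>"
    obtain s where s: "s \<in> G" "\<bar>?u - s\<bar> \<le> \<epsilon>" using cover[OF order_parameter_bound[OF \<beta> \<sigma>]] by blast
    have "(?u - s)\<^sup>2 \<le> \<epsilon>\<^sup>2" using s(2) by (metis abs_ge_zero power2_abs power_mono)
    then have "?u\<^sup>2 / 2 \<le> \<epsilon>\<^sup>2 / 2 + (s * ?u - s\<^sup>2 / 2)" by (simp add: power2_diff algebra_simps)
    then have "real N * (?u\<^sup>2 / 2) \<le> real N * (\<epsilon>\<^sup>2 / 2 + (s * ?u - s\<^sup>2 / 2))" by (intro mult_left_mono) auto
    then have "exp (real N * (?u\<^sup>2 / 2) + B * total_spin N \<sigma>) \<le> exp (real N * (\<epsilon>\<^sup>2 / 2) + (real N * (s * ?u - s\<^sup>2 / 2) + B * total_spin N \<sigma>))"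
      by (simp add: distrib_left)
    also have "\<dots> = exp (real N * (\<epsilon>\<^sup>2 / 2)) * ?e s \<sigma>" by (rule exp_add)
    also have "\<dots> \<le> (\<Sum>s\<in>G. exp (real N * (\<epsilon>\<^sup>2 / 2)) * ?e s \<sigma>)"
      by (rule member_le_sum[OF s(1) _ G(1)]) simp
    finally show "exp (real N * (?u\<^sup>2 / 2) + B * total_spin N \<sigma>) \<le> (\<Sum>s\<in>G. exp (real N * (\<epsilon>\<^sup>2 / 2)) * ?e s \<sigma>)" .
  qed
  also have "\<dots> = (\<Sum>s\<in>G. exp (real N * (\<epsilon>\<^sup>2 / 2)) * exp (real N * (ln 2 + functional_N \<beta> B N s)))"
    by (subst sum.swap) (simp add: sum_distrib_left[symmetric] linearised_sum[OF N])
  also have "\<dots> \<le> (\<Sum>s\<in>G. exp (real N * (ln 2 + m + \<epsilon>\<^sup>2 / 2)))"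
  proof (rule sum_mono)
    fix s assume "s \<in> G"
    then have "real N * (ln 2 + functional_N \<beta> B N s) \<le> real N * (ln 2 + m)" using max by (intro mult_left_mono) auto
    then show "exp (real N * (\<epsilon>\<^sup>2 / 2)) * exp (real N * (ln 2 + functional_N \<beta> B N s)) \<le> exp (real N * (ln 2 + m + \<epsilon>\<^sup>2 / 2))"
      unfolding exp_add[symmetric] by (simp add: distrib_left)
  qed
  finally show ?thesis by simp
qed

definition coupling_error :: "real \<Rightarrow> nat \<Rightarrow> real" where
  "coupling_error \<beta> N = ((exp \<beta>)\<^sup>2 + (cosh \<beta>)\<^sup>2) * (sum_sq N / total_weight w N)\<^sup>2 + sinh \<beta> * (sum_sq N / total_weight w N)"

lemma coupling_error_null: "(\<lambda>N. coupling_error \<beta> N / real N) \<longlonglongrightarrow> 0"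
  unfolding coupling_error_def
  by (rule over_N_null[where l = "((exp \<beta>)\<^sup>2 + (cosh \<beta>)\<^sup>2) * (EW2 / EW)\<^sup>2 + sinh \<beta> * (EW2 / EW)"])
    (intro tendsto_intros sum_sq_over_total)

lemma Z_rank_one:
  assumes \<beta>: "0 \<le> \<beta>" and N: "0 < N"
  shows "exp (- coupling_error \<beta> N) * rank_one_sum \<beta> N B \<le> Z N \<beta> B"
    and "Z N \<beta> B \<le> exp (coupling_error \<beta> N) * rank_one_sum \<beta> N B"
proof -
  let ?e = "edge_weight (coupling w N \<beta>) (vertex_pairs N)"
  let ?u = "\<lambda>\<sigma>. real N * ((order_parameter \<beta> N \<sigma>)\<^sup>2 / 2)"
  have bound: "exp (- coupling_error \<beta> N) * exp (?u \<sigma>) \<le> ?e \<sigma>" "?e \<sigma> \<le> exp (coupling_error \<beta> N) * exp (?u \<sigma>)"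
    if \<sigma>: "\<sigma> \<in> spins N" for \<sigma>
  proof -
    have l: "total_weight w N > 0" using total_weight_pos[of N N] N by simp
    have "(scale_N \<beta> N)\<^sup>2 = sinh \<beta> / (total_weight w N / real N)"
      unfolding scale_N_def using \<beta> l by (intro real_sqrt_pow2) auto
    then have u: "?u \<sigma> = sinh \<beta> / (2 * total_weight w N) * (\<Sum>i\<in>{1..N}. w N i * \<sigma> i)\<^sup>2"
      unfolding order_parameter_def power_divide power_mult_distrib using N l by (simp add: field_simps power2_eq_square)
    have pos: "0 < ?e \<sigma>" by (rule edge_weight_pos[OF order_refl coupling_nonneg[OF \<beta>] coupling_less_1 \<sigma>])
    have err: "\<bar>ln (?e \<sigma>) - ?u \<sigma>\<bar> \<le> coupling_error \<beta> N"
      unfolding u coupling_error_def by (rule edge_weight_error[OF \<beta> N \<sigma>])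
    have "- coupling_error \<beta> N + ?u \<sigma> \<le> ln (?e \<sigma>)" "ln (?e \<sigma>) \<le> coupling_error \<beta> N + ?u \<sigma>"
      using err by linarith+
    then show "exp (- coupling_error \<beta> N) * exp (?u \<sigma>) \<le> ?e \<sigma>" "?e \<sigma> \<le> exp (coupling_error \<beta> N) * exp (?u \<sigma>)"
      unfolding exp_add[symmetric] using pos by (metis exp_le_cancel_iff exp_ln)+
  qed
  show "exp (- coupling_error \<beta> N) * rank_one_sum \<beta> N B \<le> Z N \<beta> B"
    unfolding Ising_sum_def rank_one_sum_def sum_distrib_left exp_add
    by (intro sum_mono) (use bound(1) in \<open>simp add: mult.assoc[symmetric] mult_right_mono\<close>)
  show "Z N \<beta> B \<le> exp (coupling_error \<beta> N) * rank_one_sum \<beta> N B"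
    unfolding Ising_sum_def rank_one_sum_def sum_distrib_left exp_add
    by (intro sum_mono) (use bound(2) in \<open>simp add: mult.assoc[symmetric] mult_right_mono\<close>)
qed

text \<open>
  The order parameter is bounded uniformly in \<open>N\<close>, so one finite grid serves all large \<open>N\<close>. Only convergence of
  \<open>functional_N\<close> at finitely many points is used for the upper bound and at the maximizer for the lower bound.
\<close>

lemma ln_Z_limit:
  assumes \<beta>: "0 \<le> \<beta>" and max: "mean_field.maximizer M (V \<beta>) B z"
  shows "(\<lambda>N. ln (Z N \<beta> B) / real N) \<longlonglongrightarrow> ln 2 + F \<beta> z B"
proof (rule LIMSEQ_I)
  interpret mf: mean_field M "V \<beta>" by (rule mean_field[OF \<beta>])
  fix e :: real assume e: "e > 0"
  define \<epsilon> where "\<epsilon> = min 1 (e / 2)"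
  have \<epsilon>: "0 < \<epsilon>" "\<epsilon> \<le> 1" "\<epsilon> \<le> e / 2" using e by (auto simp: \<epsilon>_def)
  have "\<epsilon> * \<epsilon> \<le> 1 * \<epsilon>" using \<epsilon> by (intro mult_right_mono) auto
  then have \<epsilon>2: "\<epsilon>\<^sup>2 / 2 \<le> e / 4" using \<epsilon> unfolding power2_eq_square by linarith
  \<comment> \<open>The order parameter is bounded by a quantity converging to \<open>scale \<beta> * EW\<close>.\<close>
  define K where "K = scale \<beta> * EW + 1"
  have "compact {- K..K}" by simp
  then obtain G0 where G0: "finite G0" "{- K..K} \<subseteq> (\<Union>x\<in>G0. ball x \<epsilon>)"
    using \<epsilon>(1) unfolding compact_eq_totally_bounded by blast
  define G where "G = insert 0 G0"
  have G: "finite G" "G \<noteq> {}" using G0 by (auto simp: G_def)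
  have "(\<lambda>N. scale_N \<beta> N * (total_weight w N / real N)) \<longlonglongrightarrow> scale \<beta> * EW"
    by (intro tendsto_intros scale_N_limit total_weight_over_N)
  then have ev1: "\<forall>\<^sub>F N in sequentially. scale_N \<beta> N * (total_weight w N / real N) < K"
    by (rule order_tendstoD(2)) (simp add: K_def)
  have ev2: "\<forall>\<^sub>F N in sequentially. \<forall>s\<in>G. functional_N \<beta> B N s < F \<beta> z B + e / 4"
  proof (subst eventually_ball_finite_distrib[OF G(1)], intro ballI)
    fix s
    have "F \<beta> s B \<le> F \<beta> z B" using max by (simp add: mf.maximizer_def)
    then show "\<forall>\<^sub>F N in sequentially. functional_N \<beta> B N s < F \<beta> z B + e / 4"
      using e by (intro order_tendstoD(2)[OF functional_N_limit[OF \<beta>]]) auto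
  qed
  have ev3: "\<forall>\<^sub>F N in sequentially. coupling_error \<beta> N / real N < e / 4"
    using e by (intro order_tendstoD(2)[OF coupling_error_null]) auto
  have ev4: "\<forall>\<^sub>F N in sequentially. ln (real (card G)) / real N < e / 4"
    using e by (intro order_tendstoD(2)[OF over_N_null[OF tendsto_const]]) auto
  have ev5: "\<forall>\<^sub>F N in sequentially. F \<beta> z B - e / 4 < functional_N \<beta> B N z"
    using e by (intro order_tendstoD(1)[OF functional_N_limit[OF \<beta>]]) auto
  have "\<forall>\<^sub>F N in sequentially. norm (ln (Z N \<beta> B) / real N - (ln 2 + F \<beta> z B)) < e"
    using ev1 ev2 ev3 ev4 ev5 eventually_gt_at_top[of 0]
  proof eventually_elim
    case (elim N)
    then have N: "0 < N" by simp
    let ?E = "coupling_error \<beta> N"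
    have R: "0 < rank_one_sum \<beta> N B" using rank_one_lower[OF N, of \<beta> B 0] exp_gt_zero by (rule less_le_trans[rotated])
    have Zp: "0 < Z N \<beta> B" by (rule Z_pos[OF \<beta>])
    have "\<exists>s\<in>G. \<bar>u - s\<bar> \<le> \<epsilon>" if "\<bar>u\<bar> \<le> scale_N \<beta> N * (total_weight w N / real N)" for u
    proof -
      have "u \<in> {- K..K}" using that elim(1) by auto
      then obtain x where "x \<in> G0" "u \<in> ball x \<epsilon>" using G0(2) by blast
      then show ?thesis by (intro bexI[of _ x]) (auto simp: G_def dist_real_def)
    qed
    then have "rank_one_sum \<beta> N B \<le> real (card G) * exp (real N * (ln 2 + (F \<beta> z B + e / 4) + \<epsilon>\<^sup>2 / 2))"
      using elim(2) by (intro rank_one_upper[OF \<beta> N G]) (auto intro: less_imp_le)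
    then have "Z N \<beta> B \<le> exp ?E * (real (card G) * exp (real N * (ln 2 + (F \<beta> z B + e / 4) + \<epsilon>\<^sup>2 / 2)))"
      using Z_rank_one(2)[OF \<beta> N, of B] by (meson exp_ge_zero mult_left_mono order_trans)
    moreover have cG: "0 < real (card G)" using G by (simp add: card_gt_0_iff)
    ultimately have "ln (Z N \<beta> B) \<le> ln (exp ?E * (real (card G) * exp (real N * (ln 2 + (F \<beta> z B + e / 4) + \<epsilon>\<^sup>2 / 2))))"
      using Zp by simp
    also have "\<dots> = ?E + (ln (real (card G)) + real N * (ln 2 + (F \<beta> z B + e / 4) + \<epsilon>\<^sup>2 / 2))"
      using cG by (simp add: ln_mult)
    finally have "ln (Z N \<beta> B) / real N \<le> (?E + (ln (real (card G)) + real N * (ln 2 + (F \<beta> z B + e / 4) + \<epsilon>\<^sup>2 / 2))) / real N"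
      by (intro divide_right_mono) auto
    also have "\<dots> = ?E / real N + (ln (real (card G)) / real N + (ln 2 + (F \<beta> z B + e / 4) + \<epsilon>\<^sup>2 / 2))"
      using N by (simp add: add_divide_distrib)
    finally have up: "ln (Z N \<beta> B) / real N - (ln 2 + F \<beta> z B) < e" using elim(3,4) \<epsilon>2 by linarith
    have "exp (- ?E + real N * (ln 2 + functional_N \<beta> B N z)) \<le> exp (- ?E) * rank_one_sum \<beta> N B"
      unfolding exp_add by (intro mult_left_mono rank_one_lower N) simp
    also have "\<dots> \<le> Z N \<beta> B" by (rule Z_rank_one(1)[OF \<beta> N])
    finally have "- ?E + real N * (ln 2 + functional_N \<beta> B N z) \<le> ln (Z N \<beta> B)"
      using Zp by (simp add: ln_ge_iff)
    then have "(- ?E + real N * (ln 2 + functional_N \<beta> B N z)) / real N \<le> ln (Z N \<beta> B) / real N"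
      by (intro divide_right_mono) auto
    moreover have "(- ?E + real N * (ln 2 + functional_N \<beta> B N z)) / real N = - (?E / real N) + (ln 2 + functional_N \<beta> B N z)"
      using N by (simp add: add_divide_distrib diff_divide_distrib)
    ultimately have lo: "ln (Z N \<beta> B) / real N - (ln 2 + F \<beta> z B) > - e" using elim(3,5) e by linarith
    show ?case using up lo by (simp add: abs_less_iff)
  qed
  then show "\<exists>no. \<forall>N\<ge>no. norm (ln (Z N \<beta> B) / real N - (ln 2 + F \<beta> z B)) < e"
    by (simp add: eventually_sequentially)
qed

lemma alpha_eq: "0 \<le> \<beta> \<Longrightarrow> alpha w \<beta> = (cosh \<beta> - 1) * EW / 2"
  unfolding alpha_def by (rule limI[OF G2_limit])

lemma pressure_limit:
  assumes \<beta>: "0 \<le> \<beta>" and max: "mean_field.maximizer M (V \<beta>) B z"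
  shows "(\<lambda>N. pressure_N w N \<beta> B) \<longlonglongrightarrow> ln 2 + alpha w \<beta> + F \<beta> z B"
proof -
  have "(\<lambda>N. ln (edge_norm w N \<beta>) / real N + ln (Z N \<beta> B) / real N) \<longlonglongrightarrow> alpha w \<beta> + (ln 2 + F \<beta> z B)"
    unfolding alpha_eq[OF \<beta>] by (intro tendsto_add edge_norm_limit ln_Z_limit[OF \<beta> max])
  then show ?thesis by (simp add: pressure_N_eq[OF \<beta>] add_divide_distrib add_ac)
qed

end

section \<open>Magnetization, criticality and susceptibility\<close>

text \<open>
  Add the tangent bounds for the two fields at the two maximizers.
\<close>

lemma (in mean_field) mean_spin_mono:
  assumes "maximizer B y" "maximizer C z" "B < C" shows "mean_spin y B \<le> mean_spin z C"
proof -
  have "functional y B + (C - B) * mean_spin y B \<le> functional y C" using functional_lower[of y B y C] by simp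
  also have "\<dots> \<le> functional z C" using assms by (simp add: maximizer_def)
  finally have 1: "functional y B + (C - B) * mean_spin y B \<le> functional z C" .
  have "functional z C + (B - C) * mean_spin z C \<le> functional z B" using functional_lower[of z C z B] by simp
  also have "\<dots> \<le> functional y B" using assms by (simp add: maximizer_def)
  finally have "(C - B) * mean_spin y B \<le> (C - B) * mean_spin z C" using 1 by (simp add: algebra_simps)
  then show ?thesis using assms(3) by (simp add: mult_le_cancel_left)
qed

text \<open>
  Apply \<open>artanh\<close> to \<open>tanh (arsinh x) = x / sqrt (x\<^sup>2 + 1) < x\<close>.
\<close>

lemma arsinh_less_artanh:
  fixes x :: real assumes x: "0 < x" "x < 1" shows "arsinh x < artanh x"
proof -
  let ?t = "tanh (arsinh x)"
  have "1 < sqrt (x\<^sup>2 + 1)" using x by simp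
  then have "x / sqrt (x\<^sup>2 + 1) < x / 1" using x by (intro divide_strict_left_mono) (auto intro: add_nonneg_pos)
  then have t: "?t < x" by (simp add: tanh_def cosh_arsinh_real)
  have t0: "0 < ?t" using x by simp
  have "(1 + t) / (1 - t) < (1 + x) / (1 - x) \<and> 0 < (1 + t) / (1 - t)" if "0 < t" "t < x" for t
    using that x by (auto intro!: frac_less)
  from this[OF t0 t] have "(1 + ?t) / (1 - ?t) < (1 + x) / (1 - x)" "0 < (1 + ?t) / (1 - ?t)" by auto
  then have "artanh ?t < artanh x" unfolding artanh_def by simp
  then show ?thesis by (simp add: artanh_tanh_real)
qed

context regular_weights
begin

lemma is_z_star_iff: "0 \<le> \<beta> \<Longrightarrow> is_z_star M W \<beta> B z \<longleftrightarrow> mean_field.maximizer M (V \<beta>) B z"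
  and fixed_point_eq_iff: "0 \<le> \<beta> \<Longrightarrow> fixed_point_eq M W \<beta> B z \<longleftrightarrow> mean_field.response M (V \<beta>) z B = z"
proof -
  assume \<beta>: "0 \<le> \<beta>"
  interpret mf: mean_field M "V \<beta>" by (rule mean_field[OF \<beta>])
  have "pressure_functional M W \<beta> B z = mf.functional z B" for z
    by (simp add: pressure_functional_def mf.functional_def)
  then show "is_z_star M W \<beta> B z \<longleftrightarrow> mf.maximizer B z"
    by (auto simp: is_z_star_def is_arg_max_def mf.maximizer_def not_less)
  show "fixed_point_eq M W \<beta> B z \<longleftrightarrow> mf.response z B = z"
    unfolding fixed_point_eq_def mf.response_def by (rule eq_commute)
qed

lemma moments:
  assumes "0 \<le> \<beta>"
  shows "(\<integral>x. (scale \<beta> * W x)\<^sup>2 \<partial>M) = sinh \<beta> * nu M W"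
    and "(\<integral>x. scale \<beta> * W x \<partial>M)\<^sup>2 = sinh \<beta> * EW"
proof -
  have "0 \<le> sinh \<beta> / EW" using assms EW_pos by simp
  then have s: "(scale \<beta>)\<^sup>2 = sinh \<beta> / EW" by (rule real_sqrt_pow2)
  show "(\<integral>x. (scale \<beta> * W x)\<^sup>2 \<partial>M) = sinh \<beta> * nu M W"
    unfolding power_mult_distrib s by (simp add: nu_def)
  have "(\<integral>x. scale \<beta> * W x \<partial>M)\<^sup>2 = (scale \<beta>)\<^sup>2 * EW\<^sup>2" by (simp add: power_mult_distrib)
  then show "(\<integral>x. scale \<beta> * W x \<partial>M)\<^sup>2 = sinh \<beta> * EW"
    unfolding s using EW_pos by (simp add: power2_eq_square)
qed

lemma nu_pos: "0 < nu M W"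
proof -
  interpret prob_space M by (rule prob_M)
  have "EW2 \<noteq> 0"
  proof
    assume "EW2 = 0"
    then have "AE x in M. (W x)\<^sup>2 = 0"
      using integral_nonneg_eq_0_iff_AE[OF W_int2] by simp
    then have "EW = (\<integral>x. 0 \<partial>M)" by (intro integral_cong_AE) auto
    then show False using EW_pos by simp
  qed
  moreover have "0 \<le> EW2" by (rule integral_nonneg_AE) simp
  ultimately have "0 < EW2" by linarith
  then show ?thesis using EW_pos by (simp add: nu_def)
qed

lemma pressure_eq:
  assumes "0 \<le> \<beta>" "mean_field.maximizer M (V \<beta>) B z"
  shows "pressure w \<beta> B = ln 2 + alpha w \<beta> + F \<beta> z B"
  unfolding pressure_def by (rule limI[OF pressure_limit[OF assms]])

lemma pressure_converges:
  assumes \<beta>: "0 \<le> \<beta>" shows "(\<lambda>N. pressure_N w N \<beta> B) \<longlonglongrightarrow> pressure w \<beta> B"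
  using mean_field.maximizer_exists[OF mean_field[OF \<beta>]] pressure_limit[OF \<beta>] pressure_eq[OF \<beta>] by metis

text \<open>
  Two applications of \<open>derivative_of_limit\<close>, on an interval around \<open>B\<close> that avoids \<open>0\<close>: to the pressures with the
  magnetizations as derivatives, and to the magnetizations with the susceptibilities as derivatives.
\<close>

lemma magnetization_limit:
  assumes \<beta>: "0 \<le> \<beta>" and B: "B \<noteq> 0"
  shows "(\<lambda>N. magnetization_N w N \<beta> B) \<longlonglongrightarrow> magnetization w \<beta> B"
    and "(pressure w \<beta> has_real_derivative magnetization w \<beta> B) (at B)"
    and "(\<lambda>N. susceptibility_N w N \<beta> B) \<longlonglongrightarrow> susceptibility w \<beta> B"
    and "(magnetization w \<beta> has_real_derivative susceptibility w \<beta> B) (at B)"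
proof -
  define a where "a = min (B / 2) (2 * B)"
  define b where "b = max (B / 2) (2 * B)"
  have ab: "0 < a * b" "a < b" "B \<in> {a<..<b}" using B by (auto simp: a_def b_def min_def max_def zero_less_mult_iff)
  obtain L where L: "\<And>N x y. x \<in> {a<..<b} \<Longrightarrow> y \<in> {a<..<b} \<Longrightarrow>
      \<bar>magnetization_N w N \<beta> x - magnetization_N w N \<beta> y\<bar> \<le> L * \<bar>x - y\<bar>"
    "\<And>N x y. x \<in> {a<..<b} \<Longrightarrow> y \<in> {a<..<b} \<Longrightarrow>
      \<bar>susceptibility_N w N \<beta> x - susceptibility_N w N \<beta> y\<bar> \<le> L * \<bar>x - y\<bar>"
    using magnetization_N_lipschitz[OF \<beta> ab(1,2)] by blast
  have m: "(\<lambda>N. magnetization_N w N \<beta> x) \<longlonglongrightarrow> magnetization w \<beta> x \<and> (pressure w \<beta> has_real_derivative magnetization w \<beta> x) (at x)"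
    if x: "x \<in> {a<..<b}" for x
  proof -
    have "\<exists>D. (\<lambda>N. magnetization_N w N \<beta> x) \<longlonglongrightarrow> D \<and> (pressure w \<beta> has_real_derivative D) (at x)"
      by (rule derivative_of_limit[where f = "\<lambda>N. pressure_N w N \<beta>", OF pressure_converges[OF \<beta>] pressure_N_DERIV[OF \<beta>] L(1) x])
    then show ?thesis unfolding magnetization_def using limI by blast
  qed
  show "(\<lambda>N. magnetization_N w N \<beta> B) \<longlonglongrightarrow> magnetization w \<beta> B"
    "(pressure w \<beta> has_real_derivative magnetization w \<beta> B) (at B)" using m[OF ab(3)] by auto
  have "\<exists>D. (\<lambda>N. susceptibility_N w N \<beta> B) \<longlonglongrightarrow> D \<and> (magnetization w \<beta> has_real_derivative D) (at B)"
    by (rule derivative_of_limit[where f = "\<lambda>N. magnetization_N w N \<beta>", OF _ magnetization_N_DERIV L(2) ab(3)])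
      (use m in auto)
  then show "(\<lambda>N. susceptibility_N w N \<beta> B) \<longlonglongrightarrow> susceptibility w \<beta> B"
    "(magnetization w \<beta> has_real_derivative susceptibility w \<beta> B) (at B)"
    unfolding susceptibility_def using limI by blast+
qed

text \<open>
  The pressure is already known to be differentiable, so any maximizer determines its derivative.
\<close>

lemma magnetization_eq:
  assumes \<beta>: "0 \<le> \<beta>" and B: "B \<noteq> 0" and max: "mean_field.maximizer M (V \<beta>) B z"
  shows "magnetization w \<beta> B = mean_field.mean_spin M (V \<beta>) z B"
proof -
  interpret mf: mean_field M "V \<beta>" by (rule mean_field[OF \<beta>])
  show ?thesis
  proof (rule mf.envelope[OF max, where K = "ln 2 + alpha w \<beta>" and \<psi> = "pressure w \<beta>"])
    show "mf.functional z C + (ln 2 + alpha w \<beta>) \<le> pressure w \<beta> C" for C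
    proof -
      obtain y where y: "mf.maximizer C y" using mf.maximizer_exists by blast
      then have "mf.functional z C \<le> mf.functional y C" by (simp add: mf.maximizer_def)
      then show ?thesis by (simp add: pressure_eq[OF \<beta> y])
    qed
    show "pressure w \<beta> B = mf.functional z B + (ln 2 + alpha w \<beta>)" by (simp add: pressure_eq[OF \<beta> max])
  qed (rule magnetization_limit(2)[OF \<beta> B])
qed

lemma magnetization_zero:
  assumes \<beta>: "0 \<le> \<beta>"
  shows "(\<lambda>N. magnetization_N w N \<beta> 0) \<longlonglongrightarrow> magnetization w \<beta> 0" "magnetization w \<beta> 0 = 0"
proof -
  have "magnetization_N w N \<beta> 0 = 0" for N using magnetization_N_minus[OF \<beta>, of N 0] by simp
  then have "(\<lambda>N. magnetization_N w N \<beta> 0) \<longlonglongrightarrow> 0" by simp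
  moreover from this show "magnetization w \<beta> 0 = 0" unfolding magnetization_def by (rule limI)
  ultimately show "(\<lambda>N. magnetization_N w N \<beta> 0) \<longlonglongrightarrow> magnetization w \<beta> 0" by simp
qed

lemma magnetization_odd:
  assumes \<beta>: "0 \<le> \<beta>" and B: "B \<noteq> 0" shows "magnetization w \<beta> (- B) = - magnetization w \<beta> B"
proof -
  have "(\<lambda>N. magnetization_N w N \<beta> (- B)) \<longlonglongrightarrow> - magnetization w \<beta> B"
    unfolding magnetization_N_minus[OF \<beta>] by (intro tendsto_intros magnetization_limit(1)[OF \<beta> B])
  then show ?thesis unfolding magnetization_def[of w \<beta> "- B"] by (rule limI)
qed

text \<open>
  The magnetization is nonnegative and increasing for \<open>B > 0\<close>, so the limit exists for every \<open>\<beta>\<close>, including the critical one.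
\<close>

lemma spontaneous_magnetization_limit:
  assumes \<beta>: "0 \<le> \<beta>"
  shows "((\<lambda>B. magnetization w \<beta> B) \<longlongrightarrow> spontaneous_magnetization w \<beta>) (at_right 0)"
proof -
  interpret mf: mean_field M "V \<beta>" by (rule mean_field[OF \<beta>])
  let ?m = "magnetization w \<beta>"
  have mono: "?m B \<le> ?m C" if "0 < B" "B < C" for B C
  proof -
    obtain y z where "mf.maximizer B y" "mf.maximizer C z" using mf.maximizer_exists by blast
    then show ?thesis using that by (simp add: magnetization_eq[OF \<beta>] mf.mean_spin_mono)
  qed
  have nonneg: "0 \<le> ?m B" if "0 < B" for B
  proof (rule LIMSEQ_le_const)
    show "(\<lambda>N. magnetization_N w N \<beta> B) \<longlonglongrightarrow> ?m B" using that by (intro magnetization_limit(1) \<beta>) auto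
  qed (use magnetization_N_nonneg[OF \<beta> that] in auto)
  define I where "I = Inf (?m ` {0<..})"
  have bdd: "bdd_below (?m ` {0<..})" using nonneg by (intro bdd_belowI[of _ 0]) auto
  have "(?m \<longlongrightarrow> I) (at_right 0)"
  proof (rule decreasing_tendsto)
    show "\<forall>\<^sub>F B in at_right 0. I \<le> ?m B"
      using eventually_at_right_less[of "0::real"] by eventually_elim (auto simp: I_def intro!: cInf_lower bdd)
    fix x assume "I < x"
    then obtain C where C: "0 < C" "?m C < x"
      unfolding I_def using cInf_lessD[of "?m ` {0<..}" x] by auto
    show "\<forall>\<^sub>F B in at_right 0. ?m B < x"
      using eventually_at_right_real[OF C(1)] by eventually_elim (use mono[of _ C] C in force)
  qed
  then show ?thesis
    unfolding spontaneous_magnetization_def by (simp add: tendsto_Lim)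
qed

lemma magnetization_slope:
  assumes \<beta>: "0 \<le> \<beta>" and sub: "sinh \<beta> * nu M W < 1"
  shows "((\<lambda>B. magnetization w \<beta> B / B) \<longlongrightarrow> 1 + sinh \<beta> * EW / (1 - sinh \<beta> * nu M W)) (at_right 0)"
proof -
  interpret mf: mean_field M "V \<beta>" by (rule mean_field[OF \<beta>])
  define z where "z B = (SOME z. mf.maximizer B z)" for B
  have z: "mf.maximizer B (z B)" for B unfolding z_def using mf.maximizer_exists by (rule someI_ex)
  have "((\<lambda>B. mf.mean_spin (z B) B / B) \<longlongrightarrow> 1 + mf.m1\<^sup>2 / (1 - mf.m2)) (at_right 0)"
    using sub z mf.maximizer_fixed_point mf.maximizer_nonneg
    by (intro mf.mean_spin_slope) (auto simp only: moments[OF \<beta>])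
  then have "((\<lambda>B. mf.mean_spin (z B) B / B) \<longlongrightarrow> 1 + sinh \<beta> * EW / (1 - sinh \<beta> * nu M W)) (at_right 0)"
    unfolding moments[OF \<beta>] .
  then show ?thesis
  proof (rule Lim_transform_eventually)
    show "\<forall>\<^sub>F B in at_right 0. mf.mean_spin (z B) B / B = magnetization w \<beta> B / B"
      using eventually_at_right_less[of "0::real"]
      by eventually_elim (simp add: magnetization_eq[OF \<beta> _ z])
  qed
qed

lemma spontaneous_magnetization_subcritical:
  assumes \<beta>: "0 \<le> \<beta>" and sub: "sinh \<beta> * nu M W < 1"
  shows "spontaneous_magnetization w \<beta> = 0"
proof -
  have id: "((\<lambda>B::real. B) \<longlongrightarrow> 0) (at_right 0)" by (rule tendsto_ident_at)
  have "((\<lambda>B. magnetization w \<beta> B / B * B) \<longlongrightarrow> 0) (at_right 0)"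
    using tendsto_mult[OF magnetization_slope[OF assms] id] by simp
  then have "((\<lambda>B. magnetization w \<beta> B) \<longlongrightarrow> 0) (at_right 0)"
    by (rule Lim_transform_eventually)
      (use eventually_at_right_less[of "0::real"] in eventually_elim, auto)
  then show ?thesis
    by (rule tendsto_unique[OF trivial_limit_at_right_real spontaneous_magnetization_limit[OF \<beta>]])
qed

lemma spontaneous_magnetization_supercritical:
  assumes \<beta>: "0 \<le> \<beta>" and super: "1 < sinh \<beta> * nu M W"
  shows "0 < spontaneous_magnetization w \<beta>"
proof -
  interpret mf: mean_field M "V \<beta>" by (rule mean_field[OF \<beta>])
  have "1 < mf.m2" using super unfolding moments[OF \<beta>] .
  then obtain c where c: "c > 0" "\<And>B z. B > 0 \<Longrightarrow> mf.response z B = z \<Longrightarrow> 0 \<le> z \<Longrightarrow> c \<le> mf.mean_spin z B"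
    using mf.fixed_point_bounded_away by blast
  have "c \<le> magnetization w \<beta> B" if B: "0 < B" for B
  proof -
    obtain z where z: "mf.maximizer B z" using mf.maximizer_exists by blast
    then show ?thesis
      using c(2)[OF B mf.maximizer_fixed_point[OF z] mf.maximizer_nonneg[OF B z]] B
      by (simp add: magnetization_eq[OF \<beta> _ z])
  qed
  then have "\<forall>\<^sub>F B in at_right 0. c \<le> magnetization w \<beta> B"
    using eventually_at_right_less[of "0::real"] by (auto elim: eventually_mono)
  then have "c \<le> spontaneous_magnetization w \<beta>"
    using spontaneous_magnetization_limit[OF \<beta>] by (intro tendsto_lowerbound) auto
  then show ?thesis using c(1) by simp
qed

lemma sinh_nu_less_iff: "sinh \<beta> * nu M W < 1 \<longleftrightarrow> \<beta> < arsinh (1 / nu M W)"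
  and sinh_nu_greater_iff: "1 < sinh \<beta> * nu M W \<longleftrightarrow> arsinh (1 / nu M W) < \<beta>"
proof -
  have "sinh \<beta> * nu M W < 1 \<longleftrightarrow> sinh \<beta> < sinh (arsinh (1 / nu M W))"
    using nu_pos by (simp add: pos_less_divide_eq)
  then show "sinh \<beta> * nu M W < 1 \<longleftrightarrow> \<beta> < arsinh (1 / nu M W)" by (simp only: sinh_real_less_iff)
  have "1 < sinh \<beta> * nu M W \<longleftrightarrow> sinh (arsinh (1 / nu M W)) < sinh \<beta>"
    using nu_pos by (simp add: pos_divide_less_eq)
  then show "1 < sinh \<beta> * nu M W \<longleftrightarrow> arsinh (1 / nu M W) < \<beta>" by (simp only: sinh_real_less_iff)
qed

text \<open>
  The set under the infimum lies between the open and the closed half-line starting at \<open>arsinh (1 / \<nu>)\<close>.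
\<close>

lemma beta_c_an_eq: "beta_c_an w = arsinh (1 / nu M W)"
  unfolding beta_c_an_def
proof (rule cInf_eq_non_empty)
  let ?S = "{\<beta>. 0 < \<beta> \<and> 0 < spontaneous_magnetization w \<beta>}"
  have c: "0 < arsinh (1 / nu M W)" using nu_pos by simp
  have mem: "\<beta> \<in> ?S" if "arsinh (1 / nu M W) < \<beta>" for \<beta>
    using spontaneous_magnetization_supercritical[of \<beta>] that less_trans[OF c that] unfolding sinh_nu_greater_iff by simp
  then show "?S \<noteq> {}" using gt_ex by blast
  show "arsinh (1 / nu M W) \<le> \<beta>" if "\<beta> \<in> ?S" for \<beta>
    using spontaneous_magnetization_subcritical[of \<beta>] that unfolding sinh_nu_less_iff by force
  show "y \<le> arsinh (1 / nu M W)" if "\<And>\<beta>. \<beta> \<in> ?S \<Longrightarrow> y \<le> \<beta>" for y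
    by (rule dense_ge) (rule that[OF mem])
qed

text \<open>
  At \<open>B = 0\<close> the Lee-Yang bounds degenerate; the quadratic bound on the variational formula replaces them.
\<close>

lemma pressure_DERIV_zero:
  assumes \<beta>: "0 \<le> \<beta>" and sub: "sinh \<beta> * nu M W < 1"
  shows "(pressure w \<beta> has_real_derivative 0) (at 0)"
proof (rule DERIV_of_quadratic_error, rule always_eventually, rule allI)
  interpret mf: mean_field M "V \<beta>" by (rule mean_field[OF \<beta>])
  have m2: "mf.m2 < 1" using sub unfolding moments[OF \<beta>] .
  let ?C = "mf.m2 * (mf.m1 / (1 - mf.m2))\<^sup>2 + 2 * mf.m1 * (mf.m1 / (1 - mf.m2)) + 1"
  fix B
  obtain z where z: "mf.maximizer B z" using mf.maximizer_exists by blast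
  have 0: "mf.maximizer 0 0" using mf.maximizer_zero_field[OF m2] by simp
  show "\<bar>pressure w \<beta> B - pressure w \<beta> 0 - 0 * (B - 0)\<bar> \<le> ?C * (B - 0)\<^sup>2"
    using mf.functional_quadratic_near_zero[OF m2 z] unfolding pressure_eq[OF \<beta> z] pressure_eq[OF \<beta> 0] by simp
qed

text \<open>
  The right-sided slope comes from the variational problem and the left-sided one from oddness.
\<close>

lemma magnetization_DERIV_zero:
  assumes \<beta>: "0 \<le> \<beta>" and sub: "sinh \<beta> * nu M W < 1"
  shows "(magnetization w \<beta> has_real_derivative 1 + sinh \<beta> * EW / (1 - sinh \<beta> * nu M W)) (at 0)"
proof -
  let ?m = "magnetization w \<beta>" and ?\<chi> = "1 + sinh \<beta> * EW / (1 - sinh \<beta> * nu M W)"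
  have R: "((\<lambda>B. ?m B / B) \<longlongrightarrow> ?\<chi>) (at_right 0)" by (rule magnetization_slope[OF assms])
  have "((\<lambda>B. ?m (- B) / (- B)) \<longlongrightarrow> ?\<chi>) (at_right 0)"
    using R by (rule Lim_transform_eventually)
      (use eventually_at_right_less[of "0::real"] in eventually_elim, simp add: magnetization_odd[OF \<beta>])
  then have "((\<lambda>B. ?m B / B) \<longlongrightarrow> ?\<chi>) (at_left 0)" by (simp add: at_left_minus filterlim_filtermap)
  then have "((\<lambda>B. ?m B / B) \<longlongrightarrow> ?\<chi>) (at 0)" using R by (simp add: filterlim_split_at)
  then show ?thesis unfolding DERIV_def using magnetization_zero[OF \<beta>] by simp
qed

text \<open>
  For the lower bound, fix \<open>B > 0\<close> with \<open>2 M(B) / sinh 2B\<close> close to the slope of \<open>M\<close> at \<open>0\<close> and let \<open>N\<close> tend to infinity in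
  \<open>susceptibility_N_zero_ge\<close>. The upper bound is the limit of \<open>susceptibility_N_zero_le\<close>.
\<close>

lemma susceptibility_zero:
  assumes \<beta>: "0 \<le> \<beta>" and sub: "sinh \<beta> * nu M W < 1"
  shows "(\<lambda>N. susceptibility_N w N \<beta> 0) \<longlonglongrightarrow> 1 + sinh \<beta> * EW / (1 - sinh \<beta> * nu M W)" (is "_ \<longlonglongrightarrow> ?\<chi>")
proof (rule order_tendstoI)
  fix x assume x: "x < ?\<chi>"
  let ?m = "magnetization w \<beta>"
  have "((\<lambda>B::real. sinh (2 * B)) has_real_derivative 2) (at 0)"
    by (auto intro!: derivative_eq_intros)
  then have "((\<lambda>B::real. sinh (2 * B) / B) \<longlongrightarrow> 2) (at 0)" by (simp add: DERIV_def)
  then have "((\<lambda>B::real. sinh (2 * B) / B) \<longlongrightarrow> 2) (at_right 0)"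
    by (rule filterlim_mono) (auto simp: at_within_le_at)
  then have "((\<lambda>B. 2 * (?m B / B) / (sinh (2 * B) / B)) \<longlongrightarrow> 2 * ?\<chi> / 2) (at_right 0)"
    by (intro tendsto_divide tendsto_mult tendsto_const magnetization_slope[OF assms]) auto
  moreover have "2 * ?\<chi> / 2 = ?\<chi>" by (rule nonzero_mult_div_cancel_left) simp
  ultimately have "((\<lambda>B. 2 * (?m B / B) / (sinh (2 * B) / B)) \<longlongrightarrow> ?\<chi>) (at_right 0)" by (simp only:)
  from order_tendstoD(1)[OF this x] eventually_at_right_less[of "0::real"]
  have "\<forall>\<^sub>F B in at_right 0. 0 < B \<and> x < 2 * ?m B / sinh (2 * B)" by eventually_elim auto
  then obtain B where B: "0 < B" "x < 2 * ?m B / sinh (2 * B)"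
    using eventually_happens' trivial_limit_at_right_real by blast
  have "(\<lambda>N. 2 * magnetization_N w N \<beta> B / sinh (2 * B)) \<longlonglongrightarrow> 2 * ?m B / sinh (2 * B)"
    using B by (intro tendsto_intros magnetization_limit(1)[OF \<beta>]) auto
  from order_tendstoD(1)[OF this B(2)]
  show "\<forall>\<^sub>F N in sequentially. x < susceptibility_N w N \<beta> 0"
    by eventually_elim (use susceptibility_N_zero_ge[OF \<beta> B(1)] in \<open>auto intro: less_le_trans\<close>)
next
  fix x assume x: "?\<chi> < x"
  let ?q = "\<lambda>N. sum_sq N / total_weight w N"
  have q: "(\<lambda>N. sinh \<beta> * ?q N) \<longlonglongrightarrow> sinh \<beta> * nu M W"
    unfolding nu_def by (intro tendsto_intros sum_sq_over_total)
  have "(\<lambda>N. 1 + sinh \<beta> * (total_weight w N / real N) / (1 - sinh \<beta> * ?q N)) \<longlonglongrightarrow> ?\<chi>"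
    using sub by (intro tendsto_intros q total_weight_over_N) auto
  from order_tendstoD(2)[OF this x] order_tendstoD(2)[OF q sub] eventually_gt_at_top[of 0]
  show "\<forall>\<^sub>F N in sequentially. susceptibility_N w N \<beta> 0 < x"
  proof eventually_elim
    case (elim N)
    then show ?case using susceptibility_N_zero_le[OF \<beta>, of N] by (simp add: sum_sq_def)
  qed
qed

end

theorem theorem1p1:
  fixes w :: "nat \<Rightarrow> nat \<Rightarrow> real"
    and M :: "'a measure"
    and W :: "'a \<Rightarrow> real"
  assumes weights_pos: "\<And>N i. i \<in> {1..N} \<Longrightarrow> w N i > 0"
    and regular: "weight_regularity w M W"
  shows
    "(\<forall>\<beta> B. \<beta> \<ge> 0 \<longrightarrow>
        (\<lambda>N. 1 / real N * ln (G2 w N \<beta>)) \<longlonglongrightarrow> alpha w \<beta> \<and>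
        (\<lambda>N. pressure_N w N \<beta> B) \<longlonglongrightarrow> pressure w \<beta> B \<and>
        (\<exists>z. is_z_star M W \<beta> B z) \<and>
        (\<forall>z. is_z_star M W \<beta> B z \<longrightarrow>
           fixed_point_eq M W \<beta> B z \<and>
           pressure w \<beta> B =
             ln 2 + alpha w \<beta>
             + (\<integral>\<omega>. ln (cosh (sqrt (sinh \<beta> / (\<integral>\<omega>. W \<omega> \<partial>M)) * W \<omega> * z + B)) \<partial>M) - z\<^sup>2 / 2)) \<and>

     (\<forall>(\<beta>, B) \<in> uniqueness_regime w.
        (\<lambda>N. magnetization_N w N \<beta> B) \<longlonglongrightarrow> magnetization w \<beta> B \<and>
        (\<exists>!z. is_z_star M W \<beta> B z) \<and>
        (B \<noteq> 0 \<longrightarrow>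
           (pressure w \<beta> has_real_derivative magnetization w \<beta> B) (at B) \<and>
           (\<forall>z. is_z_star M W \<beta> B z \<longleftrightarrow> fixed_point_eq M W \<beta> B z \<and> B * z \<ge> 0) \<and>
           (\<forall>z. is_z_star M W \<beta> B z \<longrightarrow>
              magnetization w \<beta> B =
                (\<integral>\<omega>. tanh (sqrt (sinh \<beta> / (\<integral>\<omega>. W \<omega> \<partial>M)) * W \<omega> * z + B) \<partial>M)))) \<and>

     (\<forall>\<beta>\<ge>0.
        ((\<lambda>B. magnetization w \<beta> B) \<longlongrightarrow> spontaneous_magnetization w \<beta>) (at_right 0) \<and>
        ((\<beta>, 0) \<in> uniqueness_regime w \<longrightarrow> spontaneous_magnetization w \<beta> = 0) \<and>
        ((\<beta>, 0) \<notin> uniqueness_regime w \<and> \<beta> \<noteq> 0 \<and> \<beta> \<noteq> beta_c_an w \<longrightarrow>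
           spontaneous_magnetization w \<beta> \<noteq> 0)) \<and>
     beta_c_an w = arsinh (1 / nu M W) \<and>
     (nu M W > 1 \<longrightarrow> beta_c_an w < beta_c_qu M W) \<and>

     (\<forall>(\<beta>, B) \<in> uniqueness_regime w.
        (\<lambda>N. susceptibility_N w N \<beta> B) \<longlonglongrightarrow> susceptibility w \<beta> B \<and>
        (\<forall>\<^sub>F b in nhds B. pressure w \<beta> field_differentiable at b) \<and>
        (deriv (pressure w \<beta>) has_real_derivative susceptibility w \<beta> B) (at B))"
proof -
  interpret regular_weights w M W
    by unfold_locales (fact weights_pos, fact regular)
  have regime: "0 \<le> \<beta>" "B = 0 \<Longrightarrow> sinh \<beta> * nu M W < 1" if "(\<beta>, B) \<in> uniqueness_regime w" for \<beta> B
    using that by (auto simp: uniqueness_regime_def beta_c_an_eq sinh_nu_less_iff)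
  have regime0: "(\<beta>, 0) \<in> uniqueness_regime w \<longleftrightarrow> 0 < \<beta> \<and> sinh \<beta> * nu M W < 1" for \<beta>
    by (auto simp: uniqueness_regime_def beta_c_an_eq sinh_nu_less_iff)
  show ?thesis
    unfolding Ball_def split_paired_All prod.case
  proof (intro conjI allI impI)
    fix \<beta> B z :: real assume \<beta>: "0 \<le> \<beta>"
    show "(\<lambda>N. 1 / real N * ln (G2 w N \<beta>)) \<longlonglongrightarrow> alpha w \<beta>"
      unfolding alpha_eq[OF \<beta>] by (rule G2_limit[OF \<beta>])
    show "(\<lambda>N. pressure_N w N \<beta> B) \<longlonglongrightarrow> pressure w \<beta> B" by (rule pressure_converges[OF \<beta>])
    show "\<exists>z. is_z_star M W \<beta> B z"
      unfolding is_z_star_iff[OF \<beta>] by (rule mean_field.maximizer_exists[OF mean_field[OF \<beta>]])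
    assume "is_z_star M W \<beta> B z"
    then have z: "mean_field.maximizer M (V \<beta>) B z" by (simp add: is_z_star_iff[OF \<beta>])
    show "fixed_point_eq M W \<beta> B z"
      unfolding fixed_point_eq_iff[OF \<beta>] by (rule mean_field.maximizer_fixed_point[OF mean_field[OF \<beta>] z])
    show "pressure w \<beta> B = ln 2 + alpha w \<beta>
        + (\<integral>\<omega>. ln (cosh (sqrt (sinh \<beta> / (\<integral>\<omega>. W \<omega> \<partial>M)) * W \<omega> * z + B)) \<partial>M) - z\<^sup>2 / 2"
      unfolding pressure_eq[OF \<beta> z] mean_field.functional_def[OF mean_field[OF \<beta>]] by simp
  next
    fix \<beta> B assume U: "(\<beta>, B) \<in> uniqueness_regime w"
    note \<beta> = regime(1)[OF U]
    interpret mf: mean_field M "V \<beta>" by (rule mean_field[OF \<beta>])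
    show "(\<lambda>N. magnetization_N w N \<beta> B) \<longlonglongrightarrow> magnetization w \<beta> B"
      using magnetization_limit(1)[OF \<beta>] magnetization_zero(1)[OF \<beta>] by (cases "B = 0") auto
    show "\<exists>!z. is_z_star M W \<beta> B z"
      unfolding is_z_star_iff[OF \<beta>]
    proof (cases "B = 0")
      case True
      then have "mf.m2 < 1" using regime(2)[OF U] unfolding moments[OF \<beta>] by simp
      from mf.maximizer_zero_field[OF this] show "\<exists>!z. mf.maximizer B z" unfolding True by simp
    qed (rule mf.maximizer_unique)
    {
      assume B: "B \<noteq> 0"
      show "(pressure w \<beta> has_real_derivative magnetization w \<beta> B) (at B)"
        by (rule magnetization_limit(2)[OF \<beta> B])
      fix z
      show "is_z_star M W \<beta> B z \<longleftrightarrow> fixed_point_eq M W \<beta> B z \<and> B * z \<ge> 0"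
        unfolding is_z_star_iff[OF \<beta>] fixed_point_eq_iff[OF \<beta>] by (rule mf.maximizer_iff_fixed_point[OF B])
      assume "is_z_star M W \<beta> B z"
      then show "magnetization w \<beta> B = (\<integral>\<omega>. tanh (sqrt (sinh \<beta> / (\<integral>\<omega>. W \<omega> \<partial>M)) * W \<omega> * z + B) \<partial>M)"
        unfolding is_z_star_iff[OF \<beta>] using magnetization_eq[OF \<beta> B] by (simp add: mf.mean_spin_def)
    }
    have D: "(pressure w \<beta> has_real_derivative magnetization w \<beta> b) (at b)" if "B = 0 \<or> b \<noteq> 0" for b
      using magnetization_limit(2)[OF \<beta>] pressure_DERIV_zero[OF \<beta> regime(2)[OF U]] magnetization_zero(2)[OF \<beta>] that
      by (cases "b = 0") auto
    have near: "\<forall>\<^sub>F b in nhds B. B = 0 \<or> b \<noteq> 0"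
      by (cases "B = 0") (use t1_space_nhds[of B 0] in auto)
    show "\<forall>\<^sub>F b in nhds B. pressure w \<beta> field_differentiable at b"
      using near by eventually_elim (use D in \<open>auto simp: field_differentiable_def\<close>)
    have "(\<lambda>N. susceptibility_N w N \<beta> B) \<longlonglongrightarrow> susceptibility w \<beta> B
        \<and> (magnetization w \<beta> has_real_derivative susceptibility w \<beta> B) (at B)"
    proof (cases "B = 0")
      case True
      note sub = regime(2)[OF U True]
      have "susceptibility w \<beta> 0 = 1 + sinh \<beta> * EW / (1 - sinh \<beta> * nu M W)"
        unfolding susceptibility_def by (rule limI[OF susceptibility_zero[OF \<beta> sub]])
      then show ?thesis
        using susceptibility_zero[OF \<beta> sub] magnetization_DERIV_zero[OF \<beta> sub] unfolding True by simp
    qed (use magnetization_limit(3,4)[OF \<beta>] in blast)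
    then have \<chi>: "(\<lambda>N. susceptibility_N w N \<beta> B) \<longlonglongrightarrow> susceptibility w \<beta> B"
      "(magnetization w \<beta> has_real_derivative susceptibility w \<beta> B) (at B)" by auto
    show "(\<lambda>N. susceptibility_N w N \<beta> B) \<longlonglongrightarrow> susceptibility w \<beta> B" by (rule \<chi>)
    have "\<forall>\<^sub>F b in nhds B. magnetization w \<beta> b = deriv (pressure w \<beta>) b"
      using near by eventually_elim (rule DERIV_imp_deriv[symmetric, OF D])
    from DERIV_cong_ev[OF refl this refl] \<chi>(2)
    show "(deriv (pressure w \<beta>) has_real_derivative susceptibility w \<beta> B) (at B)" by simp
  next
    fix \<beta> :: real assume \<beta>: "0 \<le> \<beta>"
    show "((\<lambda>B. magnetization w \<beta> B) \<longlongrightarrow> spontaneous_magnetization w \<beta>) (at_right 0)"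
      by (rule spontaneous_magnetization_limit[OF \<beta>])
    show "spontaneous_magnetization w \<beta> = 0" if "(\<beta>, 0) \<in> uniqueness_regime w"
      using that spontaneous_magnetization_subcritical[OF \<beta>] regime0 by blast
    show "spontaneous_magnetization w \<beta> \<noteq> 0"
      if "(\<beta>, 0) \<notin> uniqueness_regime w \<and> \<beta> \<noteq> 0 \<and> \<beta> \<noteq> beta_c_an w"
    proof -
      have "arsinh (1 / nu M W) < \<beta>"
        using that \<beta> unfolding regime0 sinh_nu_less_iff beta_c_an_eq by auto
      then show ?thesis using spontaneous_magnetization_supercritical[OF \<beta>] unfolding sinh_nu_greater_iff by simp
    qed
  next
    show "beta_c_an w = arsinh (1 / nu M W)" by (rule beta_c_an_eq)
    show "beta_c_an w < beta_c_qu M W" if "1 < nu M W"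
      unfolding beta_c_an_eq beta_c_qu_def using that by (auto intro!: arsinh_less_artanh)
  qed
qed

end
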